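(* Let $n$ be a sample size, let parameters $\beta,\sigma,\Sigma$ of the Gaussian linear model described in the context be fixed, and let $m$ be a model with $|m|<n-1$. Then for each $\epsilon>0$, $$P_{n,\beta,\sigma,\Sigma}\bigl(|\hat\rho^2(m)-\rho^2(m)|>\epsilon\bigr)\;\le\;4\exp\left[-n\left(1-\frac{|m|}{n}\right)\Psi\left(\frac{\epsilon}{2\sigma^2(m)}\left(1-\frac{|m|}{n}\right)\right)\right],$$ where $\Psi(x)=\frac18\left(\frac{x}{x+1}\right)^2$ for $x\ge 0$. In the case $\sigma^2(m)=0$, the upper bound is to be interpreted as zero.
   Context: Model. A response $y$ satisfies $y=\sum_{j=1}^\infty x_j\beta_j+u$, where $\beta=(\beta_j)_{j\ge1}$ is a real sequence; $u$ has mean zero and variance $\sigma^2\ge0$; the random sequence $x=(x_j)_{j\ge1}$ has mean zero and covariances $\Sigma=[E(x_ix_j)]_{i,j\ge1}$; the series converges in squared mean; each $x_j$ is uncorrelated with $u$; and for all $k\ge1$ and $j_1<\dots<j_k$ the covariance matrix of $(x_{j_1},\dots,x_{j_k})'$ is positive definite. All these random variables ($y$, $u$ and $x_j$, $j\ge1$) are assumed jointly Gaussian. Sample. $(Y,X)$ consists of $n$ i.i.d. copies $(y^{(i)},x^{(i)})$, $i=1,\dots,n$, of $(y,x)$; $P_{n,\beta,\sigma,\Sigma}$ and $E_{n,\beta,\sigma,\Sigma}$ denote the corresponding probability and expectation. $\mathrm{Var}_{\beta,\sigma,\Sigma}[y]$ is the variance of $y$. Models. A model is a 0-1 sequence $m=(m_j)_{j\ge1}$,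 with $|m|$ the number of ones in $m$ ($|m|=0$ is allowed). The restricted least-squares estimator $\tilde\beta(m)$ has $j$th component zero whenever $m_j=0$; its remaining $|m|$ components are obtained by least-squares regression of $Y=(y^{(1)},\dots,y^{(n)})'$ on the corresponding columns of $X$. The residual sum of squares is $\mathrm{RSS}(m)=\sum_{i=1}^n\bigl(y^{(i)}-x^{(i)\prime}\tilde\beta(m)\bigr)^2$. Prediction error. Let $(y^{(f)},x^{(f)})$ be a copy of $(y,x)$ independent of $(Y,X)$. The conditional mean squared prediction error is $\rho^2(m)=E_{n,\beta,\sigma,\Sigma}\bigl[(y^{(f)}-x^{(f)\prime}\tilde\beta(m))^2\mid Y,X\bigr]$. Estimator. $\hat\rho^2(m)=\dfrac{\mathrm{RSS}(m)}{n-|m|}\cdot\dfrac{n+1}{n+1-|m|}$. Conditional variance. $\sigma^2(m)=\mathrm{Var}_{\beta,\sigma,\Sigma}[y\mid x_j: m_j=1]$, which is non-random by joint Gaussianity. *)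

theory Defs
  imports "HOL-Probability.Probability"
begin

text \<open>Real sequences are indexed from 0, so index \<open>j\<close> here is index \<open>j + 1\<close> in the usual
  numbering; likewise the observations are numbered \<open>0, \<dots>, n - 1\<close>.\<close>

subsection \<open>The Gaussian linear model\<close>

text \<open>A constant counts as a (degenerate) Gaussian variable; this is needed already for \<open>u\<close> when
  \<open>\<sigma> = 0\<close>.\<close>

definition gaussian_rv :: "'a measure \<Rightarrow> ('a \<Rightarrow> real) \<Rightarrow> bool" where
  "gaussian_rv M V \<longleftrightarrow> V \<in> borel_measurable M \<and>
     ((\<exists>\<mu>. AE \<omega> in M. V \<omega> = \<mu>) \<or>
      (\<exists>\<mu> s. s > 0 \<and> distributed M lborel V (\<lambda>t. ennreal (normal_density \<mu> s t))))"

definition jointly_gaussian :: "'a measure \<Rightarrow> ('a \<Rightarrow> real) set \<Rightarrow> bool" where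
  "jointly_gaussian M \<V> \<longleftrightarrow>
     (\<forall>F c. finite F \<longrightarrow> F \<subseteq> \<V> \<longrightarrow> gaussian_rv M (\<lambda>\<omega>. \<Sum>V\<in>F. c V * V \<omega>))"

locale gaussian_linear_model = prob_space P
  for P :: "'p measure" +
  fixes y u :: "'p \<Rightarrow> real"
    and x :: "nat \<Rightarrow> 'p \<Rightarrow> real"
    and \<beta> :: "nat \<Rightarrow> real"
    and \<sigma> :: real
    and \<Sigma> :: "nat \<Rightarrow> nat \<Rightarrow> real"
  assumes gaussian: "jointly_gaussian P ({y, u} \<union> range x)"
    and sigma_nonneg: "\<sigma> \<ge> 0"
    and mean_u: "expectation u = 0"
    and var_u: "variance u = \<sigma>\<^sup>2"
    and mean_x: "\<And>j. expectation (x j) = 0"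
    and cov_x: "\<And>i j. expectation (\<lambda>\<omega>. x i \<omega> * x j \<omega>) = \<Sigma> i j"
    and uncorrelated: "\<And>j. expectation (\<lambda>\<omega>. x j \<omega> * u \<omega>) = 0"
    and pos_def: "\<And>J c. finite J \<Longrightarrow> \<exists>j\<in>J. c j \<noteq> 0 \<Longrightarrow>
                    (\<Sum>i\<in>J. \<Sum>j\<in>J. c i * \<Sigma> i j * c j) > 0"
    \<comment> \<open>\<open>y = (\<Sum>j. x\<^sub>j \<beta>\<^sub>j) + u\<close>, the series converging in squared mean\<close>
    and linear_model:
      "(\<lambda>N. expectation (\<lambda>\<omega>. (y \<omega> - u \<omega> - (\<Sum>j<N. x j \<omega> * \<beta> j))\<^sup>2)) \<longlonglongrightarrow> 0"

subsection \<open>Sample and future observation\<close>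

type_synonym observation = "real \<times> (nat \<Rightarrow> real)"

abbreviation obs_space :: "observation measure" where
  "obs_space \<equiv> borel \<Otimes>\<^sub>M Pi\<^sub>M UNIV (\<lambda>_. borel)"

abbreviation sample_space :: "nat \<Rightarrow> (nat \<Rightarrow> observation) measure" where
  "sample_space n \<equiv> Pi\<^sub>M {..<n} (\<lambda>_. obs_space)"

definition sample :: "nat \<Rightarrow> (nat \<Rightarrow> 'a \<Rightarrow> observation) \<Rightarrow> 'a \<Rightarrow> nat \<Rightarrow> observation" where
  "sample n Z \<omega> = (\<lambda>i\<in>{..<n}. Z i \<omega>)"

text \<open>\<open>Z i\<close> is the pair \<open>(y\<^sup>(\<^sup>i\<^sup>), x\<^sup>(\<^sup>i\<^sup>))\<close>, \<open>Zf\<close> is the future pair, and \<open>D\<close> is the law they share.\<close>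

locale iid_sample_and_future = prob_space M
  for M :: "'a measure" +
  fixes D :: "observation measure"
    and n :: nat
    and Z :: "nat \<Rightarrow> 'a \<Rightarrow> observation"
    and Zf :: "'a \<Rightarrow> observation"
  assumes sample_indep: "indep_vars (\<lambda>_. obs_space) Z {..<n}"
    and sample_law: "\<And>i. i < n \<Longrightarrow> distr M obs_space (Z i) = D"
    and future_rv: "random_variable obs_space Zf"
    and future_indep: "indep_set (sets (vimage_algebra (space M) (sample n Z) (sample_space n)))
                                 (sets (vimage_algebra (space M) Zf obs_space))"
    and future_law: "distr M obs_space Zf = D"

subsection \<open>Models and restricted least squares\<close>

text \<open>A 0-1 sequence is a \<open>nat \<Rightarrow> bool\<close>. All models considered have finite support, so \<open>msize\<close>
  is only used where \<^term>\<open>card\<close> is meaningful, and \<open>x' b\<close> is a finite sum for \<open>b\<close> supported on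
  the model.\<close>

type_synonym model = "nat \<Rightarrow> bool"

definition msize :: "model \<Rightarrow> nat" where
  "msize m = card {j. m j}"

definition prediction_error :: "model \<Rightarrow> observation \<Rightarrow> (nat \<Rightarrow> real) \<Rightarrow> real" where
  "prediction_error m z b = fst z - (\<Sum>j | m j. snd z j * b j)"

definition sum_sq :: "nat \<Rightarrow> model \<Rightarrow> (nat \<Rightarrow> observation) \<Rightarrow> (nat \<Rightarrow> real) \<Rightarrow> real" where
  "sum_sq n m d b = (\<Sum>i<n. (prediction_error m (d i) b)\<^sup>2)"

definition least_squares ::
    "nat \<Rightarrow> model \<Rightarrow> (nat \<Rightarrow> observation) \<Rightarrow> (nat \<Rightarrow> real) \<Rightarrow> bool" where
  "least_squares n m d b \<longleftrightarrow> (\<forall>j. \<not> m j \<longrightarrow> b j = 0) \<and>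
     (\<forall>b'. (\<forall>j. \<not> m j \<longrightarrow> b' j = 0) \<longrightarrow> sum_sq n m d b \<le> sum_sq n m d b')"

text \<open>The minimiser is unique unless the selected columns of the design are linearly dependent.
  For \<open>|m| \<le> n\<close> the latter has probability zero in the model; the estimator is set to zero there,
  which keeps it measurable.\<close>

definition beta_tilde :: "nat \<Rightarrow> model \<Rightarrow> (nat \<Rightarrow> observation) \<Rightarrow> nat \<Rightarrow> real" where
  "beta_tilde n m d =
     (if \<exists>!b. least_squares n m d b then (THE b. least_squares n m d b) else (\<lambda>_. 0))"

definition RSS :: "nat \<Rightarrow> model \<Rightarrow> (nat \<Rightarrow> observation) \<Rightarrow> real" where
  "RSS n m d = sum_sq n m d (beta_tilde n m d)"

definition rho2_hat :: "nat \<Rightarrow> model \<Rightarrow> (nat \<Rightarrow> observation) \<Rightarrow> real" where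
  "rho2_hat n m d = RSS n m d / (real n - real (msize m)) *
     ((real n + 1) / (real n + 1 - real (msize m)))"

definition rho2 :: "'a measure \<Rightarrow> nat \<Rightarrow> (nat \<Rightarrow> 'a \<Rightarrow> observation) \<Rightarrow> ('a \<Rightarrow> observation) \<Rightarrow>
    model \<Rightarrow> 'a \<Rightarrow> real" where
  "rho2 M n Z Zf m =
     real_cond_exp M (vimage_algebra (space M) (sample n Z) (sample_space n))
       (\<lambda>\<omega>. (prediction_error m (Zf \<omega>) (beta_tilde n m (sample n Z \<omega>)))\<^sup>2)"

subsection \<open>Conditional variance\<close>

definition cond_var :: "'a measure \<Rightarrow> 'a measure \<Rightarrow> ('a \<Rightarrow> real) \<Rightarrow> 'a \<Rightarrow> real" where
  "cond_var P F V = real_cond_exp P F (\<lambda>\<omega>. (V \<omega> - real_cond_exp P F V \<omega>)\<^sup>2)"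

text \<open>In the Gaussian model the conditional variance of \<open>y\<close> given the \<open>x j\<close> with \<open>m j\<close> is almost
  surely equal to a constant; \<open>sigma2\<close> is that constant.\<close>

definition sigma2 :: "'p measure \<Rightarrow> ('p \<Rightarrow> real) \<Rightarrow> (nat \<Rightarrow> 'p \<Rightarrow> real) \<Rightarrow> model \<Rightarrow> real" where
  "sigma2 P y x m = (THE v. AE \<omega> in P.
     cond_var P (vimage_algebra (space P) (\<lambda>\<omega>. \<lambda>j\<in>{j. m j}. x j \<omega>)
                   (Pi\<^sub>M {j. m j} (\<lambda>_. borel))) y \<omega> = v)"

definition Psi :: "real \<Rightarrow> real" where
  "Psi t = 1 / 8 * (t / (t + 1))\<^sup>2"

end

theory Submission
  imports Defs
begin

text \<open>Write \<open>k = |m|\<close> and let \<open>s\<^sup>2\<close> be the conditional variance. Whitening the selected regressors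
  turns the sample into an \<open>n \<times> k\<close> matrix \<open>W\<close> of independent standard normals and an independent
  noise vector \<open>s g\<close>. Then \<open>RSS = s\<^sup>2 R\<close> with \<open>R\<close> chi-square with \<open>n - k\<close> degrees of freedom, and
  \<open>\<rho>\<^sup>2 = s\<^sup>2 (1 + |t|\<^sup>2)\<close>, where \<open>t\<close> are the least-squares coefficients of \<open>g\<close> on \<open>W\<close>. Rotating the
  columns of \<open>W\<close> reduces any linear form in \<open>t\<close> to the last coefficient, which is \<open>N(0, 1/B)\<close> given
  \<open>W\<close>, where \<open>B\<close> is the squared distance of the last column from the span of the others, a
  chi-square variable with \<open>n + 1 - k\<close> degrees of freedom. By the Cramer-Wold device, \<open>t\<close> is therefore
  distributed as \<open>h / \<surd>B\<close> with \<open>h\<close> standard normal and independent of \<open>B\<close>. Both \<open>R / (n - k)\<close> and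
  \<open>|t|\<^sup>2\<close> are compared with \<open>1\<close> and \<open>k / (n + 1 - k)\<close> by Chernoff bounds, and the two errors are
  added, since \<open>(n + 1) / (n + 1 - k) = 1 + k / (n + 1 - k)\<close>.\<close>

subsection \<open>The Cramer-Wold device\<close>

text \<open>The obstacle is the ratio \<open>|t|^2 = |h|^2 / B\<close>: it has polynomial tails,
  hence no exponential moment. Its deviation event is therefore rewritten as a sign condition on
  \<open>|h|^2 - c B\<close>, in which both terms have exponential moments and factorise once
  \<open>h\<close> and \<open>B\<close> are independent. That is why the joint law of
  \<open>t\<close> is needed, and not only the law of each coefficient. The rotation that isolates a
  coefficient depends on the linear form, so it yields one-dimensional laws only, and uniqueness of
  multivariate characteristic functions has to assemble them. Origin of the constants: 4 is two
  errors times two tails; \<open>\<epsilon> / 2\<close> is the share of each error; the 1/8 in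
  \<open>Psi\<close> is the factor 1/2 of a chi-square exponent times the 1/4 of
  \<open>sqrt_deviation\<close>; \<open>n - k\<close> is the smaller of the two degrees of freedom
  \<open>n - k\<close> and \<open>n + 1 - k\<close>. The noise is modelled as \<open>s\<close> times
  a standard normal vector throughout, so that a vanishing conditional variance is covered by the
  same distributional identities.\<close>

lemma Levy_uniqueness_finite:
  fixes M1 M2 :: "real measure"
  assumes "finite_measure M1" "finite_measure M2" and sets: "sets M1 = sets borel" "sets M2 = sets borel"
    and char: "\<And>t. (CLINT x|M1. iexp (t * x)) = (CLINT x|M2. iexp (t * x))"
  shows "M1 = M2"
proof -
  interpret M1: finite_measure M1 by fact
  interpret M2: finite_measure M2 by fact
  define m where "m = measure M1 (space M1)"
  \<comment> \<open>At \<open>t = 0\<close> the transforms are the total masses. Dividing by the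
    common value, when it is positive, leads to Levy's theorem for probability measures.\<close>
  have m2: "measure M2 (space M2) = m"
    using char[of 0] by (simp add: m_def)
  show ?thesis
  proof (cases "m = 0")
    case True
    have "emeasure M1 A = emeasure M2 A" for A
      using True m2 m_def M1.bounded_measure[of A] M2.bounded_measure[of A]
      by (simp add: M1.emeasure_eq_measure M2.emeasure_eq_measure measure_le_0_iff)
    then show ?thesis
      by (intro measure_eqI) (simp_all add: sets)
  next
    case False
    then have m: "m > 0" unfolding m_def by (simp add: zero_less_measure_iff)
    have sp: "space M1 = UNIV" "space M2 = UNIV"
      using sets[THEN sets_eq_imp_space_eq] by auto
    let ?N1 = "density M1 (\<lambda>_. ennreal (1 / m))" and ?N2 = "density M2 (\<lambda>_. ennreal (1 / m))"
    have 1: "real_distribution ?N1"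
    proof (intro real_distribution.intro prob_spaceI real_distribution_axioms.intro)
      show "emeasure ?N1 (space ?N1) = 1"
        using m by (simp add: emeasure_density M1.emeasure_eq_measure m_def[symmetric] ennreal_mult[symmetric] nn_integral_cmult)
    qed (simp_all add: sets)
    have 2: "real_distribution ?N2"
    proof (intro real_distribution.intro prob_spaceI real_distribution_axioms.intro)
      show "emeasure ?N2 (space ?N2) = 1"
        using m by (simp add: emeasure_density M2.emeasure_eq_measure m2 ennreal_mult[symmetric] nn_integral_cmult)
    qed (simp_all add: sets)
    have "char ?N1 = char ?N2"
    proof
      fix t
      have [measurable]: "iexp \<in> borel_measurable M1" "iexp \<in> borel_measurable M2"
         "(\<lambda>x. t * x) \<in> borel_measurable M1" "(\<lambda>x. t * x) \<in> borel_measurable M2"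
        by (simp_all add: measurable_cong_sets[OF sets(1) refl] measurable_cong_sets[OF sets(2) refl])
      show "char ?N1 t = char ?N2 t"
        unfolding char_def using m char[of t]
        by (subst (1 2) integral_density)
           (simp_all add: measurable_cong_sets[OF sets(1) refl] measurable_cong_sets[OF sets(2) refl])
    qed
    from Levy_uniqueness[OF 1 2 this] have eq: "?N1 = ?N2" .
    have "emeasure M1 A = emeasure M2 A" if "A \<in> sets M1" for A
    proof -
      have "emeasure ?N1 A = emeasure ?N2 A" using eq by simp
      then have "ennreal (1/m) * emeasure M1 A = ennreal (1/m) * emeasure M2 A"
        using that sets by (simp add: emeasure_density nn_integral_cmult)
      then show ?thesis using m
        by (simp add: M1.emeasure_eq_measure M2.emeasure_eq_measure ennreal_mult[symmetric] ennreal_inj del: ennreal_1)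
    qed
    then show ?thesis by (intro measure_eqI) (simp_all add: sets)
  qed
qed

text \<open>The weights become densities, so that one-dimensional uniqueness applies to the images
  of two weighted measures. Nonnegative weights keep these images measures, which is why the
  multivariate argument below has to avoid complex weights.\<close>

lemma Levy_uniqueness_weighted:
  fixes f X :: "'a \<Rightarrow> real" and g Y :: "'b \<Rightarrow> real"
  assumes "finite_measure M" "finite_measure N"
    and [measurable]: "f \<in> borel_measurable M" "X \<in> borel_measurable M"
      "g \<in> borel_measurable N" "Y \<in> borel_measurable N" "A \<in> sets borel"
    and f: "\<And>x. 0 \<le> f x \<and> f x \<le> C" and g: "\<And>x. 0 \<le> g x \<and> g x \<le> C"
    and char: "\<And>t. (CLINT x|M. f x *\<^sub>R iexp (t * X x)) = (CLINT x|N. g x *\<^sub>R iexp (t * Y x))"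
  shows "(LINT x|M. f x * indicator A (X x)) = (LINT x|N. g x * indicator A (Y x))"
proof -
  interpret M: finite_measure M by fact
  interpret N: finite_measure N by fact
  let ?M = "distr (density M f) borel X" and ?N = "distr (density N g) borel Y"
  have [simp]: "integrable M f" using f by (intro M.integrable_const_bound[where B=C]) auto
  have [simp]: "integrable N g" using g by (intro N.integrable_const_bound[where B=C]) auto
  have "finite_measure (density M f)"
    by (intro finite_measureI) (use f in \<open>simp add: emeasure_density nn_integral_eq_integral cong: nn_integral_cong_simp\<close>)
  then have 1: "finite_measure ?M"
    by (intro finite_measure.finite_measure_distr) simp_all
  have "finite_measure (density N g)"
    by (intro finite_measureI) (use g in \<open>simp add: emeasure_density nn_integral_eq_integral cong: nn_integral_cong_simp\<close>)
  then have 2: "finite_measure ?N"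
    by (intro finite_measure.finite_measure_distr) simp_all
  have eq: "?M = ?N"
    by (rule Levy_uniqueness_finite[OF 1 2])
       (use f g char in \<open>simp_all add: integral_distr integral_density\<close>)
  have "(LINT x|M. f x * indicator A (X x)) = (LINT x|?M. indicator A x)"
    using f by (subst integral_distr, simp, simp) (simp add: integral_density)
  also have "\<dots> = (LINT x|?N. indicator A x)"
    unfolding eq ..
  also have "\<dots> = (LINT x|N. g x * indicator A (Y x))"
    using g by (subst integral_distr, simp, simp) (simp add: integral_density)
  finally show ?thesis .
qed


text \<open>Coordinates are converted one at a time: the exponential factor in \<open>x j\<close> is
  exchanged for the indicator of a Borel set, by one-dimensional uniqueness with the remaining
  factors as weight. When all coordinates are converted, the two measures agree on boxes.\<close>

lemma Cramer_Wold_PiM: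
  fixes M N :: "('i \<Rightarrow> real) measure"
  assumes I: "finite I" and MN: "prob_space M" "prob_space N"
    and sets: "sets M = sets (PiM I (\<lambda>_. borel))" "sets N = sets (PiM I (\<lambda>_. borel))"
    and char: "\<And>t. (CLINT x|M. iexp (\<Sum>i\<in>I. t i * x i)) = (CLINT x|N. iexp (\<Sum>i\<in>I. t i * x i))"
  shows "M = N"
proof -
  interpret M: prob_space M by fact
  interpret N: prob_space N by fact
  note [measurable_cong] = sets
  have claim: "(CLINT x|M. (\<Prod>i\<in>J. indicator (A i) (x i) :: real) *\<^sub>R iexp (\<Sum>i\<in>I - J. t i * x i)) =
      (CLINT x|N. (\<Prod>i\<in>J. indicator (A i) (x i) :: real) *\<^sub>R iexp (\<Sum>i\<in>I - J. t i * x i))"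
    if J: "J \<subseteq> I" and A: "\<And>i. A i \<in> sets borel" for J t and A :: "'i \<Rightarrow> real set"
    using finite_subset[OF J I] J
  proof (induction J arbitrary: t rule: finite_subset_induct')
    case empty
    then show ?case using char by simp
  next
    case (insert j J)
    let ?K = "I - insert j J"
    have IJ: "I - J = insert j ?K" using insert by auto
    have [simp]: "finite ?K" using I by simp
    note [measurable] = A
    have jI: "j \<in> I" using insert by auto
    have KI: "?K \<subseteq> I" "J \<subseteq> I" using insert by auto
    define Q where "Q x = (\<Prod>i\<in>J. indicator (A i) (x i) :: real)" for x
    define th where "th t x = (\<Sum>i\<in>?K. t i * x i)" for t and x :: "'i \<Rightarrow> real"
    have Q: "0 \<le> Q x" "Q x \<le> 1" for x
      unfolding Q_def by (auto intro!: prod_nonneg prod_le_1 simp: indicator_def)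
    have comp: "i \<in> I \<Longrightarrow> (\<lambda>x. x i) \<in> borel_measurable (PiM I (\<lambda>_. borel))" for i :: 'i
      by (rule measurable_component_singleton)
    have Qm[measurable]: "Q \<in> borel_measurable (PiM I (\<lambda>_. borel))"
      unfolding Q_def using KI by (intro borel_measurable_prod) (auto intro!: measurable_compose[OF comp] borel_measurable_indicator A)
    have th_meas[measurable]: "th t \<in> borel_measurable (PiM I (\<lambda>_. borel))" for t
      unfolding th_def by (intro borel_measurable_sum borel_measurable_times measurable_const comp) auto
    have jm[measurable]: "(\<lambda>x. x j) \<in> borel_measurable (PiM I (\<lambda>_. borel))"
      by (rule comp[OF jI])
    define F where "F L s t = (CLINT x|L. Q x *\<^sub>R iexp (s * x j + th t x))" for L s t
    have F_eq: "F M s t = F N s t" for s t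
    proof -
      have "(\<Sum>i\<in>I - J. (t(j:=s)) i * x i) = s * x j + th t x" for x
        unfolding IJ th_def by (subst sum.insert) (auto intro!: sum.cong simp: I)
      with insert.IH[of "t(j:=s)"] show ?thesis
        unfolding F_def Q_def by (simp only:)
    qed
    \<comment> \<open>The factor \<open>iexp (th t x)\<close> is not a nonnegative weight;
      \<open>1 + cos (th t x + \<phi>)\<close> is one, and it expands into three exponentials, to
      each of which the induction hypothesis applies through \<open>F_eq\<close>.\<close>
    have F_split: "(CLINT x|L. (Q x * (1 + cos (th t x + \<phi>))) *\<^sub>R iexp (s * x j)) =
        F L s (\<lambda>_. 0) + (iexp \<phi> / 2) * F L s t + (iexp (-\<phi>) / 2) * F L s (\<lambda>i. - t i)"
      if L: "prob_space L" and [measurable_cong]: "sets L = sets (PiM I (\<lambda>_. borel))" for L s t \<phi>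
    proof -
      interpret L: prob_space L by fact
      define G where "G t x = Q x *\<^sub>R iexp (s * x j + th t x)" for t x
      have int: "integrable L (G t)" for t
        unfolding G_def using Q by (intro L.integrable_const_bound[where B=1]) auto
      have "(Q x * (1 + cos (th t x + \<phi>))) *\<^sub>R iexp (s * x j) =
        G (\<lambda>_. 0) x + (iexp \<phi> / 2) * G t x + (iexp (-\<phi>) / 2) * G (\<lambda>i. - t i) x" for x
      proof -
        have thn: "th (\<lambda>i. - t i) x = - th t x" "th (\<lambda>i. 0) x = 0"
          by (simp_all add: th_def sum_negf)
        have "complex_of_real (cos r) = (iexp r + 1 / iexp r) / 2" for r
          by (simp add: cos_of_real[symmetric] cos_exp_eq exp_minus inverse_eq_divide)
        moreover have "iexp (th t x + \<phi>) = iexp (th t x) * iexp \<phi>"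
          by (simp add: exp_add distrib_left)
        ultimately have c: "complex_of_real (cos (th t x + \<phi>)) = (iexp (th t x) * iexp \<phi> + 1 / (iexp (th t x) * iexp \<phi>)) / 2"
          by (simp only:)
        have "(q * (1 + (b * c + 1 / (b * c)) / 2)) * a = q * a + (c / 2) * (q * (a * b)) + ((1 / c) / 2) * (q * (a * (1 / b)))"
          if "b \<noteq> 0" "c \<noteq> 0" for a b c q :: complex
          using that by (simp add: field_simps)
        from this[of "iexp (th t x)" "iexp \<phi>" "of_real (Q x)" "iexp (s * x j)"]
        moreover have "iexp (-\<phi>) = 1 / iexp \<phi>" "iexp (s * x j + th t x) = iexp (s * x j) * iexp (th t x)"
            "iexp (s * x j + - th t x) = iexp (s * x j) * (1 / iexp (th t x))"
          by (simp_all add: exp_add exp_diff exp_minus distrib_left right_diff_distrib inverse_eq_divide)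
        ultimately have main: "(of_real (Q x) * (1 + (iexp (th t x) * iexp \<phi> + 1 / (iexp (th t x) * iexp \<phi>)) / 2)) * iexp (s * x j) =
          of_real (Q x) * iexp (s * x j) + (iexp \<phi> / 2) * (of_real (Q x) * iexp (s * x j + th t x))
          + (iexp (- \<phi>) / 2) * (of_real (Q x) * iexp (s * x j + - th t x))"
          by (simp only: exp_not_eq_zero not_False_eq_True simp_thms)
        show ?thesis
          unfolding G_def scaleR_conv_of_real of_real_mult[of "Q x"] of_real_add[of 1] of_real_1 c thn
          using main by (simp only: add_0_right)
      qed
      then have "(CLINT x|L. (Q x * (1 + cos (th t x + \<phi>))) *\<^sub>R iexp (s * x j)) =
          (CLINT x|L. G (\<lambda>_. 0) x + (iexp \<phi> / 2) * G t x + (iexp (-\<phi>) / 2) * G (\<lambda>i. - t i) x)"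
        by simp
      also have "\<dots> = integral\<^sup>L L (G (\<lambda>_. 0)) + (iexp \<phi> / 2) * integral\<^sup>L L (G t) + (iexp (-\<phi>) / 2) * integral\<^sup>L L (G (\<lambda>i. - t i))"
        using int by simp
      finally show ?thesis unfolding F_def G_def .
    qed
    have W: "(LINT x|M. Q x * (1 + cos (th t x + \<phi>)) * indicator (A j) (x j)) =
        (LINT x|N. Q x * (1 + cos (th t x + \<phi>)) * indicator (A j) (x j))" for t \<phi>
    proof (rule Levy_uniqueness_weighted[where C=2])
      fix x
      have c: "0 \<le> 1 + cos (th t x + \<phi>)" using cos_ge_minus_one[of "th t x + \<phi>"] by linarith
      then have "Q x * (1 + cos (th t x + \<phi>)) \<le> 1 * 2"
        using Q[of x] by (intro mult_mono) auto
      moreover have "0 \<le> Q x * (1 + cos (th t x + \<phi>))"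
        using c Q[of x] by (intro mult_nonneg_nonneg)
      ultimately show "0 \<le> Q x * (1 + cos (th t x + \<phi>)) \<and> Q x * (1 + cos (th t x + \<phi>)) \<le> 2"
        by simp
      then show "0 \<le> Q x * (1 + cos (th t x + \<phi>)) \<and> Q x * (1 + cos (th t x + \<phi>)) \<le> 2" .
    next
      show "(CLINT x|M. (Q x * (1 + cos (th t x + \<phi>))) *\<^sub>R iexp (s * x j)) =
        (CLINT x|N. (Q x * (1 + cos (th t x + \<phi>))) *\<^sub>R iexp (s * x j))" for s
        unfolding F_split[OF MN(1) sets(1)] F_split[OF MN(2) sets(2)] F_eq ..
    qed (auto intro: M.finite_measure_axioms N.finite_measure_axioms A)
    let ?q = "\<lambda>x. Q x * indicator (A j) (x j) :: real"
    have int: "integrable L (\<lambda>x. ?q x * cos (th t x + \<phi>))" "integrable L ?q"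
      if L: "prob_space L" and [measurable_cong]: "sets L = sets (PiM I (\<lambda>_. borel))" for L t \<phi>
    proof -
      interpret L: prob_space L by fact
      show "integrable L ?q"
        using Q by (intro L.integrable_const_bound[where B=1]) (auto simp: indicator_def)
      show "integrable L (\<lambda>x. ?q x * cos (th t x + \<phi>))"
        using Q by (intro L.integrable_const_bound[where B=1]) (auto simp: indicator_def abs_mult intro!: mult_le_one)
    qed
    \<comment> \<open>The zero form at phase 0 gives the weight \<open>2 * Q x\<close>. Subtracting
      this case from \<open>W\<close> leaves the cosine alone.\<close>
    have W0: "(LINT x|M. ?q x) = (LINT x|N. ?q x)"
    proof -
      have [simp]: "th (\<lambda>_. 0) x = 0" for x by (simp add: th_def)
      show ?thesis
        using W[of "\<lambda>_. 0" 0] by (simp add: mult.assoc mult.left_commute[of _ 2])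
    qed
    have Wcos: "(LINT x|M. ?q x * cos (th t x + \<phi>)) = (LINT x|N. ?q x * cos (th t x + \<phi>))" for \<phi>
    proof -
      have "(LINT x|L. Q x * (1 + cos (th t x + \<phi>)) * indicator (A j) (x j)) = (LINT x|L. ?q x) + (LINT x|L. ?q x * cos (th t x + \<phi>))"
        if L: "prob_space L" "sets L = sets (PiM I (\<lambda>_. borel))" for L
        using int[OF L] by (subst Bochner_Integration.integral_add[symmetric]) (auto simp: algebra_simps)
      from this[OF MN(1) sets(1)] this[OF MN(2) sets(2)] W[of t \<phi>] W0 show ?thesis by simp
    qed
    \<comment> \<open>The phases \<open>0\<close> and \<open>-pi/2\<close> give cosine and sine,
      that is, the real and imaginary parts of the exponential in the coordinates still to be
      converted.\<close>
    have split: "(CLINT x|L. (\<Prod>i\<in>insert j J. indicator (A i) (x i) :: real) *\<^sub>R iexp (\<Sum>i\<in>?K. t i * x i)) =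
        of_real (LINT x|L. ?q x * cos (th t x + 0)) + \<i> * of_real (LINT x|L. ?q x * cos (th t x + (-pi/2)))"
      if L: "prob_space L" "sets L = sets (PiM I (\<lambda>_. borel))" for L
    proof -
      have "(CLINT x|L. (\<Prod>i\<in>insert j J. indicator (A i) (x i) :: real) *\<^sub>R iexp (\<Sum>i\<in>?K. t i * x i)) =
        (CLINT x|L. of_real (?q x * cos (th t x + 0)) + \<i> * of_real (?q x * cos (th t x + (-pi/2))))"
        using insert.hyps
        by (intro Bochner_Integration.integral_cong refl)
           (simp add: th_def[symmetric] Q_def[symmetric] scaleR_conv_of_real cis_conv_exp[symmetric] cos_diff cis.ctr complex_eq_iff)
      also have "\<dots> = of_real (LINT x|L. ?q x * cos (th t x + 0)) + \<i> * of_real (LINT x|L. ?q x * cos (th t x + (-pi/2)))"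
        using int(1)[OF L, of t 0, THEN integrable_of_real, where 'a=complex] int(1)[OF L, of t "-pi/2", THEN integrable_of_real, where 'a=complex]
        by (subst Bochner_Integration.integral_add)
           (simp_all only: integral_complex_of_real integral_mult_right_zero integrable_mult_right)
      finally show ?thesis .
    qed
    show ?case
      unfolding split[OF MN(1) sets(1)] split[OF MN(2) sets(2)] Wcos ..
  qed
  show ?thesis
  proof (rule measure_eqI_PiM_finite[OF I])
    fix A :: "'i \<Rightarrow> real set" assume A: "\<And>i. i \<in> I \<Longrightarrow> A i \<in> sets borel"
    \<comment> \<open>The sets are known to be Borel only on \<open>I\<close>, while
      \<open>claim\<close> asks for a Borel set at every index; the default leaves the box
      unchanged.\<close>
    define B where "B i = (if i \<in> I then A i else {})" for i
    have B: "B i \<in> sets borel" for i using A by (simp add: B_def)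
    have AB: "Pi\<^sub>E I A = Pi\<^sub>E I B" by (auto simp: B_def PiE_iff)
    have ind: "(\<Prod>i\<in>I. indicator (B i) (x i) :: real) = indicator (Pi\<^sub>E I B) x" if "x \<in> extensional I" for x
      using that I by (auto simp: indicator_def PiE_iff prod_zero)
    have m: "complex_of_real (measure L (Pi\<^sub>E I B)) = (CLINT x|L. (\<Prod>i\<in>I. indicator (B i) (x i) :: real) *\<^sub>R iexp (\<Sum>i\<in>I - I. 0 * x i))"
      if "prob_space L" and sL: "sets L = sets (PiM I (\<lambda>_. borel))" for L
    proof -
      interpret L: prob_space L by fact
      have E: "Pi\<^sub>E I B \<in> sets L" unfolding sL using I B by (intro sets_PiM_I_finite) auto
      have sp: "space L = (\<Pi>\<^sub>E i\<in>I. UNIV)" using sets_eq_imp_space_eq[OF sL] by (simp add: space_PiM)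
      have "(CLINT x|L. (\<Prod>i\<in>I. indicator (B i) (x i) :: real) *\<^sub>R iexp (\<Sum>i\<in>I - I. 0 * x i)) = (CLINT x|L. of_real (indicator (Pi\<^sub>E I B) x))"
        by (intro Bochner_Integration.integral_cong refl) (simp add: sp ind PiE_iff scaleR_conv_of_real)
      also have "\<dots> = of_real (measure L (Pi\<^sub>E I B))"
        using E by (subst integral_complex_of_real) simp
      finally show ?thesis by simp
    qed
    have "measure M (Pi\<^sub>E I B) = measure N (Pi\<^sub>E I B)"
      using claim[of I B "\<lambda>_. 0"] B m[OF MN(1) sets(1)] m[OF MN(2) sets(2)]
      by (simp only: of_real_eq_iff[symmetric, where 'a=complex] subset_refl)
    then show "emeasure M (Pi\<^sub>E I A) = emeasure N (Pi\<^sub>E I A)"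
      unfolding AB by (simp add: M.emeasure_eq_measure N.emeasure_eq_measure)
  next
    show "range (\<lambda>_::nat. \<Pi>\<^sub>E i\<in>I. UNIV) \<subseteq> prod_algebra I (\<lambda>_. borel)"
      using I by (auto intro!: prod_algebraI_finite)
  qed (auto simp: sets space_PiM)
qed

corollary distr_eqI_linear_forms:
  fixes X :: "'a \<Rightarrow> 'i \<Rightarrow> real" and Y :: "'b \<Rightarrow> 'i \<Rightarrow> real"
  assumes I: "finite I" and MN: "prob_space M" "prob_space N"
    and [measurable]: "X \<in> M \<rightarrow>\<^sub>M PiM I (\<lambda>_. borel)" "Y \<in> N \<rightarrow>\<^sub>M PiM I (\<lambda>_. borel)"
    and char: "\<And>t. (CLINT x|M. iexp (\<Sum>i\<in>I. t i * X x i)) = (CLINT x|N. iexp (\<Sum>i\<in>I. t i * Y x i))"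
  shows "distr M (PiM I (\<lambda>_. borel)) X = distr N (PiM I (\<lambda>_. borel)) Y"
proof -
  have [measurable]: "(\<lambda>x. \<Sum>i\<in>I. t i * x i) \<in> borel_measurable (PiM I (\<lambda>_. borel))" for t :: "'i \<Rightarrow> real"
    by (intro borel_measurable_sum borel_measurable_times measurable_const measurable_component_singleton) simp_all
  show ?thesis
    by (rule Cramer_Wold_PiM[OF I])
       (use MN char in \<open>simp_all add: prob_space.prob_space_distr integral_distr\<close>)
qed

subsection \<open>Standard Gaussian vectors\<close>

definition std_gaussian :: "'i set \<Rightarrow> ('i \<Rightarrow> real) measure" where
  "std_gaussian I = PiM I (\<lambda>_. std_normal_distribution)"

interpretation std_gaussian: product_prob_space "\<lambda>_. std_normal_distribution" I for I :: "'i set"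
  using real_dist_normal_dist
  by (intro product_prob_spaceI) (simp add: real_distribution_def)

lemma prob_space_std_gaussian: "prob_space (std_gaussian I)"
  unfolding std_gaussian_def by (rule std_gaussian.P.prob_space_axioms)

lemma sets_std_gaussian [measurable_cong, simp]: "sets (std_gaussian I) = sets (PiM I (\<lambda>_. borel))"
  unfolding std_gaussian_def by (intro sets_PiM_cong) auto

lemma space_std_gaussian: "space (std_gaussian I) = extensional I"
  by (simp add: std_gaussian_def space_PiM PiE_UNIV_domain PiE_def)

lemma char_std_gaussian:
  assumes "finite I"
  shows "(CLINT x|std_gaussian I. iexp (\<Sum>i\<in>I. t i * x i)) = of_real (exp (- (\<Sum>i\<in>I. (t i)\<^sup>2) / 2))"
proof -
  have "(CLINT x|std_gaussian I. iexp (\<Sum>i\<in>I. t i * x i)) = (CLINT x|std_gaussian I. (\<Prod>i\<in>I. iexp (t i * x i)))"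
    using assms by (simp add: exp_sum sum_distrib_left)
  also have "\<dots> = (\<Prod>i\<in>I. char std_normal_distribution (t i))"
    unfolding std_gaussian_def char_def using assms
    by (intro std_gaussian.product_integral_prod) (auto intro!: prob_space.integrable_iexp[OF std_gaussian.prob_space])
  also have "\<dots> = of_real (exp (- (\<Sum>i\<in>I. (t i)\<^sup>2) / 2))"
    unfolding char_std_normal_distribution using assms
    by (simp add: sum_negf[symmetric] sum_divide_distrib exp_sum flip: of_real_prod)
  finally show ?thesis .
qed

text \<open>Vectors are functions compared on a finite index set, because the dimension is a
  parameter (\<open>n\<close>, \<open>k\<close>, or a set of matrix entries) and not a type.\<close>

definition dot :: "'p set \<Rightarrow> ('p \<Rightarrow> real) \<Rightarrow> ('p \<Rightarrow> real) \<Rightarrow> real" where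
  "dot J u v = (\<Sum>p\<in>J. u p * v p)"

lemma dot_commute: "dot J u v = dot J v u"
  unfolding dot_def by (simp add: mult.commute)

lemma dot_self_nonneg [simp]: "0 \<le> dot J u u"
  unfolding dot_def by (intro sum_nonneg) simp

lemma dot_self_eq_0_iff: "finite J \<Longrightarrow> dot J u u = 0 \<longleftrightarrow> (\<forall>p\<in>J. u p = 0)"
  unfolding dot_def by (subst sum_nonneg_eq_0_iff) auto

lemma dot_add_right: "dot J u (\<lambda>p. v p + w p) = dot J u v + dot J u w"
  unfolding dot_def by (simp add: distrib_left sum.distrib)

lemma dot_diff_right: "dot J u (\<lambda>p. v p - w p) = dot J u v - dot J u w"
  unfolding dot_def by (simp add: right_diff_distrib sum_subtractf)

lemma dot_scale_right: "dot J u (\<lambda>p. c * v p) = c * dot J u v"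
  unfolding dot_def by (simp add: sum_distrib_left mult.left_commute)

lemma dot_sum_right: "dot J u (\<lambda>p. \<Sum>i\<in>I. f i p) = (\<Sum>i\<in>I. dot J u (f i))"
  unfolding dot_def by (simp add: sum_distrib_left sum.swap[of _ I])

lemma dot_add_left: "dot J (\<lambda>p. v p + w p) u = dot J v u + dot J w u"
  and dot_diff_left: "dot J (\<lambda>p. v p - w p) u = dot J v u - dot J w u"
  and dot_scale_left: "dot J (\<lambda>p. c * v p) u = c * dot J v u"
  and dot_sum_left: "dot J (\<lambda>p. \<Sum>i\<in>I. f i p) u = (\<Sum>i\<in>I. dot J (f i) u)"
  by (simp_all add: dot_commute[of J _ u] dot_add_right dot_diff_right dot_scale_right dot_sum_right)

lemmas dot_simps = dot_add_left dot_add_right dot_diff_left dot_diff_right dot_scale_left dot_scale_right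
  dot_sum_left dot_sum_right

lemma dot_cong: "(\<And>p. p \<in> J \<Longrightarrow> u p = u' p) \<Longrightarrow> (\<And>p. p \<in> J \<Longrightarrow> v p = v' p) \<Longrightarrow> dot J u v = dot J u' v'"
  unfolding dot_def by simp

lemma borel_measurable_dot [measurable (raw)]:
  assumes "\<And>p. p \<in> J \<Longrightarrow> (\<lambda>x. u x p) \<in> borel_measurable M" "\<And>p. p \<in> J \<Longrightarrow> (\<lambda>x. v x p) \<in> borel_measurable M"
  shows "(\<lambda>x. dot J (u x) (v x)) \<in> borel_measurable M"
  unfolding dot_def using assms by simp

definition orthonormal :: "'p set \<Rightarrow> nat \<Rightarrow> (nat \<Rightarrow> 'p \<Rightarrow> real) \<Rightarrow> bool" where
  "orthonormal J k e \<longleftrightarrow> (\<forall>i<k. \<forall>j<k. dot J (e i) (e j) = (if i = j then 1 else 0))"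

text \<open>The characteristic function of a standard Gaussian vector sees a linear form only
  through its squared norm, and orthonormality makes the norm of
  \<open>\<Sum>i\<in>I. t i * a i\<close> equal to that of \<open>t\<close>. The lemma serves for
  projections onto fewer coordinates as well as for rotations.\<close>

lemma distr_std_gaussian_orthonormal:
  fixes a :: "'i \<Rightarrow> 'p \<Rightarrow> real"
  assumes "finite I" "finite J" and on: "\<And>i j. i \<in> I \<Longrightarrow> j \<in> I \<Longrightarrow> dot J (a i) (a j) = (if i = j then 1 else 0)"
  shows "distr (std_gaussian J) (PiM I (\<lambda>_. borel)) (\<lambda>y. \<lambda>i\<in>I. dot J (a i) y) = std_gaussian I"
proof -
  have "distr (std_gaussian J) (PiM I (\<lambda>_. borel)) (\<lambda>y. \<lambda>i\<in>I. dot J (a i) y)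
     = distr (std_gaussian I) (PiM I (\<lambda>_. borel)) (\<lambda>x. x)"
  proof (rule distr_eqI_linear_forms)
    show "(\<lambda>y. \<lambda>i\<in>I. dot J (a i) y) \<in> std_gaussian J \<rightarrow>\<^sub>M PiM I (\<lambda>_. borel)"
      by measurable
    fix t :: "'i \<Rightarrow> real"
    have "dot J (\<lambda>p. \<Sum>i\<in>I. t i * a i p) (\<lambda>p. \<Sum>i\<in>I. t i * a i p) = (\<Sum>i\<in>I. \<Sum>j\<in>I. t i * (t j * dot J (a i) (a j)))"
      by (simp add: dot_simps sum_distrib_left)
    also have "\<dots> = (\<Sum>i\<in>I. (t i)\<^sup>2)"
      using assms by (simp add: on power2_eq_square if_distrib cong: if_cong sum.cong)
    finally have sq: "(\<Sum>p\<in>J. (\<Sum>i\<in>I. t i * a i p)\<^sup>2) = (\<Sum>i\<in>I. (t i)\<^sup>2)"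
      by (simp add: dot_def power2_eq_square)
    have "(CLINT y|std_gaussian J. iexp (\<Sum>i\<in>I. t i * (\<lambda>i\<in>I. dot J (a i) y) i))
      = (CLINT y|std_gaussian J. iexp (\<Sum>p\<in>J. (\<Sum>i\<in>I. t i * a i p) * y p))"
      unfolding dot_def
      by (simp add: sum_distrib_left sum_distrib_right sum.swap[of _ I] mult.assoc)
    also have "\<dots> = (CLINT x|std_gaussian I. iexp (\<Sum>i\<in>I. t i * x i))"
      by (simp only: char_std_gaussian assms sq)
    finally show "(CLINT y|std_gaussian J. iexp (\<Sum>i\<in>I. t i * (\<lambda>i\<in>I. dot J (a i) y) i))
      = (CLINT x|std_gaussian I. iexp (\<Sum>i\<in>I. t i * x i))" .
  qed (use assms in \<open>auto simp: prob_space_std_gaussian\<close>)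
  also have "\<dots> = std_gaussian I"
    by (rule distr_id2) simp
  finally show ?thesis .
qed

lemma nn_integral_exp_square_std_normal:
  assumes "l < 1 / 2"
  shows "(\<integral>\<^sup>+ x. exp (l * x\<^sup>2) \<partial>std_normal_distribution) = ennreal ((1 - 2 * l) powr (- 1 / 2))"
proof -
  \<comment> \<open>Tilting the standard normal density by \<open>exp (l * x^2)\<close> gives
    \<open>s\<close> times the centred normal density with standard deviation
    \<open>s\<close>.\<close>
  define s where "s = 1 / sqrt (1 - 2 * l)"
  have s: "s > 0" using assms by (simp add: s_def)
  have s2: "s\<^sup>2 = 1 / (1 - 2 * l)" using assms by (simp add: s_def power_divide)
  have "std_normal_density x * exp (l * x\<^sup>2) = s * normal_density 0 s x" for x
  proof -
    have "exp (- x\<^sup>2 / 2) * exp (l * x\<^sup>2) = exp (- x\<^sup>2 / (2 * s\<^sup>2))"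
      using assms by (simp add: exp_add[symmetric] s2 field_simps)
    moreover have "sqrt (2 * pi * s\<^sup>2) = sqrt (2 * pi) * s"
      using s by (simp add: real_sqrt_mult)
    ultimately show ?thesis
      using s by (simp add: normal_density_def)
  qed
  then have "(\<integral>\<^sup>+ x. exp (l * x\<^sup>2) \<partial>std_normal_distribution) = (\<integral>\<^sup>+ x. ennreal s * normal_density 0 s x \<partial>lborel)"
    using s by (subst nn_integral_density) (auto simp flip: ennreal_mult)
  also have "\<dots> = ennreal s * (\<integral>\<^sup>+ x. normal_density 0 s x \<partial>lborel)"
    by (rule nn_integral_cmult) simp
  also have "(\<integral>\<^sup>+ x. normal_density 0 s x \<partial>lborel) = 1"
    using prob_space.emeasure_space_1[OF prob_space_normal_density[OF s, of 0]]
    by (simp add: emeasure_density)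
  also have "s = (1 - 2 * l) powr (- 1 / 2)"
    using assms by (simp add: s_def powr_minus_divide powr_half_sqrt)
  finally show ?thesis by simp
qed

lemma nn_integral_exp_sum_squares_std_gaussian:
  assumes "l < 1 / 2" "finite I"
  shows "(\<integral>\<^sup>+ x. exp (l * (\<Sum>i\<in>I. (x i)\<^sup>2)) \<partial>std_gaussian I) = ennreal ((1 - 2 * l) powr (- real (card I) / 2))"
proof -
  have "(\<integral>\<^sup>+ x. exp (l * (\<Sum>i\<in>I. (x i)\<^sup>2)) \<partial>std_gaussian I) = (\<integral>\<^sup>+ x. (\<Prod>i\<in>I. ennreal (exp (l * (x i)\<^sup>2))) \<partial>std_gaussian I)"
    using assms by (simp add: prod_ennreal exp_sum sum_distrib_left)
  also have "\<dots> = (\<Prod>i\<in>I. ennreal ((1 - 2 * l) powr (- 1 / 2)))"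
    unfolding std_gaussian_def using assms
    by (subst std_gaussian.product_nn_integral_prod) (auto simp: nn_integral_exp_square_std_normal)
  also have "\<dots> = ennreal ((1 - 2 * l) powr (- real (card I) / 2))"
    using assms by (simp add: ennreal_power powr_realpow[symmetric] powr_powr)
  finally show ?thesis .
qed

lemma AE_std_gaussian_nonzero:
  assumes "i \<in> I"
  shows "AE x in std_gaussian I. x i \<noteq> 0"
  unfolding std_gaussian_def
proof (rule AE_PiM_component[OF _ assms])
  show "AE x in std_normal_distribution. x \<noteq> 0"
    using AE_lborel_singleton[of "0::real"] by (subst AE_density) auto
qed (simp add: std_gaussian.prob_space)

subsection \<open>Orthonormal families\<close>

lemma Bessel:
  assumes "orthonormal J k e"
  shows "dot J (\<lambda>p. v p - (\<Sum>i<k. dot J (e i) v * e i p)) (\<lambda>p. v p - (\<Sum>i<k. dot J (e i) v * e i p))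
     = dot J v v - (\<Sum>i<k. (dot J (e i) v)\<^sup>2)"
proof -
  define a where "a i = dot J (e i) v" for i
  have a: "dot J (e i) v = a i" "dot J v (e i) = a i" for i
    by (simp_all add: a_def dot_commute)
  have "(\<Sum>i<k. a i * (\<Sum>j<k. a j * dot J (e i) (e j))) = (\<Sum>i<k. (a i)\<^sup>2)"
  proof (intro sum.cong refl)
    fix i assume "i \<in> {..<k}"
    then have "(\<Sum>j<k. a j * dot J (e i) (e j)) = (\<Sum>j<k. if j = i then a i else 0)"
      using assms unfolding orthonormal_def by (intro sum.cong) auto
    then show "a i * (\<Sum>j<k. a j * dot J (e i) (e j)) = (a i)\<^sup>2"
      using \<open>i \<in> {..<k}\<close> by (simp add: power2_eq_square)
  qed
  then show ?thesis
    by (simp add: dot_simps a power2_eq_square)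
qed

lemma dot_residual_orthonormal:
  assumes "orthonormal J k e" "j < k"
  shows "dot J (e j) (\<lambda>p. v p - (\<Sum>i<k. dot J (e i) v * e i p)) = 0"
proof -
  have "(\<Sum>i<k. dot J (e i) v * dot J (e j) (e i)) = (\<Sum>i<k. if i = j then dot J (e j) v else 0)"
    using assms unfolding orthonormal_def by (intro sum.cong) auto
  then show ?thesis using assms(2) by (simp add: dot_simps)
qed

text \<open>This is the trace of the complementary projection, and it replaces dimension theory:
  each summand is nonnegative, so a family has at most \<open>card J\<close> members; if the total
  is positive, some unit vector has a nonzero remainder and the family can be extended.\<close>

lemma sum_Bessel_unit_vectors:
  assumes "finite J" "orthonormal J k e"
  shows "(\<Sum>q\<in>J. 1 - (\<Sum>i<k. (e i q)\<^sup>2)) = real (card J) - real k"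
proof -
  have "(\<Sum>q\<in>J. \<Sum>i<k. (e i q)\<^sup>2) = (\<Sum>i<k. dot J (e i) (e i))"
    unfolding dot_def by (subst sum.swap) (simp add: power2_eq_square)
  also have "\<dots> = real k" using assms(2) by (simp add: orthonormal_def)
  finally show ?thesis by (simp add: sum_subtractf)
qed

lemma unit_vector_residual:
  assumes "finite J" "orthonormal J k e" "q \<in> J"
  defines "d \<equiv> \<lambda>p. if p = q then 1 else (0::real)"
  shows "dot J (\<lambda>p. d p - (\<Sum>i<k. dot J (e i) d * e i p)) (\<lambda>p. d p - (\<Sum>i<k. dot J (e i) d * e i p))
     = 1 - (\<Sum>i<k. (e i q)\<^sup>2)"
proof -
  have "dot J u d = u q" for u
    unfolding dot_def d_def using assms by (simp add: if_distrib cong: if_cong)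
  then show ?thesis
    unfolding Bessel[OF assms(2)] using assms(3) by (simp add: d_def)
qed

lemma orthonormal_card_le:
  assumes "finite J" "orthonormal J k e"
  shows "k \<le> card J"
proof -
  have "0 \<le> (\<Sum>q\<in>J. 1 - (\<Sum>i<k. (e i q)\<^sup>2))"
    by (intro sum_nonneg) (simp only: unit_vector_residual[OF assms, symmetric] dot_self_nonneg)
  then show ?thesis
    unfolding sum_Bessel_unit_vectors[OF assms] by simp
qed

lemma orthonormal_extend:
  assumes "finite J" "orthonormal J k e" "k < card J"
  obtains v where "orthonormal J (Suc k) (e(k := v))"
proof -
  have "\<exists>q\<in>J. 1 - (\<Sum>i<k. (e i q)\<^sup>2) > 0"
  proof (rule ccontr)
    assume "\<not> ?thesis"
    then have "(\<Sum>q\<in>J. 1 - (\<Sum>i<k. (e i q)\<^sup>2)) \<le> 0" by (intro sum_nonpos) (auto simp: not_less)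
    then show False
      using assms(3) unfolding sum_Bessel_unit_vectors[OF assms(1,2)] by simp
  qed
  then obtain q where q: "q \<in> J" "1 - (\<Sum>i<k. (e i q)\<^sup>2) > 0" by blast
  define d :: "_ \<Rightarrow> real" where "d p = (if p = q then 1 else 0)" for p
  define r where "r = (\<lambda>p. d p - (\<Sum>i<k. dot J (e i) d * e i p))"
  have r: "dot J r r > 0"
    using unit_vector_residual[OF assms(1,2) q(1)] q(2) unfolding r_def d_def by simp
  have r0: "dot J (e j) r = 0" "dot J r (e j) = 0" if "j < k" for j
    using dot_residual_orthonormal[OF assms(2) that, of d] by (simp_all add: r_def dot_commute)
  obtain c where c: "c * (c * dot J r r) = 1"
    using r by (intro that[of "1 / sqrt (dot J r r)"]) simp
  have "orthonormal J (Suc k) (e(k := (\<lambda>p. c * r p)))"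
    using assms(2) r r0 unfolding orthonormal_def
    by (auto simp: less_Suc_eq dot_scale_left dot_scale_right c)
  then show ?thesis by (rule that)
qed

lemma orthonormal_completion:
  assumes J: "finite J" and "orthonormal J k e"
  obtains e' where "orthonormal J (card J) e'" "\<And>i. i < k \<Longrightarrow> e' i = e i"
proof -
  have "k \<le> l \<Longrightarrow> l \<le> card J \<Longrightarrow> \<exists>e'. orthonormal J l e' \<and> (\<forall>i<k. e' i = e i)" for l
  proof (induction l rule: nat_induct)
    case (Suc l)
    show ?case
    proof (cases "k = Suc l")
      case False
      then obtain e' where e': "orthonormal J l e'" "\<forall>i<k. e' i = e i" using Suc by auto
      obtain v where "orthonormal J (Suc l) (e'(l := v))"
        using orthonormal_extend[OF J e'(1)] Suc.prems by auto
      then show ?thesis using e'(2) False Suc.prems by (intro exI[of _ "e'(l := v)"]) (auto simp del: fun_upd_apply simp: fun_upd_other)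
    qed (use assms in auto)
  qed (use assms in auto)
  from this[of "card J"] show ?thesis
    using orthonormal_card_le[OF assms] that by auto
qed

text \<open>A nonzero remainder could be normalised and appended, which would give an orthonormal
  family with more than \<open>card J\<close> members.\<close>

lemma orthonormal_expansion:
  assumes J: "finite J" and on: "orthonormal J (card J) e" and p: "p \<in> J"
  shows "v p = (\<Sum>i<card J. dot J (e i) v * e i p)"
proof -
  let ?r = "\<lambda>p. v p - (\<Sum>i<card J. dot J (e i) v * e i p)"
  have "dot J ?r ?r = 0"
  proof (rule ccontr)
    assume "dot J ?r ?r \<noteq> 0"
    then have "dot J ?r ?r > 0" using dot_self_nonneg[of J ?r] by linarith
    then obtain c where c: "c * (c * dot J ?r ?r) = 1"
      by (intro that[of "1 / sqrt (dot J ?r ?r)"]) simp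
    have r0: "dot J (e j) ?r = 0" "dot J ?r (e j) = 0" if "j < card J" for j
      using dot_residual_orthonormal[OF on that, of v] by (simp_all add: dot_commute)
    define r where "r = ?r"
    have "orthonormal J (Suc (card J)) (e(card J := (\<lambda>p. c * r p)))"
      using on c r0 unfolding orthonormal_def r_def[symmetric]
      by (auto simp: less_Suc_eq dot_scale_left dot_scale_right)
    from orthonormal_card_le[OF J this] show False by simp
  qed
  then show ?thesis using p by (simp add: dot_self_eq_0_iff[OF J])
qed

lemma Parseval:
  assumes "finite J" "orthonormal J (card J) e"
  shows "dot J v v = (\<Sum>i<card J. (dot J (e i) v)\<^sup>2)"
proof -
  have "dot J (\<lambda>p. v p - (\<Sum>i<card J. dot J (e i) v * e i p)) (\<lambda>p. v p - (\<Sum>i<card J. dot J (e i) v * e i p)) = 0"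
    using orthonormal_expansion[OF assms, of _ v] by (simp add: dot_self_eq_0_iff[OF assms(1)])
  then show ?thesis unfolding Bessel[OF assms(2)] by simp
qed

subsection \<open>Gram--Schmidt residuals and least squares\<close>

text \<open>Left unnormalised, so that only squared norms are divided by. If an earlier vector
  vanishes, division by zero yields 0 and its term drops out; the recursion therefore also makes
  sense for dependent columns.\<close>

fun gram_schmidt :: "'p set \<Rightarrow> (nat \<Rightarrow> 'p \<Rightarrow> real) \<Rightarrow> nat \<Rightarrow> 'p \<Rightarrow> real" where
  "gram_schmidt J W k = (\<lambda>p. W k p - (\<Sum>j<k. dot J (W k) (gram_schmidt J W j)
      / dot J (gram_schmidt J W j) (gram_schmidt J W j) * gram_schmidt J W j p))"

declare gram_schmidt.simps [simp del]

definition residual :: "'p set \<Rightarrow> (nat \<Rightarrow> 'p \<Rightarrow> real) \<Rightarrow> nat \<Rightarrow> ('p \<Rightarrow> real) \<Rightarrow> 'p \<Rightarrow> real" where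
  "residual J W k v = (\<lambda>p. v p - (\<Sum>j<k. dot J v (gram_schmidt J W j)
      / dot J (gram_schmidt J W j) (gram_schmidt J W j) * gram_schmidt J W j p))"

lemma gram_schmidt_residual: "gram_schmidt J W k = residual J W k (W k)"
  unfolding residual_def by (rule gram_schmidt.simps)

lemma dot_eq_0_of_self_eq_0: "finite J \<Longrightarrow> dot J u u = 0 \<Longrightarrow> dot J v u = 0"
  unfolding dot_self_eq_0_iff by (simp add: dot_def)

text \<open>Orthogonality is assumed only below \<open>k\<close>, so that the lemma can serve inside
  the induction that establishes it in general.\<close>

lemma residual_orthogonal_aux:
  assumes J: "finite J" and orth: "\<And>i j. i < k \<Longrightarrow> j < k \<Longrightarrow> i \<noteq> j \<Longrightarrow> dot J (gram_schmidt J W i) (gram_schmidt J W j) = 0"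
    and l: "l < k"
  shows "dot J (residual J W k v) (gram_schmidt J W l) = 0"
proof -
  let ?g = "gram_schmidt J W"
  \<comment> \<open>The case of a vanishing \<open>?g l\<close> fits in: the quotient is then 0, and
    so is \<open>dot J v (?g l)\<close>.\<close>
  have "(\<Sum>j<k. dot J v (?g j) / dot J (?g j) (?g j) * dot J (?g j) (?g l))
    = (\<Sum>j<k. if j = l then dot J v (?g l) else 0)"
    using dot_eq_0_of_self_eq_0[OF J, of "?g l" v] l by (intro sum.cong) (auto simp: orth)
  then show ?thesis using l unfolding residual_def by (simp add: dot_simps del: times_divide_eq_left)
qed

lemma gram_schmidt_orthogonal:
  assumes J: "finite J" and "i \<noteq> j"
  shows "dot J (gram_schmidt J W i) (gram_schmidt J W j) = 0"
proof -
  have "\<forall>i<k. \<forall>j<k. i \<noteq> j \<longrightarrow> dot J (gram_schmidt J W i) (gram_schmidt J W j) = 0" for k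
  proof (induction k)
    case (Suc k)
    have "dot J (gram_schmidt J W k) (gram_schmidt J W l) = 0" if "l < k" for l
      unfolding gram_schmidt_residual[of J W k] using Suc that by (intro residual_orthogonal_aux[OF J]) auto
    moreover have "dot J (gram_schmidt J W l) (gram_schmidt J W k) = 0" if "l < k" for l
      using calculation[OF that] by (simp add: dot_commute)
    ultimately show ?case using Suc by (auto simp: less_Suc_eq)
  qed simp
  from this[of "Suc (max i j)"] assms(2) show ?thesis by auto
qed

lemma residual_orthogonal:
  assumes "finite J" "l < k"
  shows "dot J (residual J W k v) (gram_schmidt J W l) = 0"
  using assms by (intro residual_orthogonal_aux gram_schmidt_orthogonal)

lemma residual_orthogonal_column:
  assumes J: "finite J" and "l < k"
  shows "dot J (residual J W k v) (W l) = 0"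
proof -
  have "W l = (\<lambda>p. gram_schmidt J W l p + (\<Sum>j<l. dot J (W l) (gram_schmidt J W j)
      / dot J (gram_schmidt J W j) (gram_schmidt J W j) * gram_schmidt J W j p))"
    by (subst gram_schmidt.simps) simp
  then have "dot J (residual J W k v) (W l) = dot J (residual J W k v) (\<lambda>p. gram_schmidt J W l p + (\<Sum>j<l. dot J (W l) (gram_schmidt J W j)
      / dot J (gram_schmidt J W j) (gram_schmidt J W j) * gram_schmidt J W j p))"
    by (rule arg_cong)
  also have "\<dots> = 0"
    using assms by (simp add: dot_simps residual_orthogonal del: times_divide_eq_left)
  finally show ?thesis .
qed

text \<open>Row \<open>j\<close> of the unit lower triangular matrix that expresses the Gram-Schmidt
  vectors in the original columns. Having a recursion, and not mere existence, makes the entries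
  measurable in the data.\<close>

fun gs_coef :: "'p set \<Rightarrow> (nat \<Rightarrow> 'p \<Rightarrow> real) \<Rightarrow> nat \<Rightarrow> nat \<Rightarrow> real" where
  "gs_coef J W j l = (if l = j then 1 else if l > j then 0 else
     - (\<Sum>i<j. dot J (W j) (gram_schmidt J W i) / dot J (gram_schmidt J W i) (gram_schmidt J W i) * gs_coef J W i l))"

declare gs_coef.simps [simp del]

lemma gs_coef_diag [simp]: "gs_coef J W j j = 1"
  and gs_coef_above [simp]: "l > j \<Longrightarrow> gs_coef J W j l = 0"
  by (simp_all add: gs_coef.simps[of J W j l] gs_coef.simps[of J W j j])

lemma gram_schmidt_eq_combination:
  "j < k \<Longrightarrow> gram_schmidt J W j p = (\<Sum>l<k. gs_coef J W j l * W l p)"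
proof (induction j rule: less_induct)
  case (less j)
  let ?c = "\<lambda>i. dot J (W j) (gram_schmidt J W i) / dot J (gram_schmidt J W i) (gram_schmidt J W i)"
  have "gram_schmidt J W j p = W j p - (\<Sum>i<j. ?c i * (\<Sum>l<k. gs_coef J W i l * W l p))"
    using less by (subst gram_schmidt.simps) (auto intro!: sum.cong)
  also have "\<dots> = (\<Sum>l<k. if l = j then W j p else 0) - (\<Sum>l<k. \<Sum>i<j. ?c i * gs_coef J W i l * W l p)"
    using less.prems by (simp add: sum.swap[of _ "{..<k}" "{..<j}"] sum_distrib_left mult.assoc)
  also have "\<dots> = (\<Sum>l<k. gs_coef J W j l * W l p)"
    unfolding sum_subtractf[symmetric]
  proof (intro sum.cong refl)
    fix l
    have "(\<Sum>i<j. ?c i * gs_coef J W i l * W l p) = 0" if "l \<ge> j"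
      using that by (intro sum.neutral) auto
    then show "(if l = j then W j p else 0) - (\<Sum>i<j. ?c i * gs_coef J W i l * W l p) = gs_coef J W j l * W l p"
      by (auto simp: gs_coef.simps[of J W j l] sum_distrib_right)
  qed
  finally show ?case .
qed

text \<open>The projection onto the Gram-Schmidt vectors, rewritten in the original columns: a
  least-squares solution obtained without inverting a Gram matrix. For dependent columns it is still
  one of the solutions.\<close>

definition ls_coef :: "'p set \<Rightarrow> (nat \<Rightarrow> 'p \<Rightarrow> real) \<Rightarrow> nat \<Rightarrow> ('p \<Rightarrow> real) \<Rightarrow> nat \<Rightarrow> real" where
  "ls_coef J W k v l = (\<Sum>j<k. dot J v (gram_schmidt J W j)
      / dot J (gram_schmidt J W j) (gram_schmidt J W j) * gs_coef J W j l)"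

lemma residual_eq_ls_coef:
  "residual J W k v p = v p - (\<Sum>l<k. ls_coef J W k v l * W l p)"
proof -
  let ?c = "\<lambda>i. dot J v (gram_schmidt J W i) / dot J (gram_schmidt J W i) (gram_schmidt J W i)"
  have "(\<Sum>j<k. ?c j * gram_schmidt J W j p) = (\<Sum>j<k. \<Sum>l<k. ?c j * (gs_coef J W j l * W l p))"
    by (intro sum.cong refl) (simp add: gram_schmidt_eq_combination[of _ k] sum_distrib_left)
  also have "\<dots> = (\<Sum>l<k. ls_coef J W k v l * W l p)"
    unfolding ls_coef_def by (subst sum.swap) (simp add: sum_distrib_right mult.assoc)
  finally show ?thesis unfolding residual_def by simp
qed

text \<open>By triangularity, among the Gram-Schmidt vectors in use only the last one involves the
  last column. This is what makes the last coefficient the convenient one.\<close>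

lemma ls_coef_last:
  "ls_coef J W (Suc k) v k = dot J v (gram_schmidt J W k) / dot J (gram_schmidt J W k) (gram_schmidt J W k)"
  unfolding ls_coef_def by simp

text \<open>Linear independence in a form that can be verified column by column and whose
  measurability follows from that of the Gram-Schmidt vectors; the usual form is
  \<open>full_rank_iff_independent\<close>.\<close>

definition full_rank :: "'p set \<Rightarrow> (nat \<Rightarrow> 'p \<Rightarrow> real) \<Rightarrow> nat \<Rightarrow> bool" where
  "full_rank J W k \<longleftrightarrow> (\<forall>j<k. dot J (gram_schmidt J W j) (gram_schmidt J W j) \<noteq> 0)"

lemma full_rank_iff_independent:
  assumes J: "finite J"
  shows "full_rank J W k \<longleftrightarrow> (\<forall>c. (\<forall>p\<in>J. (\<Sum>l<k. c l * W l p) = 0) \<longrightarrow> (\<forall>l<k. c l = 0))"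
proof
  assume "full_rank J W k"
  then show "\<forall>c. (\<forall>p\<in>J. (\<Sum>l<k. c l * W l p) = 0) \<longrightarrow> (\<forall>l<k. c l = 0)"
  proof (induction k)
    case (Suc k)
    let ?g = "gram_schmidt J W k"
    have fr: "full_rank J W k" and g: "dot J ?g ?g \<noteq> 0" using Suc.prems by (auto simp: full_rank_def)
    show ?case
    proof (intro allI impI)
      fix c l assume c: "\<forall>p\<in>J. (\<Sum>l<Suc k. c l * W l p) = 0" and l: "l < Suc k"
      \<comment> \<open>Pairing a dependence with the last Gram-Schmidt vector annihilates every
        column except the last, which isolates \<open>c k\<close>.\<close>
      have orth: "dot J ?g (W l) = 0" if "l < k" for l
        unfolding gram_schmidt_residual using residual_orthogonal_column[OF J that] .
      have gW: "dot J ?g (W k) = dot J ?g ?g"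
      proof -
        have "dot J ?g ?g = dot J ?g (residual J W k (W k))" by (simp add: gram_schmidt_residual)
        also have "\<dots> = dot J ?g (W k)"
          unfolding residual_def using gram_schmidt_orthogonal[OF J, of k _ W]
          by (simp add: dot_simps del: times_divide_eq_left)
        finally show ?thesis ..
      qed
      have "0 = dot J ?g (\<lambda>p. \<Sum>l<Suc k. c l * W l p)"
        using c unfolding dot_def by simp
      also have "\<dots> = c k * dot J ?g ?g" using orth gW by (simp add: dot_simps)
      finally have ck: "c k = 0" using g by simp
      with c have "\<forall>p\<in>J. (\<Sum>l<k. c l * W l p) = 0" by simp
      with Suc.IH[OF fr] have "\<forall>l<k. c l = 0" by blast
      with ck l show "c l = 0" by (auto simp: less_Suc_eq)
    qed
  qed simp
next
  assume ind: "\<forall>c. (\<forall>p\<in>J. (\<Sum>l<k. c l * W l p) = 0) \<longrightarrow> (\<forall>l<k. c l = 0)"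
  show "full_rank J W k"
    unfolding full_rank_def
  proof (intro allI impI notI)
    \<comment> \<open>A vanishing Gram-Schmidt vector is itself a dependence among the columns, with
      coefficient 1 at column \<open>j\<close>.\<close>
    fix j assume j: "j < k" and "dot J (gram_schmidt J W j) (gram_schmidt J W j) = 0"
    then have "\<forall>p\<in>J. (\<Sum>l<k. gs_coef J W j l * W l p) = 0"
      by (simp add: dot_self_eq_0_iff[OF J] gram_schmidt_eq_combination[OF j])
    with ind j have "gs_coef J W j j = 0" by blast
    then show False by simp
  qed
qed

text \<open>Pythagoras: the residual is orthogonal to every column. The second summand is the excess
  over the least possible value, so this identity both gives the minimum and describes all
  minimisers.\<close>

lemma dot_residual_decomposition:
  assumes J: "finite J"
  shows "dot J (\<lambda>p. v p - (\<Sum>l<k. c l * W l p)) (\<lambda>p. v p - (\<Sum>l<k. c l * W l p)) =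
    dot J (residual J W k v) (residual J W k v)
     + dot J (\<lambda>p. \<Sum>l<k. (ls_coef J W k v l - c l) * W l p) (\<lambda>p. \<Sum>l<k. (ls_coef J W k v l - c l) * W l p)"
proof -
  let ?r = "residual J W k v" and ?d = "\<lambda>p. \<Sum>l<k. (ls_coef J W k v l - c l) * W l p"
  have "v p - (\<Sum>l<k. c l * W l p) = ?r p + ?d p" for p
    by (simp add: residual_eq_ls_coef left_diff_distrib sum_subtractf)
  moreover have "dot J ?r ?d = 0" "dot J ?d ?r = 0"
    by (simp_all add: dot_simps residual_orthogonal_column[OF J] dot_commute[of J "W _" ?r])
  ultimately show ?thesis
    by (simp add: dot_add_left dot_add_right)
qed

section \<open>Insensitivity to restricting the data matrix, and measurability\<close>

lemma gram_schmidt_cong: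
  assumes "\<And>l p. l \<le> k \<Longrightarrow> p \<in> J \<Longrightarrow> W l p = W' l p" "p \<in> J"
  shows "gram_schmidt J W k p = gram_schmidt J W' k p"
  using assms
proof (induction k arbitrary: p rule: less_induct)
  case (less k)
  then have "dot J (W k) (gram_schmidt J W j) = dot J (W' k) (gram_schmidt J W' j)"
    "dot J (gram_schmidt J W j) (gram_schmidt J W j) = dot J (gram_schmidt J W' j) (gram_schmidt J W' j)"
    if "j < k" for j
    using that by (auto intro!: dot_cong)
  moreover have "gram_schmidt J W j p = gram_schmidt J W' j p" if "j < k" for j
    using less that by auto
  ultimately show ?case
    using less.prems by (subst (1 2) gram_schmidt.simps) simp
qed

lemma dot_gram_schmidt_cong:
  assumes "\<And>l p. l \<le> k \<Longrightarrow> p \<in> J \<Longrightarrow> W l p = W' l p"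
  shows "dot J (gram_schmidt J W k) (gram_schmidt J W k) = dot J (gram_schmidt J W' k) (gram_schmidt J W' k)"
  using assms by (intro dot_cong gram_schmidt_cong) auto

lemma full_rank_cong:
  assumes "\<And>l p. l < k \<Longrightarrow> p \<in> J \<Longrightarrow> W l p = W' l p"
  shows "full_rank J W k \<longleftrightarrow> full_rank J W' k"
proof -
  have "dot J (gram_schmidt J W j) (gram_schmidt J W j) = dot J (gram_schmidt J W' j) (gram_schmidt J W' j)" if "j < k" for j
    using that assms by (intro dot_gram_schmidt_cong) auto
  then show ?thesis unfolding full_rank_def by simp
qed

lemma residual_cong:
  assumes "\<And>l p. l < k \<Longrightarrow> p \<in> J \<Longrightarrow> W l p = W' l p" "\<And>p. p \<in> J \<Longrightarrow> v p = v' p" "p \<in> J"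
  shows "residual J W k v p = residual J W' k v' p"
proof -
  have "gram_schmidt J W j q = gram_schmidt J W' j q" if "j < k" "q \<in> J" for j q
    using assms that by (intro gram_schmidt_cong) auto
  then show ?thesis
    unfolding residual_def using assms by (auto intro!: sum.cong arg_cong2[where f="(*)"] arg_cong2[where f="(/)"] dot_cong)
qed

lemma borel_measurable_gram_schmidt:
  assumes "\<And>l p. l \<le> k \<Longrightarrow> p \<in> J \<Longrightarrow> (\<lambda>x. W x l p) \<in> borel_measurable M" "p \<in> J"
  shows "(\<lambda>x. gram_schmidt J (W x) k p) \<in> borel_measurable M"
  using assms
proof (induction k arbitrary: p rule: less_induct)
  case (less k)
  have [measurable]: "(\<lambda>x. gram_schmidt J (W x) j p) \<in> borel_measurable M" if "j < k" "p \<in> J" for j p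
    using less that by auto
  have [measurable]: "(\<lambda>x. W x k p) \<in> borel_measurable M" if "p \<in> J" for p
    using less.prems that by auto
  show ?case
    using less.prems(2)
    by (subst gram_schmidt.simps) (intro borel_measurable_diff borel_measurable_sum borel_measurable_times borel_measurable_divide borel_measurable_dot; measurable)
qed

lemma borel_measurable_gs_coef:
  assumes "\<And>l p. l \<le> k \<Longrightarrow> p \<in> J \<Longrightarrow> (\<lambda>x. W x l p) \<in> borel_measurable M"
  shows "(\<lambda>x. gs_coef J (W x) k i) \<in> borel_measurable M"
  using assms
proof (induction k rule: less_induct)
  case (less k)
  have [measurable]: "(\<lambda>x. gram_schmidt J (W x) j p) \<in> borel_measurable M" if "j < k" "p \<in> J" for j p
    using less that by (intro borel_measurable_gram_schmidt) auto
  have [measurable]: "(\<lambda>x. gs_coef J (W x) j i) \<in> borel_measurable M" if "j < k" for j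
    using less that by auto
  have [measurable]: "(\<lambda>x. W x k p) \<in> borel_measurable M" if "p \<in> J" for p
    using less.prems that by auto
  consider "i = k" | "i > k" | "i < k" by linarith
  then show ?case
  proof cases
    case 3
    have "(\<lambda>x. - (\<Sum>j<k. dot J (W x k) (gram_schmidt J (W x) j) /
        dot J (gram_schmidt J (W x) j) (gram_schmidt J (W x) j) * gs_coef J (W x) j i)) \<in> borel_measurable M"
      by (intro borel_measurable_uminus borel_measurable_sum borel_measurable_times borel_measurable_divide borel_measurable_dot; measurable)
    with 3 show ?thesis
      by (simp add: gs_coef.simps[of J _ k])
  qed (simp_all add: gs_coef.simps[of _ _ k])
qed

lemma borel_measurable_ls_coef:
  assumes "\<And>l p. l < k \<Longrightarrow> p \<in> J \<Longrightarrow> (\<lambda>x. W x l p) \<in> borel_measurable M"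
    and [measurable]: "\<And>p. p \<in> J \<Longrightarrow> (\<lambda>x. v x p) \<in> borel_measurable M"
  shows "(\<lambda>x. ls_coef J (W x) k (v x) i) \<in> borel_measurable M"
proof -
  have [measurable]: "(\<lambda>x. gram_schmidt J (W x) j p) \<in> borel_measurable M" if "j < k" "p \<in> J" for j p
    using assms that by (intro borel_measurable_gram_schmidt) auto
  have [measurable]: "(\<lambda>x. gs_coef J (W x) j i) \<in> borel_measurable M" if "j < k" for j
    using assms that by (intro borel_measurable_gs_coef) auto
  show ?thesis
    unfolding ls_coef_def
    by (intro borel_measurable_sum borel_measurable_times borel_measurable_divide borel_measurable_dot; measurable)
qed

lemma borel_measurable_dot_gram_schmidt:
  assumes "\<And>l p. l \<le> k \<Longrightarrow> p \<in> J \<Longrightarrow> (\<lambda>x. W x l p) \<in> borel_measurable M"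
  shows "(\<lambda>x. dot J (gram_schmidt J (W x) k) (gram_schmidt J (W x) k)) \<in> borel_measurable M"
  using assms by (intro borel_measurable_dot borel_measurable_gram_schmidt) auto

lemma ls_coef_unique:
  assumes J: "finite J" and full: "full_rank J W k"
    and orth: "\<And>l. l < k \<Longrightarrow> dot J (\<lambda>p. v p - (\<Sum>j<k. c j * W j p)) (W l) = 0" and l: "l < k"
  shows "c l = ls_coef J W k v l"
proof -
  let ?d = "\<lambda>p. \<Sum>l<k. (ls_coef J W k v l - c l) * W l p"
  have d: "?d p = (v p - (\<Sum>j<k. c j * W j p)) - residual J W k v p" for p
    by (simp add: residual_eq_ls_coef left_diff_distrib sum_subtractf)
  have "dot J ?d (W j) = 0" if "j < k" for j
    unfolding d dot_diff_left[of J "\<lambda>p. v p - _ p"] using orth[OF that] residual_orthogonal_column[OF J that] by simp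
  then have "dot J ?d ?d = 0"
    by (simp add: dot_sum_right dot_scale_right)
  then have "\<forall>p\<in>J. ?d p = 0" using J by (simp add: dot_self_eq_0_iff)
  then have "\<forall>l<k. ls_coef J W k v l - c l = 0"
    using full_rank_iff_independent[OF J, THEN iffD1, OF full, THEN spec, of "\<lambda>l. ls_coef J W k v l - c l"]
    by blast
  with l show ?thesis by simp
qed

text \<open>The normalised Gram-Schmidt vectors are completed to an orthonormal basis; the residual
  is what lives on the added directions. Their number is the source of the degrees of
  freedom.\<close>

lemma residual_orthonormal_coordinates:
  assumes J: "finite J" and full: "full_rank J W k"
  obtains e where "orthonormal J (card J) e" "k \<le> card J"
    "\<And>v. dot J (residual J W k v) (residual J W k v) = (\<Sum>i\<in>{k..<card J}. (dot J (e i) v)\<^sup>2)"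
proof -
  define c where "c j = 1 / sqrt (dot J (gram_schmidt J W j) (gram_schmidt J W j))" for j
  have c: "c j * (c j * dot J (gram_schmidt J W j) (gram_schmidt J W j)) = 1"
    "c j * c j = 1 / dot J (gram_schmidt J W j) (gram_schmidt J W j)" if "j < k" for j
    using full that dot_self_nonneg[of J "gram_schmidt J W j"] unfolding full_rank_def c_def by auto
  let ?e = "\<lambda>j p. c j * gram_schmidt J W j p"
  have on: "orthonormal J k ?e"
    using gram_schmidt_orthogonal[OF J, of _ _ W] c unfolding orthonormal_def
    by (auto simp: dot_scale_left dot_scale_right)
  obtain e where e: "orthonormal J (card J) e" "\<And>i. i < k \<Longrightarrow> e i = ?e i"
    using orthonormal_completion[OF J on] by metis
  have k: "k \<le> card J" by (rule orthonormal_card_le[OF J on])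
  have "dot J (residual J W k v) (residual J W k v) = (\<Sum>i\<in>{k..<card J}. (dot J (e i) v)\<^sup>2)" for v
  proof -
    have "residual J W k v = (\<lambda>p. v p - (\<Sum>i<k. dot J (?e i) v * ?e i p))"
    proof
      fix p
      have "dot J (?e i) v * ?e i p = dot J v (gram_schmidt J W i) / dot J (gram_schmidt J W i) (gram_schmidt J W i) * gram_schmidt J W i p"
        if "i < k" for i
      proof -
        have "dot J (?e i) v * ?e i p = (c i * c i) * (dot J v (gram_schmidt J W i) * gram_schmidt J W i p)"
          by (simp add: dot_scale_left dot_commute[of J v])
        then show ?thesis unfolding c(2)[OF that] by simp
      qed
      then show "residual J W k v p = v p - (\<Sum>i<k. dot J (?e i) v * ?e i p)"
        unfolding residual_def by (intro arg_cong2[where f="(-)"] refl sum.cong) (simp only: lessThan_iff)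
    qed
    then have "dot J (residual J W k v) (residual J W k v) = dot J v v - (\<Sum>i<k. (dot J (?e i) v)\<^sup>2)"
      by (simp only: Bessel[OF on])
    also have "\<dots> = (\<Sum>i<card J. (dot J (e i) v)\<^sup>2) - (\<Sum>i<k. (dot J (e i) v)\<^sup>2)"
      by (simp add: Parseval[OF J e(1)] e(2))
    also have "\<dots> = (\<Sum>i\<in>{k..<card J}. (dot J (e i) v)\<^sup>2)"
      using k by (simp add: sum_diff[symmetric] lessThan_minus_lessThan)
    finally show ?thesis .
  qed
  with e(1) k show ?thesis by (rule that)
qed

text \<open>For fixed columns, the coordinates along the added directions are again standard
  Gaussian, so the squared residual is chi-square with \<open>card J - k\<close> degrees of freedom.
  Only its moment generating function is recorded, since the Chernoff bounds work with nothing
  else.\<close>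

lemma nn_integral_exp_residual:
  assumes J: "finite J" and full: "full_rank J W k" and l: "l < 1 / 2"
  shows "(\<integral>\<^sup>+ v. exp (l * dot J (residual J W k v) (residual J W k v)) \<partial>std_gaussian J)
    = ennreal ((1 - 2 * l) powr (- real (card J - k) / 2))"
proof -
  obtain e where e: "orthonormal J (card J) e"
    "\<And>v. dot J (residual J W k v) (residual J W k v) = (\<Sum>i\<in>{k..<card J}. (dot J (e i) v)\<^sup>2)"
    by (rule residual_orthonormal_coordinates[OF J full]) blast
  let ?I = "{k..<card J}"
  have d: "distr (std_gaussian J) (PiM ?I (\<lambda>_. borel)) (\<lambda>y. \<lambda>i\<in>?I. dot J (e i) y) = std_gaussian ?I"
    using e(1) by (intro distr_std_gaussian_orthonormal J) (auto simp: orthonormal_def)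
  have m: "(\<lambda>y. \<lambda>i\<in>?I. dot J (e i) y) \<in> std_gaussian J \<rightarrow>\<^sub>M PiM ?I (\<lambda>_. borel)"
    by measurable
  have f: "(\<lambda>x. ennreal (exp (l * (\<Sum>i\<in>?I. (x i)\<^sup>2)))) \<in> borel_measurable (PiM ?I (\<lambda>_. borel))"
    by measurable
  have "(\<integral>\<^sup>+ v. exp (l * (\<Sum>i\<in>?I. (dot J (e i) v)\<^sup>2)) \<partial>std_gaussian J)
    = (\<integral>\<^sup>+ x. exp (l * (\<Sum>i\<in>?I. (x i)\<^sup>2)) \<partial>distr (std_gaussian J) (PiM ?I (\<lambda>_. borel)) (\<lambda>y. \<lambda>i\<in>?I. dot J (e i) y))"
    by (subst nn_integral_distr[OF m]) (use f in simp_all)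
  then show ?thesis
    unfolding e(2) d using nn_integral_exp_sum_squares_std_gaussian[OF l, of ?I] by simp
qed

lemma AE_residual_nonzero:
  assumes J: "finite J" and full: "full_rank J W k" and k: "k < card J"
  shows "AE v in std_gaussian J. dot J (residual J W k v) (residual J W k v) \<noteq> 0"
proof -
  obtain e where e: "orthonormal J (card J) e"
    "\<And>v. dot J (residual J W k v) (residual J W k v) = (\<Sum>i\<in>{k..<card J}. (dot J (e i) v)\<^sup>2)"
    by (rule residual_orthonormal_coordinates[OF J full]) blast
  let ?I = "{k..<card J}"
  have d: "distr (std_gaussian J) (PiM ?I (\<lambda>_. borel)) (\<lambda>y. \<lambda>i\<in>?I. dot J (e i) y) = std_gaussian ?I"
    using e(1) by (intro distr_std_gaussian_orthonormal J) (auto simp: orthonormal_def)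
  have "AE x in std_gaussian ?I. x k \<noteq> 0"
    using k by (intro AE_std_gaussian_nonzero) simp
  then have "AE v in std_gaussian J. (\<lambda>i\<in>?I. dot J (e i) v) k \<noteq> 0"
    unfolding d[symmetric] by (rule AE_distrD[rotated]) measurable
  then show ?thesis
    unfolding e(2)
  proof eventually_elim
    case (elim v)
    then show ?case using k by (subst sum_nonneg_eq_0_iff) (auto intro!: bexI[of _ k])
  qed
qed

subsection \<open>Gaussian data matrices\<close>

text \<open>A data matrix is stored flat: entry \<open>(i, l)\<close> is the \<open>i\<close>th observation of column \<open>l\<close>.\<close>

abbreviation (input) columns :: "('p \<times> nat \<Rightarrow> real) \<Rightarrow> nat \<Rightarrow> 'p \<Rightarrow> real" where
  "columns x \<equiv> (\<lambda>l i. x (i, l))"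

text \<open>It is used in two roles. With the response in column \<open>k\<close> it is the residual
  sum of squares after regression on the first \<open>k\<close> columns; with column
  \<open>k\<close> as the last of \<open>Suc k\<close> regressors it is the variable
  \<open>B\<close> that governs the coefficients.\<close>

definition sq_resid :: "nat \<Rightarrow> nat \<Rightarrow> (nat \<times> nat \<Rightarrow> real) \<Rightarrow> real" where
  "sq_resid n k x = dot {..<n} (gram_schmidt {..<n} (columns x) k) (gram_schmidt {..<n} (columns x) k)"

lemma sq_resid_nonneg: "0 \<le> sq_resid n k x"
  by (simp add: sq_resid_def)

lemma borel_measurable_sq_resid:
  "k \<le> k' \<Longrightarrow> sq_resid n k \<in> borel_measurable (PiM ({..<n} \<times> {..k'}) (\<lambda>_. borel))"
  unfolding sq_resid_def[abs_def]
  by (intro borel_measurable_dot_gram_schmidt measurable_component_singleton) auto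

lemma sq_resid_cong:
  "(\<And>i l. i < n \<Longrightarrow> l \<le> k \<Longrightarrow> x (i, l) = x' (i, l)) \<Longrightarrow> sq_resid n k x = sq_resid n k x'"
  unfolding sq_resid_def by (intro dot_gram_schmidt_cong) auto

lemma sets_Collect_full_rank:
  assumes [measurable]: "\<And>l p. l < k \<Longrightarrow> p \<in> J \<Longrightarrow> (\<lambda>x. W x l p) \<in> borel_measurable M"
  shows "{x \<in> space M. full_rank J (W x) k} \<in> sets M"
proof -
  have [measurable]: "(\<lambda>x. dot J (gram_schmidt J (W x) j) (gram_schmidt J (W x) j)) \<in> borel_measurable M" if "j < k" for j
    using that assms by (intro borel_measurable_dot_gram_schmidt) auto
  have "{x \<in> space M. \<forall>j\<in>{..<k}. dot J (gram_schmidt J (W x) j) (gram_schmidt J (W x) j) \<noteq> 0} \<in> sets M"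
    by (rule sets.sets_Collect_finite_All) (simp_all, measurable)
  then show ?thesis unfolding full_rank_def by (simp add: Ball_def)
qed

text \<open>Separates one column from the preceding ones, so that it can be integrated with those
  held fixed. The proof runs through the gluing map \<open>m\<close>, which inverts the splitting,
  because the law of a glued matrix can be tested on boxes.\<close>

lemma distr_std_gaussian_last_column:
  fixes n k :: nat
  shows "distr (std_gaussian ({..<n} \<times> {..k})) (PiM ({..<n} \<times> {..<k}) (\<lambda>_. borel) \<Otimes>\<^sub>M PiM {..<n} (\<lambda>_. borel))
     (\<lambda>x. (restrict x ({..<n} \<times> {..<k}), \<lambda>i\<in>{..<n}. x (i, k)))
   = std_gaussian ({..<n} \<times> {..<k}) \<Otimes>\<^sub>M std_gaussian ({..<n} :: nat set)"
  (is "distr ?K ?N ?s = ?A \<Otimes>\<^sub>M ?B")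
proof -
  define m where "m = (\<lambda>(x :: nat \<times> nat \<Rightarrow> real, g). \<lambda>(i, l)\<in>{..<n}\<times>{..k}. if l = k then g i else x (i, l) :: real)"
  interpret B: prob_space ?B by (rule prob_space_std_gaussian)
  let ?P = "PiM ({..<n}\<times>{..k}) (\<lambda>_. borel :: real measure)"
  have meas: "m \<in> ?A \<Otimes>\<^sub>M ?B \<rightarrow>\<^sub>M ?P"
  proof -
    have "(\<lambda>p. if snd j = k then snd p (fst j) else fst p j) \<in> borel_measurable (?A \<Otimes>\<^sub>M ?B)" if "j \<in> {..<n}\<times>{..k}" for j
      using that by (cases "snd j = k") (auto intro!: measurable_compose[OF measurable_snd] measurable_compose[OF measurable_fst])
    then have "(\<lambda>p. \<lambda>j\<in>{..<n}\<times>{..k}. if snd j = k then snd p (fst j) else fst p j) \<in> ?A \<Otimes>\<^sub>M ?B \<rightarrow>\<^sub>M ?P"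
      by (rule measurable_restrict)
    also have "(\<lambda>p. \<lambda>j\<in>{..<n}\<times>{..k}. if snd j = k then snd p (fst j) else fst p j) = m"
      by (auto simp: m_def fun_eq_iff restrict_def)
    finally show ?thesis .
  qed
  have K: "distr (?A \<Otimes>\<^sub>M ?B) ?P m = ?K"
    unfolding std_gaussian_def[of "{..<n}\<times>{..k}"]
  proof (rule std_gaussian.PiM_eqI)
    show "sets (distr (?A \<Otimes>\<^sub>M ?B) ?P m) = sets (PiM ({..<n} \<times> {..k}) (\<lambda>_. std_normal_distribution))"
      using sets_std_gaussian[of "{..<n} \<times> {..k}"] by (simp add: std_gaussian_def)
    fix S :: "nat \<times> nat \<Rightarrow> real set"
    assume S: "\<And>j. j \<in> {..<n} \<times> {..k} \<Longrightarrow> S j \<in> sets std_normal_distribution"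
    have vim: "m -` Pi\<^sub>E ({..<n} \<times> {..k}) S \<inter> space (?A \<Otimes>\<^sub>M ?B) = Pi\<^sub>E ({..<n} \<times> {..<k}) S \<times> Pi\<^sub>E {..<n} (\<lambda>i. S (i, k))"
    proof -
      have "m (x, g) \<in> Pi\<^sub>E ({..<n} \<times> {..k}) S \<longleftrightarrow> x \<in> Pi\<^sub>E ({..<n} \<times> {..<k}) S \<and> g \<in> Pi\<^sub>E {..<n} (\<lambda>i. S (i, k))"
        if xg: "x \<in> extensional ({..<n} \<times> {..<k})" "g \<in> extensional {..<n}" for x g
      proof -
        have "m (x, g) \<in> Pi\<^sub>E ({..<n} \<times> {..k}) S \<longleftrightarrow> (\<forall>i<n. \<forall>l\<le>k. (if l = k then g i else x (i, l)) \<in> S (i, l))"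
          unfolding m_def PiE_iff by (auto simp: Ball_def)
        also have "\<dots> \<longleftrightarrow> (\<forall>i<n. (\<forall>l<k. x (i, l) \<in> S (i, l)) \<and> g i \<in> S (i, k))"
          by (metis le_neq_implies_less less_imp_le less_irrefl order_refl)
        also have "\<dots> \<longleftrightarrow> x \<in> Pi\<^sub>E ({..<n} \<times> {..<k}) S \<and> g \<in> Pi\<^sub>E {..<n} (\<lambda>i. S (i, k))"
          using xg by (auto simp: PiE_iff)
        finally show ?thesis .
      qed
      moreover have "x \<in> extensional ({..<n} \<times> {..<k})" "g \<in> extensional {..<n}"
        if "x \<in> Pi\<^sub>E ({..<n} \<times> {..<k}) S" "g \<in> Pi\<^sub>E {..<n} (\<lambda>i. S (i, k))" for x g
        using that by (simp_all add: PiE_def)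
      ultimately have "p \<in> m -` Pi\<^sub>E ({..<n} \<times> {..k}) S \<inter> (extensional ({..<n} \<times> {..<k}) \<times> extensional {..<n}) \<longleftrightarrow>
          p \<in> Pi\<^sub>E ({..<n} \<times> {..<k}) S \<times> Pi\<^sub>E {..<n} (\<lambda>i. S (i, k))" for p
        unfolding Int_iff vimage_eq mem_Times_iff by (metis prod.collapse)
      then show ?thesis
        unfolding space_pair_measure space_std_gaussian by (rule set_eqI)
    qed
    have "emeasure (distr (?A \<Otimes>\<^sub>M ?B) ?P m) (Pi\<^sub>E ({..<n} \<times> {..k}) S)
      = emeasure (?A \<Otimes>\<^sub>M ?B) (Pi\<^sub>E ({..<n} \<times> {..<k}) S \<times> Pi\<^sub>E {..<n} (\<lambda>i. S (i, k)))"
      using S by (subst emeasure_distr[OF meas]) (auto simp: vim intro!: sets_PiM_I_finite)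
    also have "\<dots> = emeasure ?A (Pi\<^sub>E ({..<n} \<times> {..<k}) S) * emeasure ?B (Pi\<^sub>E {..<n} (\<lambda>i. S (i, k)))"
      using S by (intro B.emeasure_pair_measure_Times) (auto intro!: sets_PiM_I_finite)
    also have "\<dots> = (\<Prod>j\<in>{..<n} \<times> {..<k}. emeasure std_normal_distribution (S j)) * (\<Prod>i<n. emeasure std_normal_distribution (S (i, k)))"
      using S unfolding std_gaussian_def by (subst (1 2) std_gaussian.emeasure_PiM) auto
    also have "(\<Prod>i<n. emeasure std_normal_distribution (S (i, k))) = (\<Prod>j\<in>{..<n} \<times> {k}. emeasure std_normal_distribution (S j))"
      by (rule prod.reindex_bij_witness[of _ fst "\<lambda>i. (i, k)"]) auto
    also have "(\<Prod>j\<in>{..<n} \<times> {..<k}. emeasure std_normal_distribution (S j)) * \<dots> = (\<Prod>j\<in>{..<n} \<times> {..k}. emeasure std_normal_distribution (S j))"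
      by (subst prod.union_disjoint[symmetric]) (auto intro!: prod.cong)
    finally show "emeasure (distr (?A \<Otimes>\<^sub>M ?B) ?P m) (Pi\<^sub>E ({..<n} \<times> {..k}) S) = (\<Prod>j\<in>{..<n} \<times> {..k}. emeasure std_normal_distribution (S j))" .
  qed simp
  have sm: "?s \<in> ?P \<rightarrow>\<^sub>M ?N"
    by (intro measurable_Pair measurable_restrict_subset measurable_restrict measurable_component_singleton) auto
  have "distr ?K ?N ?s = distr (?A \<Otimes>\<^sub>M ?B) ?N (?s \<circ> m)"
    unfolding K[symmetric] using sm meas by (rule distr_distr)
  also have "\<dots> = distr (?A \<Otimes>\<^sub>M ?B) ?N (\<lambda>x. x)"
  proof (rule distr_cong[OF refl refl])
    fix p assume "p \<in> space (?A \<Otimes>\<^sub>M ?B)"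
    then show "(?s \<circ> m) p = p"
      by (cases p) (auto simp: m_def space_pair_measure space_std_gaussian extensional_def fun_eq_iff restrict_def)
  qed
  also have "\<dots> = ?A \<Otimes>\<^sub>M ?B"
    by (intro distr_id2 sets_pair_measure_cong) simp_all
  finally show ?thesis .
qed

lemma measurable_split_last_column:
  fixes n k :: nat
  shows "(\<lambda>x. (restrict x ({..<n} \<times> {..<k}), \<lambda>i\<in>{..<n}. x (i, k))) \<in>
    PiM ({..<n} \<times> {..k}) (\<lambda>_. borel) \<rightarrow>\<^sub>M PiM ({..<n} \<times> {..<k}) (\<lambda>_. borel) \<Otimes>\<^sub>M PiM {..<n} (\<lambda>_. borel :: real measure)"
  by (intro measurable_Pair measurable_restrict_subset measurable_restrict measurable_component_singleton) auto

lemma sets_pair_std_gaussian [measurable_cong]: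
  "sets (std_gaussian I \<Otimes>\<^sub>M std_gaussian J) = sets (PiM I (\<lambda>_. borel) \<Otimes>\<^sub>M PiM J (\<lambda>_. borel))"
  by (intro sets_pair_measure_cong) simp_all

lemma pair_prob_space_std_gaussian: "pair_prob_space (std_gaussian I) (std_gaussian J)"
  by (intro pair_prob_space.intro pair_sigma_finite.intro prob_space_std_gaussian
      prob_space_imp_sigma_finite)

lemma AE_std_gaussian_last_column:
  fixes n k :: nat
  assumes m: "{p \<in> space (PiM ({..<n} \<times> {..<k}) (\<lambda>_. borel) \<Otimes>\<^sub>M PiM {..<n} (\<lambda>_. borel)). P p}
      \<in> sets (PiM ({..<n} \<times> {..<k}) (\<lambda>_. borel) \<Otimes>\<^sub>M PiM {..<n} (\<lambda>_. borel))"
    and ae: "AE x in std_gaussian ({..<n} \<times> {..<k}). AE g in std_gaussian {..<n}. P (x, g)"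
  shows "AE x in std_gaussian ({..<n} \<times> {..k}). P (restrict x ({..<n} \<times> {..<k}), \<lambda>i\<in>{..<n}. x (i, k))"
proof -
  interpret pair_prob_space "std_gaussian ({..<n} \<times> {..<k})" "std_gaussian {..<n}"
    by (rule pair_prob_space_std_gaussian)
  have "AE p in std_gaussian ({..<n} \<times> {..<k}) \<Otimes>\<^sub>M std_gaussian {..<n}. P p"
    using m ae by (intro AE_pair_measure)
      (simp_all add: sets_pair_std_gaussian sets_eq_imp_space_eq[OF sets_pair_std_gaussian])
  then show ?thesis
    unfolding distr_std_gaussian_last_column[symmetric]
    by (rule AE_distrD[rotated]) (use measurable_split_last_column[of n k] in simp)
qed

lemma nn_integral_std_gaussian_last_column:
  fixes n k :: nat
  assumes m: "h \<in> borel_measurable (PiM ({..<n} \<times> {..<k}) (\<lambda>_. borel) \<Otimes>\<^sub>M PiM {..<n} (\<lambda>_. borel))"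
  shows "(\<integral>\<^sup>+x. h (restrict x ({..<n} \<times> {..<k}), \<lambda>i\<in>{..<n}. x (i, k)) \<partial>std_gaussian ({..<n} \<times> {..k}))
    = (\<integral>\<^sup>+x. \<integral>\<^sup>+g. h (x, g) \<partial>std_gaussian {..<n} \<partial>std_gaussian ({..<n} \<times> {..<k}))"
proof -
  interpret pair_prob_space "std_gaussian ({..<n} \<times> {..<k})" "std_gaussian {..<n}"
    by (rule pair_prob_space_std_gaussian)
  have "(\<integral>\<^sup>+x. \<integral>\<^sup>+g. h (x, g) \<partial>std_gaussian {..<n} \<partial>std_gaussian ({..<n} \<times> {..<k})) =
     (\<integral>\<^sup>+p. h p \<partial>(std_gaussian ({..<n} \<times> {..<k}) \<Otimes>\<^sub>M std_gaussian {..<n}))"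
    using m by (intro M2.nn_integral_fst) (simp cong: measurable_cong_sets add: measurable_cong_sets[OF sets_pair_std_gaussian refl])
  also have "\<dots> = (\<integral>\<^sup>+x. h (restrict x ({..<n} \<times> {..<k}), \<lambda>i\<in>{..<n}. x (i, k)) \<partial>std_gaussian ({..<n} \<times> {..k}))"
    unfolding distr_std_gaussian_last_column[symmetric]
    using m measurable_split_last_column[of n k] by (subst nn_integral_distr) simp_all
  finally show ?thesis ..
qed

lemma sq_resid_split:
  "sq_resid n k x = dot {..<n} (residual {..<n} (columns (restrict x ({..<n} \<times> {..<k}))) k (\<lambda>i\<in>{..<n}. x (i, k)))
     (residual {..<n} (columns (restrict x ({..<n} \<times> {..<k}))) k (\<lambda>i\<in>{..<n}. x (i, k)))"
  unfolding sq_resid_def gram_schmidt_residual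
  by (intro dot_cong residual_cong) auto

lemma measurable_pair_columns:
  assumes "l < k" "i < n"
  shows "(\<lambda>p. fst p (i, l)) \<in> borel_measurable (PiM ({..<n} \<times> {..<k}) (\<lambda>_. borel) \<Otimes>\<^sub>M N)"
  using assms by (intro measurable_compose[OF measurable_fst measurable_component_singleton]) auto

lemma measurable_pair_residual:
  fixes n k :: nat
  shows "(\<lambda>p. dot {..<n} (residual {..<n} (columns (fst p)) k (snd p)) (residual {..<n} (columns (fst p)) k (snd p)))
    \<in> borel_measurable (PiM ({..<n} \<times> {..<k}) (\<lambda>_. borel) \<Otimes>\<^sub>M PiM {..<n} (\<lambda>_. borel))" (is "_ \<in> borel_measurable ?N")
proof -
  have s: "(\<lambda>p. snd p i) \<in> borel_measurable ?N" if "i < n" for i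
    using that by (intro measurable_compose[OF measurable_snd measurable_component_singleton]) auto
  have g: "(\<lambda>p. gram_schmidt {..<n} (columns (fst p)) j i) \<in> borel_measurable ?N" if "j < k" "i < n" for i j
    using that by (intro borel_measurable_gram_schmidt measurable_pair_columns) auto
  have "(\<lambda>p. residual {..<n} (columns (fst p)) k (snd p) i) \<in> borel_measurable ?N" if "i < n" for i
    unfolding residual_def using that s g
    by (intro borel_measurable_diff borel_measurable_sum borel_measurable_times borel_measurable_divide borel_measurable_dot) auto
  then show ?thesis by (intro borel_measurable_dot) auto
qed

text \<open>Columns are added one at a time: against a fixed design of full rank with fewer than
  \<open>n\<close> columns, a fresh Gaussian column almost surely has a nonzero residual.\<close>

lemma AE_full_rank:
  "k \<le> n \<Longrightarrow> AE x in std_gaussian ({..<n} \<times> {..<k}). full_rank {..<n} (columns x) k"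
proof (induction k)
  case (Suc k)
  let ?A = "{..<n} \<times> {..<k}"
  let ?P = "\<lambda>p. full_rank {..<n} (columns (fst p)) k \<and>
      dot {..<n} (residual {..<n} (columns (fst p)) k (snd p)) (residual {..<n} (columns (fst p)) k (snd p)) \<noteq> 0"
  have "AE x in std_gaussian ({..<n} \<times> {..k}). ?P (restrict x ?A, \<lambda>i\<in>{..<n}. x (i, k))"
  proof (rule AE_std_gaussian_last_column)
    let ?N = "PiM ?A (\<lambda>_. borel) \<Otimes>\<^sub>M PiM {..<n} (\<lambda>_. borel :: real measure)"
    have [measurable]: "Measurable.pred ?N (\<lambda>p. full_rank {..<n} (columns (fst p)) k)"
      unfolding pred_def by (intro sets_Collect_full_rank measurable_pair_columns) auto
    note [measurable] = measurable_pair_residual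
    show "{p \<in> space ?N. ?P p} \<in> sets ?N"
      by measurable
    have "AE x in std_gaussian ?A. full_rank {..<n} (columns x) k"
      using Suc by simp
    then show "AE x in std_gaussian ?A. AE g in std_gaussian {..<n}. ?P (x, g)"
    proof eventually_elim
      case (elim x)
      then show ?case using AE_residual_nonzero[OF _ elim] Suc.prems by simp
    qed
  qed
  then show ?case
    unfolding lessThan_Suc_atMost
  proof eventually_elim
    case (elim x)
    have "full_rank {..<n} (columns (restrict x ?A)) k \<longleftrightarrow> full_rank {..<n} (columns x) k"
      by (rule full_rank_cong) auto
    moreover have "sq_resid n k x \<noteq> 0"
      using elim unfolding sq_resid_split fst_conv snd_conv by blast
    ultimately show ?case
      using elim unfolding fst_conv full_rank_def sq_resid_def by (auto simp: less_Suc_eq)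
  qed
qed (simp add: full_rank_def)

lemma distr_std_gaussian_restrict:
  fixes I K :: "'i set"
  assumes "I \<subseteq> K" "finite K"
  shows "distr (std_gaussian K) (PiM I (\<lambda>_. borel)) (\<lambda>x. restrict x I) = std_gaussian I"
proof -
  have "distr (std_gaussian K) (PiM I (\<lambda>_. borel)) (\<lambda>x. restrict x I)
    = distr (PiM K (\<lambda>_. std_normal_distribution)) (PiM I (\<lambda>_. std_normal_distribution)) (\<lambda>x. restrict x I)"
    unfolding std_gaussian_def by (intro distr_cong refl sets_PiM_cong) simp
  then show ?thesis
    using std_gaussian.distr_restrict[OF assms] by (simp add: std_gaussian_def)
qed

lemma measurable_restrict_std_gaussian:
  "I \<subseteq> K \<Longrightarrow> (\<lambda>x. restrict x I :: 'i \<Rightarrow> real) \<in> std_gaussian K \<rightarrow>\<^sub>M PiM I (\<lambda>_. borel)"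
  using measurable_restrict_subset[of I K "\<lambda>_. borel :: real measure"]
  by (simp add: measurable_cong_sets[OF sets_std_gaussian refl])

lemma AE_std_gaussian_restrict:
  assumes "I \<subseteq> K" "finite K" "AE x in std_gaussian I. P x"
  shows "AE x in std_gaussian K. P (restrict x I)"
proof (rule AE_distrD[of "\<lambda>x. restrict x I" "std_gaussian K" "PiM I (\<lambda>_. borel)" P])
  show "AE x in distr (std_gaussian K) (PiM I (\<lambda>_. borel)) (\<lambda>x. restrict x I). P x"
    unfolding distr_std_gaussian_restrict[OF assms(1,2)] by (rule assms(3))
qed (rule measurable_restrict_std_gaussian[OF assms(1)])

lemma AE_full_rank':
  assumes "k \<le> n" "k \<le> k'"
  shows "AE x in std_gaussian ({..<n} \<times> {..k'}). full_rank {..<n} (columns x) k"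
proof -
  have "{..<n} \<times> {..<k} \<subseteq> {..<n} \<times> {..k'}" using assms by auto
  from AE_std_gaussian_restrict[OF this _ AE_full_rank[OF assms(1)]]
  have "AE x in std_gaussian ({..<n} \<times> {..k'}). full_rank {..<n} (columns (restrict x ({..<n} \<times> {..<k}))) k"
    by simp
  then show ?thesis
  proof eventually_elim
    case (elim x)
    have "full_rank {..<n} (columns (restrict x ({..<n} \<times> {..<k}))) k \<longleftrightarrow> full_rank {..<n} (columns x) k"
      by (rule full_rank_cong) auto
    with elim show ?case by simp
  qed
qed

text \<open>Given the first \<open>j\<close> columns, which almost surely have full rank, the
  conditional value no longer depends on them and so survives integrating them out.\<close>

lemma nn_integral_exp_sq_resid:
  assumes j: "j \<le> k" "j \<le> n" and l: "l < 1 / 2"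
  shows "(\<integral>\<^sup>+x. exp (l * sq_resid n j x) \<partial>std_gaussian ({..<n} \<times> {..k})) = ennreal ((1 - 2 * l) powr (- real (n - j) / 2))"
proof -
  have sub: "{..<n} \<times> {..j} \<subseteq> {..<n} \<times> {..k}" using j by auto
  have m: "(\<lambda>x. ennreal (exp (l * sq_resid n j x))) \<in> borel_measurable (PiM ({..<n} \<times> {..j}) (\<lambda>_. borel))"
    using borel_measurable_sq_resid[of j j n] by measurable
  have "(\<integral>\<^sup>+x. exp (l * sq_resid n j x) \<partial>std_gaussian ({..<n} \<times> {..k}))
    = (\<integral>\<^sup>+x. exp (l * sq_resid n j (restrict x ({..<n} \<times> {..j}))) \<partial>std_gaussian ({..<n} \<times> {..k}))"
    by (intro nn_integral_cong arg_cong[where f=ennreal] arg_cong[where f=exp] arg_cong2[where f="(*)"] refl sq_resid_cong) auto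
  also have "\<dots> = (\<integral>\<^sup>+x. exp (l * sq_resid n j x)
      \<partial>distr (std_gaussian ({..<n} \<times> {..k})) (PiM ({..<n} \<times> {..j}) (\<lambda>_. borel)) (\<lambda>x. restrict x ({..<n} \<times> {..j})))"
    using m by (subst nn_integral_distr[OF measurable_restrict_std_gaussian[OF sub]]) simp_all
  also have "\<dots> = (\<integral>\<^sup>+x. exp (l * sq_resid n j x) \<partial>std_gaussian ({..<n} \<times> {..j}))"
    by (simp add: distr_std_gaussian_restrict[OF sub])
  also have "\<dots> = (\<integral>\<^sup>+x. \<integral>\<^sup>+g. exp (l * dot {..<n} (residual {..<n} (columns x) j g) (residual {..<n} (columns x) j g))
       \<partial>std_gaussian {..<n} \<partial>std_gaussian ({..<n} \<times> {..<j}))"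
    unfolding sq_resid_split
    using measurable_pair_residual[of n j]
      nn_integral_std_gaussian_last_column[of "\<lambda>p. ennreal (exp (l * dot {..<n}
          (residual {..<n} (columns (fst p)) j (snd p)) (residual {..<n} (columns (fst p)) j (snd p))))" n j]
    by simp
  also have "\<dots> = (\<integral>\<^sup>+x. ennreal ((1 - 2 * l) powr (- real (n - j) / 2)) \<partial>std_gaussian ({..<n} \<times> {..<j}))"
  proof (rule nn_integral_cong_AE)
    show "AE x in std_gaussian ({..<n} \<times> {..<j}).
        (\<integral>\<^sup>+g. exp (l * dot {..<n} (residual {..<n} (columns x) j g) (residual {..<n} (columns x) j g)) \<partial>std_gaussian {..<n})
          = ennreal ((1 - 2 * l) powr (- real (n - j) / 2))"
      using AE_full_rank[OF j(2)]
      by eventually_elim (use nn_integral_exp_residual[OF _ _ l, of "{..<n}"] in simp)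
  qed
  also have "\<dots> = ennreal ((1 - 2 * l) powr (- real (n - j) / 2))"
    by (simp add: prob_space.emeasure_space_1[OF prob_space_std_gaussian])
  finally show ?thesis .
qed

section \<open>Law of the least-squares coefficients\<close>

lemma distr_std_gaussian_rotate_columns:
  fixes b :: "nat \<Rightarrow> nat \<Rightarrow> real" and n k :: nat
  assumes b: "orthonormal {..k} (Suc k) b"
  shows "distr (std_gaussian ({..<n} \<times> {..k})) (PiM ({..<n} \<times> {..k}) (\<lambda>_. borel))
      (\<lambda>x. \<lambda>(i, l)\<in>{..<n} \<times> {..k}. \<Sum>j\<le>k. b l j * x (i, j)) = std_gaussian ({..<n} \<times> {..k})"
proof -
  let ?K = "{..<n} \<times> {..k}"
  \<comment> \<open>The form \<open>a (i, l)\<close> acts on row \<open>i\<close> alone, through the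
    vector \<open>b l\<close>: one and the same rotation is applied to every row, and different rows
    use disjoint entries.\<close>
  define a where "a = (\<lambda>(i :: nat, l). \<lambda>(i' :: nat, j). if i' = i then b l j else 0)"
  have d: "dot ?K (a q) y = (\<Sum>j\<le>k. b (snd q) j * y (fst q, j))" if "q \<in> ?K" for q y
  proof -
    have "dot ?K (a q) y = (\<Sum>i'<n. \<Sum>j\<le>k. (if i' = fst q then b (snd q) j else 0) * y (i', j))"
      unfolding dot_def a_def by (simp add: sum.cartesian_product split_def)
    also have "\<dots> = (\<Sum>i'<n. if i' = fst q then \<Sum>j\<le>k. b (snd q) j * y (fst q, j) else 0)"
      by (intro sum.cong) auto
    finally show ?thesis using that by auto
  qed
  have "distr (std_gaussian ?K) (PiM ?K (\<lambda>_. borel)) (\<lambda>y. \<lambda>q\<in>?K. dot ?K (a q) y) = std_gaussian ?K"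
  proof (rule distr_std_gaussian_orthonormal)
    fix q r assume qr: "q \<in> ?K" "r \<in> ?K"
    have "dot ?K (a q) (a r) = (if fst r = fst q then dot {..k} (b (snd q)) (b (snd r)) else 0)"
      unfolding d[OF qr(1)] by (auto simp: a_def split_def dot_def)
    then show "dot ?K (a q) (a r) = (if q = r then 1 else 0)"
      using b qr unfolding orthonormal_def by (auto simp: prod_eq_iff less_Suc_eq_le)
  qed auto
  moreover have "(\<lambda>y. \<lambda>q\<in>?K. dot ?K (a q) y) = (\<lambda>x. \<lambda>(i, l)\<in>?K. \<Sum>j\<le>k. b l j * x (i, j))"
    by (auto simp: fun_eq_iff d restrict_def)
  ultimately show ?thesis by simp
qed

text \<open>With the regressors fixed, the coefficient is a linear form in the Gaussian response
  column, of variance \<open>1 / sq_resid n k x\<close>. Where \<open>sq_resid n k x\<close> is 0,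
  both integrands are 1, because division by zero yields 0.\<close>

lemma char_ls_coef_last:
  fixes n k :: nat
  shows "(CLINT x|std_gaussian ({..<n} \<times> {..Suc k}).
      iexp (\<alpha> * ls_coef {..<n} (columns x) (Suc k) (\<lambda>i. x (i, Suc k)) k))
    = (CLINT x|std_gaussian ({..<n} \<times> {..k}). of_real (exp (- \<alpha>\<^sup>2 / (2 * sq_resid n k x))))"
proof -
  let ?A = "{..<n} \<times> {..<Suc k}" and ?K = "{..<n} \<times> {..Suc k}"
  let ?N = "PiM ?A (\<lambda>_. borel) \<Otimes>\<^sub>M PiM {..<n} (\<lambda>_. borel :: real measure)"
  have A: "{..<n} \<times> {..k} = ?A" by auto
  interpret pair_prob_space "std_gaussian ?A" "std_gaussian {..<n}"
    by (rule pair_prob_space_std_gaussian)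
  define H where "H p = iexp (\<alpha> * (dot {..<n} (snd p) (gram_schmidt {..<n} (columns (fst p)) k) / sq_resid n k (fst p)))"
    for p :: "(nat \<times> nat \<Rightarrow> real) \<times> (nat \<Rightarrow> real)"
  have H[measurable]: "H \<in> borel_measurable ?N"
  proof -
    have s: "(\<lambda>p. snd p i) \<in> borel_measurable ?N" if "i < n" for i
      using that by (intro measurable_compose[OF measurable_snd measurable_component_singleton]) auto
    have g: "(\<lambda>p. gram_schmidt {..<n} (columns (fst p)) k i) \<in> borel_measurable ?N" if "i < n" for i
      using that by (intro borel_measurable_gram_schmidt measurable_pair_columns) auto
    have "(\<lambda>p. \<alpha> * (dot {..<n} (snd p) (gram_schmidt {..<n} (columns (fst p)) k) / sq_resid n k (fst p))) \<in> borel_measurable ?N"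
      unfolding sq_resid_def using s g
      by (intro borel_measurable_times borel_measurable_divide borel_measurable_dot borel_measurable_const) auto
    then show ?thesis
      unfolding H_def[abs_def] by measurable
  qed
  have "iexp (\<alpha> * ls_coef {..<n} (columns x) (Suc k) (\<lambda>i. x (i, Suc k)) k) = H (restrict x ?A, \<lambda>i\<in>{..<n}. x (i, Suc k))" for x
  proof -
    have "dot {..<n} (\<lambda>i. x (i, Suc k)) (gram_schmidt {..<n} (columns x) k)
      = dot {..<n} (\<lambda>i\<in>{..<n}. x (i, Suc k)) (gram_schmidt {..<n} (columns (restrict x ?A)) k)"
      by (intro dot_cong gram_schmidt_cong) auto
    moreover have "sq_resid n k x = sq_resid n k (restrict x ?A)"
      by (intro sq_resid_cong) auto
    ultimately show ?thesis
      unfolding H_def ls_coef_last sq_resid_def[symmetric] fst_conv snd_conv by simp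
  qed
  then have "(CLINT x|std_gaussian ?K. iexp (\<alpha> * ls_coef {..<n} (columns x) (Suc k) (\<lambda>i. x (i, Suc k)) k))
    = (CLINT x|std_gaussian ?K. H (restrict x ?A, \<lambda>i\<in>{..<n}. x (i, Suc k)))"
    by simp
  also have "\<dots> = (CLINT p|std_gaussian ?A \<Otimes>\<^sub>M std_gaussian {..<n}. H p)"
    unfolding distr_std_gaussian_last_column[symmetric]
    using measurable_split_last_column[of n "Suc k"] H by (subst integral_distr) simp_all
  also have "\<dots> = (CLINT x|std_gaussian ?A. CLINT g|std_gaussian {..<n}. H (x, g))"
  proof (rule integral_fst'[symmetric])
    show "integrable (std_gaussian ?A \<Otimes>\<^sub>M std_gaussian {..<n}) H"
      by (intro integrable_const_bound[where B=1]) (simp_all add: H_def[symmetric] measurable_cong_sets[OF sets_pair_std_gaussian refl], simp add: H_def)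
  qed
  also have "\<dots> = (CLINT x|std_gaussian ?A. of_real (exp (- \<alpha>\<^sup>2 / (2 * sq_resid n k x))))"
  proof (intro Bochner_Integration.integral_cong refl)
    fix x
    let ?g = "gram_schmidt {..<n} (columns x) k"
    have "(\<Sum>i<n. (\<alpha> * ?g i / sq_resid n k x)\<^sup>2) = \<alpha>\<^sup>2 * dot {..<n} ?g ?g / (sq_resid n k x)\<^sup>2"
      by (simp add: dot_def power_mult_distrib power_divide sum_distrib_left sum_divide_distrib power2_eq_square[of "?g _"] mult.assoc)
    also have "\<dots> = \<alpha>\<^sup>2 / sq_resid n k x"
      by (simp add: sq_resid_def power2_eq_square[of "dot _ _ _"])
    finally have sq: "(\<Sum>i<n. (\<alpha> * ?g i / sq_resid n k x)\<^sup>2) = \<alpha>\<^sup>2 / sq_resid n k x" .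
    have "H (x, g) = iexp (\<Sum>i<n. (\<alpha> * ?g i / sq_resid n k x) * g i)" for g
      unfolding H_def by (simp add: dot_def sum_distrib_left sum_divide_distrib mult_ac)
    then have "(CLINT g|std_gaussian {..<n}. H (x, g)) = of_real (exp (- (\<Sum>i<n. (\<alpha> * ?g i / sq_resid n k x)\<^sup>2) / 2))"
      by (simp only: char_std_gaussian finite_lessThan)
    then show "(CLINT g|std_gaussian {..<n}. H (x, g)) = of_real (exp (- \<alpha>\<^sup>2 / (2 * sq_resid n k x)))"
      unfolding sq by (simp add: mult.commute)
  qed
  finally show ?thesis unfolding A .
qed

text \<open>Expanding a unit vector in the basis yields the orthogonality relations of the
  transposed matrix.\<close>

lemma orthonormal_transpose:
  assumes J: "finite J" and on: "orthonormal J (card J) e" and "p \<in> J" "q \<in> J"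
  shows "(\<Sum>i<card J. e i p * e i q) = (if p = q then 1 else 0)"
proof -
  define d :: "_ \<Rightarrow> real" where "d r = (if r = p then 1 else 0)" for r
  have "dot J u d = u p" for u
    unfolding dot_def d_def using J assms(3) by (simp add: if_distrib cong: if_cong)
  then show ?thesis
    using orthonormal_expansion[OF J on assms(4), of d] by (auto simp: d_def)
qed

text \<open>In matrix form \<open>W' = W b^T\<close>, hence \<open>W' (b t) = W t\<close>: the
  fitted vector is unchanged, so \<open>b t\<close> satisfies the normal equations for
  \<open>W'\<close>, and full rank makes their solution unique.\<close>

lemma ls_coef_rotate:
  fixes b :: "nat \<Rightarrow> nat \<Rightarrow> real"
  assumes J: "finite J" and b: "orthonormal {..<k} k b"
    and W': "\<And>l p. l < k \<Longrightarrow> p \<in> J \<Longrightarrow> W' l p = (\<Sum>j<k. b l j * W j p)"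
    and v': "\<And>p. p \<in> J \<Longrightarrow> v' p = v p"
    and full: "full_rank J W' k" and l: "l < k"
  shows "ls_coef J W' k v' l = (\<Sum>j<k. b l j * ls_coef J W k v j)"
proof -
  define t where "t = ls_coef J W k v"
  define c where "c l = (\<Sum>j<k. b l j * t j)" for l
  have bt: "(\<Sum>i<k. b i j * b i j') = (if j = j' then 1 else 0)" if "j < k" "j' < k" for j j'
    using orthonormal_transpose[of "{..<k}" b j j'] b that by simp
  have comb: "(\<Sum>l<k. c l * W' l p) = (\<Sum>j<k. t j * W j p)" if p: "p \<in> J" for p
  proof -
    have "(\<Sum>l<k. c l * W' l p) = (\<Sum>l<k. \<Sum>j<k. \<Sum>j'<k. (b l j * b l j') * (t j * W j' p))"
      unfolding c_def by (intro sum.cong refl) (simp add: W'[OF _ p] sum_product mult_ac)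
    also have "\<dots> = (\<Sum>j<k. \<Sum>j'<k. \<Sum>l<k. (b l j * b l j') * (t j * W j' p))"
      by (subst sum.swap) (intro sum.cong refl sum.swap)
    also have "\<dots> = (\<Sum>j<k. \<Sum>j'<k. (if j = j' then 1 else 0) * (t j * W j' p))"
      by (intro sum.cong refl) (simp add: sum_distrib_right[symmetric] bt)
    also have "\<dots> = (\<Sum>j<k. \<Sum>j'<k. if j = j' then t j * W j p else 0)"
      by (intro sum.cong refl) auto
    also have "\<dots> = (\<Sum>j<k. t j * W j p)" by simp
    finally show ?thesis .
  qed
  have "c l = ls_coef J W' k v' l"
  proof (rule ls_coef_unique[OF J full _ l])
    fix l assume l: "l < k"
    have "dot J (\<lambda>p. v' p - (\<Sum>j<k. c j * W' j p)) (W' l) = dot J (residual J W k v) (\<lambda>p. \<Sum>j<k. b l j * W j p)"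
      by (intro dot_cong) (simp_all add: comb v' residual_eq_ls_coef t_def W'[OF l])
    also have "\<dots> = 0"
      by (simp add: dot_simps residual_orthogonal_column[OF J])
    finally show "dot J (\<lambda>p. v' p - (\<Sum>j<k. c j * W' j p)) (W' l) = 0" .
  qed
  then show ?thesis by (simp add: c_def t_def)
qed

lemma borel_measurable_ls_coef_columns:
  "(\<lambda>x. ls_coef {..<n} (columns x) k (\<lambda>i. x (i, k)) l) \<in> borel_measurable (PiM ({..<n} \<times> {..k}) (\<lambda>_. borel))"
  by (intro borel_measurable_ls_coef measurable_component_singleton) auto

text \<open>Right-rotating the design so that \<open>a\<close> becomes a multiple of the last coordinate vector
  reduces the linear form to a single coefficient.\<close>

lemma char_ls_coef:
  fixes a :: "nat \<Rightarrow> real" and n k :: nat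
  assumes n: "Suc k \<le> n"
  shows "(CLINT x|std_gaussian ({..<n} \<times> {..Suc k}).
      iexp (\<Sum>l<Suc k. a l * ls_coef {..<n} (columns x) (Suc k) (\<lambda>i. x (i, Suc k)) l))
    = (CLINT x|std_gaussian ({..<n} \<times> {..k}). of_real (exp (- (\<Sum>l<Suc k. (a l)\<^sup>2) / (2 * sq_resid n k x))))"
proof (cases "(\<Sum>l<Suc k. (a l)\<^sup>2) = 0")
  case True
  then have "\<forall>l<Suc k. a l = 0" by (subst (asm) sum_nonneg_eq_0_iff) auto
  then show ?thesis
    by (simp add: prob_space.prob_space[OF prob_space_std_gaussian])
next
  case False
  let ?m = "Suc k"
  let ?K = "{..<n} \<times> {..?m}"
  define \<alpha> where "\<alpha> = sqrt (\<Sum>l<?m. (a l)\<^sup>2)"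
  have \<alpha>2: "\<alpha>\<^sup>2 = (\<Sum>l<?m. (a l)\<^sup>2)" unfolding \<alpha>_def by (simp add: sum_nonneg)
  then have \<alpha>: "\<alpha> \<noteq> 0" using False by auto
  define u where "u l = a l / \<alpha>" for l
  have "dot {..<?m} u u = (\<Sum>l<?m. (a l)\<^sup>2) / \<alpha>\<^sup>2"
    unfolding dot_def u_def by (simp only: sum_divide_distrib power2_eq_square times_divide_times_eq)
  then have "orthonormal {..<?m} 1 (\<lambda>_. u)"
    using False by (simp add: orthonormal_def \<alpha>2)
  then obtain e where e: "orthonormal {..<?m} ?m e" "e 0 = u"
    using orthonormal_completion[of "{..<?m}" 1 "\<lambda>_. u"] by auto
  \<comment> \<open>The completion has the prescribed unit vector \<open>u\<close> in front.
    Reversing the order makes it row \<open>k\<close>, so the last rotated coefficient is the given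
    linear form divided by its norm \<open>\<alpha>\<close>.\<close>
  define b where "b l = e (k - l)" for l
  have b: "orthonormal {..<?m} ?m b"
    using e(1) unfolding orthonormal_def b_def by (auto simp: less_Suc_eq_le)
  \<comment> \<open>The rotation is extended by the identity on column \<open>Suc k\<close>, which
    holds the response.\<close>
  define b' where "b' l j = (if l < ?m then if j < ?m then b l j else 0 else if j = ?m then 1 else 0)" for l j
  have b': "orthonormal {..?m} (Suc ?m) b'"
  proof -
    have "dot {..?m} (b' i) (b' j) = (if i < ?m \<and> j < ?m then dot {..<?m} (b i) (b j) else if i < ?m \<or> j < ?m then 0 else 1)" for i j
      unfolding dot_def b'_def by (auto simp: lessThan_Suc_atMost[symmetric])
    then show ?thesis using b unfolding orthonormal_def by auto
  qed
  define r where "r x = (\<lambda>(i, l)\<in>?K. \<Sum>j\<le>?m. b' l j * x (i, j))" for x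
  have r: "r \<in> std_gaussian ?K \<rightarrow>\<^sub>M PiM ?K (\<lambda>_. borel)"
  proof -
    have "(\<lambda>x. \<lambda>q\<in>?K. \<Sum>j\<le>?m. b' (snd q) j * x (fst q, j)) \<in> std_gaussian ?K \<rightarrow>\<^sub>M PiM ?K (\<lambda>_. borel)"
      by (intro measurable_restrict borel_measurable_sum borel_measurable_times)
         (auto simp: measurable_cong_sets[OF sets_std_gaussian refl] intro!: measurable_component_singleton)
    then show ?thesis unfolding r_def[abs_def] by (simp add: split_def)
  qed
  have distr_r: "distr (std_gaussian ?K) (PiM ?K (\<lambda>_. borel)) r = std_gaussian ?K"
    unfolding r_def[abs_def] using distr_std_gaussian_rotate_columns[OF b', of n] by simp
  let ?f = "\<lambda>x. iexp (\<alpha> * ls_coef {..<n} (columns x) ?m (\<lambda>i. x (i, ?m)) k)"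
  have f: "?f \<in> borel_measurable (PiM ?K (\<lambda>_. borel))"
    using borel_measurable_ls_coef_columns[of n ?m k] by simp
  \<comment> \<open>The transformation rule for the coefficients asks for full rank of the rotated
    design. The rotated matrix has the law of the original one, so this holds almost surely.\<close>
  have "AE x in std_gaussian ?K. full_rank {..<n} (columns x) ?m"
    using n by (intro AE_full_rank') auto
  then have "AE x in distr (std_gaussian ?K) (PiM ?K (\<lambda>_. borel)) r. full_rank {..<n} (columns x) ?m"
    by (simp only: distr_r)
  then have "AE x in std_gaussian ?K. full_rank {..<n} (columns (r x)) ?m"
    by (rule AE_distrD[OF r])
  then have ae: "AE x in std_gaussian ?K.
      iexp (\<Sum>l<?m. a l * ls_coef {..<n} (columns x) ?m (\<lambda>i. x (i, ?m)) l) = ?f (r x)"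
  proof eventually_elim
    case (elim x)
    have "ls_coef {..<n} (columns (r x)) ?m (\<lambda>i. r x (i, ?m)) k = (\<Sum>j<?m. b k j * ls_coef {..<n} (columns x) ?m (\<lambda>i. x (i, ?m)) j)"
    proof (rule ls_coef_rotate[OF _ b _ _ elim])
      show "r x (p, l) = (\<Sum>j<?m. b l j * x (p, j))" if "l < ?m" "p \<in> {..<n}" for l p
        using that by (simp add: r_def b'_def lessThan_Suc_atMost[symmetric])
      show "r x (p, ?m) = x (p, ?m)" if "p \<in> {..<n}" for p
        using that by (simp add: r_def b'_def if_distrib[of "\<lambda>x. x * _"] cong: if_cong)
    qed auto
    then have "\<alpha> * ls_coef {..<n} (columns (r x)) ?m (\<lambda>i. r x (i, ?m)) k = (\<Sum>l<?m. a l * ls_coef {..<n} (columns x) ?m (\<lambda>i. x (i, ?m)) l)"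
      using \<alpha> by (simp only: sum_distrib_left b_def e(2) diff_self_eq_0 u_def) (simp add: mult.assoc[symmetric])
    then show ?case by simp
  qed
  have "(CLINT x|std_gaussian ?K. iexp (\<Sum>l<?m. a l * ls_coef {..<n} (columns x) ?m (\<lambda>i. x (i, ?m)) l))
    = (CLINT x|std_gaussian ?K. ?f (r x))"
  proof (rule integral_cong_AE)
    show "(\<lambda>x. iexp (\<Sum>l<?m. a l * ls_coef {..<n} (columns x) ?m (\<lambda>i. x (i, ?m)) l)) \<in> borel_measurable (std_gaussian ?K)"
      using borel_measurable_ls_coef_columns[of n ?m] by (simp add: measurable_cong_sets[OF sets_std_gaussian refl])
    show "(\<lambda>x. ?f (r x)) \<in> borel_measurable (std_gaussian ?K)"
      by (rule measurable_compose[OF r f])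
  qed (rule ae)
  also have "\<dots> = (CLINT x|distr (std_gaussian ?K) (PiM ?K (\<lambda>_. borel)) r. ?f x)"
    by (rule integral_distr[OF r f, symmetric])
  also have "\<dots> = (CLINT x|std_gaussian ({..<n} \<times> {..k}). of_real (exp (- \<alpha>\<^sup>2 / (2 * sq_resid n k x))))"
    unfolding distr_r by (rule char_ls_coef_last)
  finally show ?thesis unfolding \<alpha>2 .
qed

text \<open>Given \<open>B\<close>, the right-hand vector is centred Gaussian with covariance
  \<open>1 / B\<close> times the identity, which produces the transforms found in
  \<open>char_ls_coef\<close>. On the left numerator and denominator come from one matrix; on the
  right they are independent, which is what the Chernoff bound needs in order to factorise.\<close>

lemma distr_ls_coef:
  fixes n k :: nat
  assumes n: "Suc k \<le> n"
  shows "distr (std_gaussian ({..<n} \<times> {..Suc k})) (PiM {..<Suc k} (\<lambda>_. borel))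
      (\<lambda>x. \<lambda>l\<in>{..<Suc k}. ls_coef {..<n} (columns x) (Suc k) (\<lambda>i. x (i, Suc k)) l)
    = distr (std_gaussian ({..<n} \<times> {..k}) \<Otimes>\<^sub>M std_gaussian {..<Suc k}) (PiM {..<Suc k} (\<lambda>_. borel))
      (\<lambda>p. \<lambda>l\<in>{..<Suc k}. snd p l / sqrt (sq_resid n k (fst p)))"
proof -
  let ?A = "{..<n} \<times> {..k}" and ?m = "Suc k"
  interpret pair_prob_space "std_gaussian ?A" "std_gaussian {..<?m}"
    by (rule pair_prob_space_std_gaussian)
  have q: "sq_resid n k \<in> borel_measurable (std_gaussian ?A)"
    by (simp add: measurable_cong_sets[OF sets_std_gaussian refl] borel_measurable_sq_resid)
  have h: "(\<lambda>p. snd p l / sqrt (sq_resid n k (fst p))) \<in> borel_measurable (std_gaussian ?A \<Otimes>\<^sub>M std_gaussian {..<?m})" if "l < ?m" for l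
  proof -
    have "(\<lambda>h. h l) \<in> borel_measurable (std_gaussian {..<?m})"
      using that by (simp add: measurable_cong_sets[OF sets_std_gaussian refl] measurable_component_singleton)
    then show ?thesis
      using q by (intro borel_measurable_divide measurable_compose[OF measurable_snd] measurable_compose[OF measurable_fst, of "sq_resid n k"] borel_measurable_sqrt) auto
  qed
  show ?thesis
  proof (rule distr_eqI_linear_forms)
    show "prob_space (std_gaussian ?A \<Otimes>\<^sub>M std_gaussian {..<?m})"
      by (rule P.prob_space_axioms)
    show "(\<lambda>x. \<lambda>l\<in>{..<?m}. ls_coef {..<n} (columns x) ?m (\<lambda>i. x (i, ?m)) l) \<in> std_gaussian ({..<n} \<times> {..?m}) \<rightarrow>\<^sub>M PiM {..<?m} (\<lambda>_. borel)"
      using borel_measurable_ls_coef_columns[of n ?m]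
      by (intro measurable_restrict) (simp add: measurable_cong_sets[OF sets_std_gaussian refl])
    show "(\<lambda>p. \<lambda>l\<in>{..<?m}. snd p l / sqrt (sq_resid n k (fst p))) \<in> std_gaussian ?A \<Otimes>\<^sub>M std_gaussian {..<?m} \<rightarrow>\<^sub>M PiM {..<?m} (\<lambda>_. borel)"
      using h by (intro measurable_restrict) auto
    fix a :: "nat \<Rightarrow> real"
    let ?F = "\<lambda>p. iexp (\<Sum>l<?m. a l * (snd p l / sqrt (sq_resid n k (fst p))))"
    have "integrable (std_gaussian ?A \<Otimes>\<^sub>M std_gaussian {..<?m}) ?F"
    proof (intro integrable_const_bound[where B=1])
      have "(\<lambda>p. \<Sum>l<?m. a l * (snd p l / sqrt (sq_resid n k (fst p)))) \<in> borel_measurable (std_gaussian ?A \<Otimes>\<^sub>M std_gaussian {..<?m})"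
        using h by (intro borel_measurable_sum borel_measurable_times) auto
      then show "?F \<in> borel_measurable (std_gaussian ?A \<Otimes>\<^sub>M std_gaussian {..<?m})"
        by measurable
    qed simp
    from integral_fst'[OF this, symmetric]
    have "(CLINT p|std_gaussian ?A \<Otimes>\<^sub>M std_gaussian {..<?m}. ?F p) = (CLINT x|std_gaussian ?A. CLINT h|std_gaussian {..<?m}. ?F (x, h))" .
    also have "\<dots> = (CLINT x|std_gaussian ?A. of_real (exp (- (\<Sum>l<?m. (a l)\<^sup>2) / (2 * sq_resid n k x))))"
    proof (intro Bochner_Integration.integral_cong refl)
      fix x
      have "?F (x, h) = iexp (\<Sum>l<?m. (a l / sqrt (sq_resid n k x)) * h l)" for h
        unfolding fst_conv snd_conv by simp
      then have "(CLINT h|std_gaussian {..<?m}. ?F (x, h)) = of_real (exp (- (\<Sum>l<?m. (a l / sqrt (sq_resid n k x))\<^sup>2) / 2))"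
        by (simp only: char_std_gaussian finite_lessThan)
      also have "(\<Sum>l<?m. (a l / sqrt (sq_resid n k x))\<^sup>2) = (\<Sum>l<?m. (a l)\<^sup>2) / sq_resid n k x"
        by (simp only: power_divide real_sqrt_pow2 sq_resid_nonneg sum_divide_distrib)
      also have "- (s / q) / 2 = - s / (2 * q)" for s q :: real
        by simp
      finally show "(CLINT h|std_gaussian {..<?m}. ?F (x, h)) = of_real (exp (- (\<Sum>l<?m. (a l)\<^sup>2) / (2 * sq_resid n k x)))" .
    qed
    finally show "(CLINT x|std_gaussian ({..<n} \<times> {..?m}). iexp (\<Sum>l<?m. a l * (\<lambda>l\<in>{..<?m}. ls_coef {..<n} (columns x) ?m (\<lambda>i. x (i, ?m)) l) l))
      = (CLINT p|std_gaussian ?A \<Otimes>\<^sub>M std_gaussian {..<?m}. iexp (\<Sum>l<?m. a l * (\<lambda>l\<in>{..<?m}. snd p l / sqrt (sq_resid n k (fst p))) l))"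
      using char_ls_coef[OF n, of a] by simp
  qed (auto intro: prob_space_std_gaussian)
qed

subsection \<open>Chernoff bounds\<close>

text \<open>The factor \<open>\<tau>\<close> in the event treats both tails at once: its sign
  selects the side. The exact exponent \<open>\<tau> - ln (1 + \<tau>)\<close> is weakened to a
  squared difference of roots, the shape that the bound for the coefficients shares.\<close>

lemma Chernoff_sq_resid:
  fixes n k :: nat and \<tau> :: real
  assumes k: "k < n" and \<tau>: "-1 < \<tau>"
  shows "measure (std_gaussian ({..<n} \<times> {..k}))
      {x \<in> space (std_gaussian ({..<n} \<times> {..k})). 0 \<le> \<tau> * (sq_resid n k x - real (n - k) * (1 + \<tau>))}
    \<le> exp (- (real (n - k) / 2 * (sqrt (1 + \<tau>) - 1)\<^sup>2))"
proof -
  let ?G = "std_gaussian ({..<n} \<times> {..k})" and ?p = "real (n - k)"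
  interpret prob_space ?G by (rule prob_space_std_gaussian)
  have m[measurable]: "sq_resid n k \<in> borel_measurable ?G"
    by (simp add: measurable_cong_sets[OF sets_std_gaussian refl] borel_measurable_sq_resid)
  \<comment> \<open>The optimal tilt: with \<open>p\<close> degrees of freedom, the derivative in
    \<open>l\<close> of \<open>- l * p * (1 + \<tau>) - p / 2 * ln (1 - 2 * l)\<close> vanishes
    here.\<close>
  define l where "l = \<tau> / (2 * (1 + \<tau>))"
  have l: "l < 1 / 2" "1 - 2 * l = 1 / (1 + \<tau>)" using \<tau> by (simp_all add: l_def field_simps)
  let ?E = "{x \<in> space ?G. 0 \<le> \<tau> * (sq_resid n k x - ?p * (1 + \<tau>))}"
  have "emeasure ?G ?E = (\<integral>\<^sup>+x. indicator ?E x \<partial>?G)"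
    using m by (intro nn_integral_indicator[symmetric]) measurable
  also have "\<dots> \<le> (\<integral>\<^sup>+x. ennreal (exp (- l * (?p * (1 + \<tau>)))) * ennreal (exp (l * sq_resid n k x)) \<partial>?G)"
  proof (intro nn_integral_mono)
    fix x
    have "1 \<le> exp (- l * (?p * (1 + \<tau>))) * exp (l * sq_resid n k x)" if "0 \<le> \<tau> * (sq_resid n k x - ?p * (1 + \<tau>))"
    proof -
      have "0 \<le> (\<tau> * (sq_resid n k x - ?p * (1 + \<tau>))) / (2 * (1 + \<tau>))"
        using that \<tau> by simp
      also have "\<dots> = l * (sq_resid n k x - ?p * (1 + \<tau>))" by (simp add: l_def)
      finally show ?thesis
        by (simp add: exp_add[symmetric] right_diff_distrib)
    qed
    then show "indicator ?E x \<le> ennreal (exp (- l * (?p * (1 + \<tau>)))) * ennreal (exp (l * sq_resid n k x))"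
      by (auto simp: ennreal_mult[symmetric] indicator_def simp del: ennreal_1 simp flip: ennreal_1)
  qed
  also have "\<dots> = ennreal (exp (- l * (?p * (1 + \<tau>)))) * ennreal ((1 - 2 * l) powr (- ?p / 2))"
    using m k l by (subst nn_integral_cmult) (auto simp: nn_integral_exp_sq_resid)
  also have "\<dots> = ennreal (exp (- (?p / 2 * (\<tau> - ln (1 + \<tau>)))))"
  proof -
    have aux: "\<tau> / (2 * u) * u = \<tau> / 2" if "u \<noteq> 0" for u using that by simp
    have "l * (1 + \<tau>) = \<tau> / 2" unfolding l_def by (rule aux) (use \<tau> in simp)
    then have "l * (?p * (1 + \<tau>)) = ?p * \<tau> / 2" by (metis mult.left_commute times_divide_eq_right)
    moreover have "(1 - 2 * l) powr (- ?p / 2) = exp (?p / 2 * ln (1 + \<tau>))"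
      unfolding l(2) using \<tau> by (simp add: powr_def ln_div)
    ultimately show ?thesis
      by (simp add: ennreal_mult[symmetric] exp_add[symmetric] right_diff_distrib)
  qed
  finally have "measure ?G ?E \<le> exp (- (?p / 2 * (\<tau> - ln (1 + \<tau>))))"
    by (simp add: emeasure_eq_measure)
  also have "\<dots> \<le> exp (- (?p / 2 * (sqrt (1 + \<tau>) - 1)\<^sup>2))"
  proof -
    \<comment> \<open>The inequality \<open>ln z <= z - 1\<close> is applied at the square root; at
      \<open>1 + \<tau>\<close> itself it would give only the trivial lower bound 0 for the
      exponent.\<close>
    have "ln (1 + \<tau>) = 2 * ln (sqrt (1 + \<tau>))" using \<tau> by (simp add: ln_sqrt)
    also have "\<dots> \<le> 2 * (sqrt (1 + \<tau>) - 1)" using \<tau> by (intro mult_left_mono ln_le_minus_one) auto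
    finally have "(sqrt (1 + \<tau>) - 1)\<^sup>2 \<le> \<tau> - ln (1 + \<tau>)"
      using \<tau> by (simp add: power2_diff)
    then show ?thesis by (simp add: mult_left_mono)
  qed
  finally show ?thesis .
qed

text \<open>The ratio event is multiplied by \<open>B > 0\<close> and becomes a sign condition on a
  difference of independent chi-square terms. The two conditions on \<open>\<mu>\<close> are those
  under which both moment generating functions are finite, and the sign of \<open>\<mu>\<close>
  selects the tail.\<close>

lemma Chernoff_ls_coef_aux:
  fixes n k :: nat and \<mu> c :: real
  assumes n: "Suc k \<le> n" and \<mu>: "\<mu> < 1" "-1 < \<mu> * c"
  shows "measure (std_gaussian ({..<n} \<times> {..Suc k}))
      {x \<in> space (std_gaussian ({..<n} \<times> {..Suc k})).
        0 \<le> \<mu> * ((\<Sum>l<Suc k. (ls_coef {..<n} (columns x) (Suc k) (\<lambda>i. x (i, Suc k)) l)\<^sup>2) - c)}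
    \<le> (1 - \<mu>) powr (- real (Suc k) / 2) * (1 + \<mu> * c) powr (- real (n - k) / 2)"
proof -
  let ?G = "std_gaussian ({..<n} \<times> {..Suc k})" and ?A = "{..<n} \<times> {..k}" and ?m = "Suc k"
  let ?N = "std_gaussian ?A \<Otimes>\<^sub>M std_gaussian {..<?m}"
  let ?P = "PiM {..<?m} (\<lambda>_. borel :: real measure)"
  interpret pair_prob_space "std_gaussian ?A" "std_gaussian {..<?m}"
    by (rule pair_prob_space_std_gaussian)
  interpret G: prob_space ?G by (rule prob_space_std_gaussian)
  define t where "t x = (\<lambda>l\<in>{..<?m}. ls_coef {..<n} (columns x) ?m (\<lambda>i. x (i, ?m)) l)" for x
  define s where "s p = (\<lambda>l\<in>{..<?m}. snd p l / sqrt (sq_resid n k (fst p)))" for p :: "(nat \<times> nat \<Rightarrow> real) \<times> (nat \<Rightarrow> real)"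
  define S where "S = {z \<in> space ?P. 0 \<le> \<mu> * ((\<Sum>l<?m. (z l)\<^sup>2) - c)}"
  have S: "S \<in> sets ?P" unfolding S_def by measurable
  have q: "sq_resid n k \<in> borel_measurable (std_gaussian ?A)"
    by (simp add: measurable_cong_sets[OF sets_std_gaussian refl] borel_measurable_sq_resid)
  have hl: "(\<lambda>h. h l) \<in> borel_measurable (std_gaussian {..<?m})" if "l < ?m" for l
    using that by (simp add: measurable_cong_sets[OF sets_std_gaussian refl] measurable_component_singleton)
  have s: "s \<in> ?N \<rightarrow>\<^sub>M ?P"
    unfolding s_def[abs_def] using q hl
    by (intro measurable_restrict borel_measurable_divide measurable_compose[OF measurable_snd] measurable_compose[OF measurable_fst, of "sq_resid n k"] borel_measurable_sqrt) auto
  have t: "t \<in> ?G \<rightarrow>\<^sub>M ?P"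
    unfolding t_def[abs_def] using borel_measurable_ls_coef_columns[of n ?m]
    by (intro measurable_restrict) (simp add: measurable_cong_sets[OF sets_std_gaussian refl])
  have eq: "distr ?G ?P t = distr ?N ?P s"
    unfolding t_def[abs_def] s_def[abs_def] by (rule distr_ls_coef[OF n])
  let ?E = "{x \<in> space ?G. 0 \<le> \<mu> * ((\<Sum>l<?m. (ls_coef {..<n} (columns x) ?m (\<lambda>i. x (i, ?m)) l)\<^sup>2) - c)}"
  have tE: "t -` S \<inter> space ?G = ?E"
    using measurable_space[OF t] unfolding S_def by (auto simp: t_def)
  let ?h = "\<lambda>h. \<Sum>l<?m. (h l)\<^sup>2 :: real"
  have hm: "?h \<in> borel_measurable (std_gaussian {..<?m})"
    using hl by (intro borel_measurable_sum borel_measurable_power) auto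
  have "emeasure ?G ?E = emeasure (distr ?G ?P t) S"
    using t S by (simp add: emeasure_distr tE)
  also have "\<dots> = (\<integral>\<^sup>+z. indicator S z \<partial>distr ?N ?P s)"
    unfolding eq using S by simp
  also have "\<dots> = (\<integral>\<^sup>+p. indicator S (s p) \<partial>?N)"
    using s S by (intro nn_integral_distr) simp_all
  also have "\<dots> = (\<integral>\<^sup>+x. \<integral>\<^sup>+h. indicator S (s (x, h)) \<partial>std_gaussian {..<?m} \<partial>std_gaussian ?A)"
    using measurable_compose[OF s borel_measurable_indicator[OF S]] by (rule M2.nn_integral_fst[symmetric])
  also have "\<dots> \<le> (\<integral>\<^sup>+x. ennreal (exp ((- \<mu> * c / 2) * sq_resid n k x)) * (\<integral>\<^sup>+h. exp ((\<mu> / 2) * ?h h) \<partial>std_gaussian {..<?m}) \<partial>std_gaussian ?A)"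
  proof (rule nn_integral_mono_AE)
    have "AE x in std_gaussian ({..<n} \<times> {..k}). full_rank {..<n} (columns x) ?m"
      using AE_full_rank[OF n] unfolding lessThan_Suc_atMost .
    then show "AE x in std_gaussian ?A. (\<integral>\<^sup>+h. indicator S (s (x, h)) \<partial>std_gaussian {..<?m})
      \<le> ennreal (exp ((- \<mu> * c / 2) * sq_resid n k x)) * (\<integral>\<^sup>+h. exp ((\<mu> / 2) * ?h h) \<partial>std_gaussian {..<?m})"
    proof eventually_elim
      case (elim x)
      then have "sq_resid n k x \<noteq> 0" by (simp add: full_rank_def sq_resid_def)
      then have B: "sq_resid n k x > 0" using sq_resid_nonneg[of n k x] by linarith
      have "(\<integral>\<^sup>+h. indicator S (s (x, h)) \<partial>std_gaussian {..<?m})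
        \<le> (\<integral>\<^sup>+h. ennreal (exp ((- \<mu> * c / 2) * sq_resid n k x)) * ennreal (exp ((\<mu> / 2) * ?h h)) \<partial>std_gaussian {..<?m})"
      proof (intro nn_integral_mono)
        fix h
        have "1 \<le> exp ((- \<mu> * c / 2) * sq_resid n k x) * exp ((\<mu> / 2) * ?h h)" if "s (x, h) \<in> S"
        proof -
          have "?h (s (x, h)) = ?h h / sq_resid n k x"
            unfolding s_def using B by (simp add: power_divide sum_divide_distrib del: sum.lessThan_Suc)
          then have "0 \<le> \<mu> * (?h h / sq_resid n k x - c)"
            using that unfolding S_def by simp
          then have "0 \<le> (\<mu> * (?h h / sq_resid n k x - c)) * (sq_resid n k x / 2)"
            using B by simp
          also have "\<dots> = (- \<mu> * c / 2) * sq_resid n k x + (\<mu> / 2) * ?h h"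
            using B by (simp add: field_simps)
          finally show ?thesis
            by (simp only: exp_add[symmetric] one_le_exp_iff)
        qed
        then show "indicator S (s (x, h)) \<le> ennreal (exp ((- \<mu> * c / 2) * sq_resid n k x)) * ennreal (exp ((\<mu> / 2) * ?h h))"
          by (auto simp: ennreal_mult[symmetric] indicator_def simp del: ennreal_1 simp flip: ennreal_1)
      qed
      also have "\<dots> = ennreal (exp ((- \<mu> * c / 2) * sq_resid n k x)) * (\<integral>\<^sup>+h. exp ((\<mu> / 2) * ?h h) \<partial>std_gaussian {..<?m})"
        using hm by (intro nn_integral_cmult) simp
      finally show ?case .
    qed
  qed
  also have "(\<integral>\<^sup>+h. exp ((\<mu> / 2) * ?h h) \<partial>std_gaussian {..<?m}) = ennreal ((1 - \<mu>) powr (- real ?m / 2))"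
    using \<mu> nn_integral_exp_sum_squares_std_gaussian[of "\<mu> / 2" "{..<?m}"] by simp
  also have "(\<integral>\<^sup>+x. ennreal (exp ((- \<mu> * c / 2) * sq_resid n k x)) * ennreal ((1 - \<mu>) powr (- real ?m / 2)) \<partial>std_gaussian ?A)
    = ennreal ((1 + \<mu> * c) powr (- real (n - k) / 2)) * ennreal ((1 - \<mu>) powr (- real ?m / 2))"
    using q nn_integral_exp_sq_resid[of k k n "- \<mu> * c / 2"] n \<mu> by (subst nn_integral_multc) simp_all
  finally show ?thesis
    by (simp add: G.emeasure_eq_measure ennreal_mult[symmetric] mult.commute)
qed

text \<open>The exponent is a relative entropy between two-point distributions with weights
  \<open>k / (n + 1)\<close> and \<open>(n + 1 - k) / (n + 1)\<close>; it is bounded below by the squared Hellinger distance.\<close>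

lemma Chernoff_ls_coef:
  fixes n k :: nat and \<tau> :: real
  assumes n: "k \<le> n" "0 < k" and \<tau>: "0 < real k + (real n + 1) * \<tau>"
  shows "measure (std_gaussian ({..<n} \<times> {..k}))
      {x \<in> space (std_gaussian ({..<n} \<times> {..k})).
        0 \<le> \<tau> * ((\<Sum>l<k. (ls_coef {..<n} (columns x) k (\<lambda>i. x (i, k)) l)\<^sup>2)
              - (real k + (real n + 1) * \<tau>) / (real n + 1 - real k))}
    \<le> exp (- ((real n + 1 - real k) / 2 * (1 - 1 / sqrt (1 + \<tau>))\<^sup>2))"
proof -
  obtain k' where k': "k = Suc k'" using n by (cases k) auto
  let ?G = "std_gaussian ({..<n} \<times> {..k})"
  interpret G: prob_space ?G by (rule prob_space_std_gaussian)
  define N q where "N = real n + 1" and "q = real n + 1 - real k"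
  have Nq: "N = q + real k" by (simp add: N_def q_def)
  have q: "q > 0" using n by (simp add: q_def)
  have k: "real k > 0" using n by simp
  have \<tau>1: "-1 < \<tau>"
  proof (rule ccontr)
    assume "\<not> ?thesis"
    then have "N * \<tau> \<le> N * (-1)" using Nq q k by (intro mult_left_mono) auto
    then show False using \<tau> Nq q unfolding N_def[symmetric] by linarith
  qed
  \<comment> \<open>Since \<open>1 + d / q = N / q * (1 + \<tau>)\<close>, the threshold
    \<open>d / q\<close> for the squared coefficients is a relative deviation \<open>\<tau>\<close>
    of \<open>1 + |t|^2\<close> from its target \<open>N / q\<close>.\<close>
  define d where "d = real k + N * \<tau>"
  have d: "d > 0" using \<tau> by (simp add: d_def N_def)
  \<comment> \<open>For the threshold \<open>c\<close>, this \<open>\<mu>\<close> minimises the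
    bound of \<open>Chernoff_ls_coef_aux\<close>; the stationarity condition amounts to
    \<open>\<mu> * c = \<tau>\<close>.\<close>
  define c \<mu> where "c = d / q" and "\<mu> = \<tau> * q / d"
  have c: "c > 0" using d q by (simp add: c_def)
  have \<mu>c: "\<mu> * c = \<tau>" using d q by (simp add: c_def \<mu>_def)
  define A where "A = real k * (1 + \<tau>) / d"
  have A: "1 - \<mu> = A" using d by (simp add: A_def \<mu>_def d_def Nq field_simps)
  have A0: "A > 0" using d k \<tau>1 by (simp add: A_def)
  let ?T = "\<lambda>x. \<Sum>l<k. (ls_coef {..<n} (columns x) k (\<lambda>i. x (i, k)) l)\<^sup>2"
  have "{x \<in> space ?G. 0 \<le> \<tau> * (?T x - d / q)} = {x \<in> space ?G. 0 \<le> \<mu> * (?T x - c)}"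
  proof -
    have "0 \<le> \<tau> * z \<longleftrightarrow> 0 \<le> \<mu> * z" for z
    proof -
      have "\<mu> * z = (\<tau> * z) * (q / d)" by (simp add: \<mu>_def)
      then show ?thesis using q d by (simp add: zero_le_mult_iff zero_le_divide_iff)
    qed
    then show ?thesis by (simp add: c_def)
  qed
  moreover have "measure ?G {x \<in> space ?G. 0 \<le> \<mu> * (?T x - c)}
      \<le> (1 - \<mu>) powr (- real k / 2) * (1 + \<mu> * c) powr (- q / 2)"
    using Chernoff_ls_coef_aux[of k' n \<mu> c] n A A0 \<mu>c \<tau>1 unfolding k' q_def by simp
  moreover have "(1 - \<mu>) powr (- real k / 2) * (1 + \<mu> * c) powr (- q / 2) = exp (- ((q * ln (1 + \<tau>) + real k * ln A) / 2))"
    unfolding A \<mu>c using A0 \<tau>1 by (simp add: powr_def exp_add[symmetric] field_simps)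
  moreover have "q * (1 - 1 / sqrt (1 + \<tau>))\<^sup>2 \<le> q * ln (1 + \<tau>) + real k * ln A"
  proof -
    have ln: "2 * (1 - 1 / sqrt y) \<le> ln y" if "y > 0" for y :: real
    proof -
      have "ln (1 / sqrt y) \<le> 1 / sqrt y - 1" using that by (intro ln_le_minus_one) simp
      then show ?thesis using that by (simp add: ln_div ln_sqrt)
    qed
    have sq: "2 * (1 - 1 / sqrt y) = (1 - 1 / sqrt y)\<^sup>2 + 1 - 1 / y" if "y > 0" for y :: real
      using that by (simp add: power2_diff power_divide)
    \<comment> \<open>The total weight \<open>q + k = N\<close> is preserved when the weights are
      divided by \<open>1 + \<tau>\<close> and by \<open>A\<close>. This cancels the terms
      \<open>1 - 1 / y\<close> that separate the logarithmic bound from the squares.\<close>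
    have sum: "q / (1 + \<tau>) + real k / A = N"
    proof -
      have "real k / A = d / (1 + \<tau>)" using k d \<tau>1 by (simp add: A_def)
      then have "q / (1 + \<tau>) + real k / A = (q + d) / (1 + \<tau>)" by (simp add: add_divide_distrib)
      also have "q + d = N * (1 + \<tau>)" by (simp add: d_def Nq algebra_simps)
      finally show ?thesis using \<tau>1 by simp
    qed
    \<comment> \<open>Of the two squares only the one with weight \<open>q\<close> is kept; the one
      with weight \<open>k\<close> is nonnegative and is given away.\<close>
    have "q * (1 - 1 / sqrt (1 + \<tau>))\<^sup>2 \<le> q * (1 - 1 / sqrt (1 + \<tau>))\<^sup>2 + real k * (1 - 1 / sqrt A)\<^sup>2"
      by simp
    also have "\<dots> = q * ((1 - 1 / sqrt (1 + \<tau>))\<^sup>2 + 1 - 1 / (1 + \<tau>)) + real k * ((1 - 1 / sqrt A)\<^sup>2 + 1 - 1 / A)"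
      using sum by (simp add: algebra_simps Nq)
    also have "\<dots> = q * (2 * (1 - 1 / sqrt (1 + \<tau>))) + real k * (2 * (1 - 1 / sqrt A))"
      using \<tau>1 by (subst (1 2) sq[symmetric]) (simp_all add: A0)
    also have "\<dots> \<le> q * ln (1 + \<tau>) + real k * ln A"
      using ln[of "1 + \<tau>"] ln[OF A0] \<tau>1 q k by (intro add_mono mult_left_mono) auto
    finally show ?thesis .
  qed
  then have "exp (- ((q * ln (1 + \<tau>) + real k * ln A) / 2)) \<le> exp (- (q / 2 * (1 - 1 / sqrt (1 + \<tau>))\<^sup>2))"
    by simp
  ultimately show ?thesis
    unfolding d_def N_def q_def by (simp only:)
qed

text \<open>Brings both kinds of exponent to the form of \<open>Psi\<close>. The quantity
  \<open>1 - 1 / sqrt y\<close> stays below 1 however large \<open>y\<close> is, which forces the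
  saturating expression \<open>t / (t + 1)\<close> in place of \<open>t\<close>.\<close>

lemma sqrt_deviation:
  fixes y t :: real
  assumes y: "0 < y" and t: "0 \<le> t" "t \<le> \<bar>y - 1\<bar>"
  shows "(t / (t + 1))\<^sup>2 / 4 \<le> (sqrt y - 1)\<^sup>2" "(t / (t + 1))\<^sup>2 / 4 \<le> (1 - 1 / sqrt y)\<^sup>2"
proof -
  define s where "s = sqrt y"
  have s: "s > 0" "y = s\<^sup>2" using y by (auto simp: s_def)
  have "t / (t + 1) / 2 \<le> \<bar>s - 1\<bar> \<and> t / (t + 1) / 2 \<le> \<bar>1 - 1 / s\<bar>"
  proof (cases "s \<le> 1")
    case True
    then have "\<bar>y - 1\<bar> = (1 - s) * (1 + s)" using s by (simp add: power2_eq_square algebra_simps abs_if) (smt (verit) mult_le_one)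
    also have "\<dots> \<le> (1 - s) * 2" using True by (intro mult_left_mono) auto
    finally have "t / 2 \<le> 1 - s" using t by simp
    moreover have "t / (t + 1) / 2 \<le> t / 2" using t by (simp add: divide_le_eq algebra_simps)
    moreover have "1 - s \<le> 1 / s - 1"
    proof -
      have "0 \<le> (1 - s)\<^sup>2 / s" using s by simp
      also have "\<dots> = 1 / s - 1 - (1 - s)" using s by (simp add: power2_diff field_simps power2_eq_square)
      finally show ?thesis by simp
    qed
    ultimately show ?thesis by linarith
  next
    case False
    \<comment> \<open>For \<open>s > 1\<close> this is the smaller of the two deviations. From
      \<open>y >= 1 + t\<close> one gets \<open>(1 - w)^2 <= 1 - t / (t + 1)\<close>, and dropping
      \<open>w^2\<close> after expansion gives \<open>w >= t / (t + 1) / 2\<close>.\<close>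
    define w where "w = 1 - 1 / s"
    have "1 < s\<^sup>2" using False by (simp add: one_less_power)
    then have "1 + t \<le> s\<^sup>2" using t s by linarith
    then have "1 / s\<^sup>2 \<le> 1 / (1 + t)" using t s by (intro divide_left_mono) auto
    then have "(1 - w)\<^sup>2 \<le> 1 / (1 + t)" by (simp add: w_def power_divide)
    moreover define r where "r = t / (t + 1)"
    moreover have "1 / (1 + t) = 1 - r" using t by (simp add: r_def field_simps)
    moreover have "(1 - w)\<^sup>2 = 1 - 2 * w + w\<^sup>2" by (simp add: power2_diff)
    ultimately have w: "t / (t + 1) / 2 \<le> w" using zero_le_power2[of w] unfolding r_def[symmetric] by linarith
    have "w \<le> s - 1"
    proof -
      have "0 \<le> (s - 1)\<^sup>2 / s" using s by simp
      also have "\<dots> = s - 1 - w" using s by (simp add: w_def power2_diff field_simps power2_eq_square)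
      finally show ?thesis by simp
    qed
    with w show ?thesis unfolding w_def by linarith
  qed
  moreover have "r\<^sup>2 / 4 = (r / 2)\<^sup>2" for r :: real by (simp add: power_divide)
  from this[of "t / (t + 1)"] have "(t / (t + 1))\<^sup>2 / 4 = (t / (t + 1) / 2)\<^sup>2" .
  moreover have "0 \<le> t / (t + 1) / 2" using t by simp
  ultimately show "(t / (t + 1))\<^sup>2 / 4 \<le> (sqrt y - 1)\<^sup>2" "(t / (t + 1))\<^sup>2 / 4 \<le> (1 - 1 / sqrt y)\<^sup>2"
    unfolding s_def by (metis abs_le_square_iff abs_of_nonneg)+
qed

text \<open>Residual sum and squared coefficients are each allowed an error \<open>\<delta>\<close>
  in either direction, which accounts for \<open>2 * \<delta>\<close> and for four exceptional
  events. No independence between the two is used: the events are combined by a union bound.\<close>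

lemma deviation_bound_std_gaussian:
  fixes n k :: nat and \<delta> :: real
  defines "G \<equiv> std_gaussian ({..<n} \<times> {..k})"
    and "T \<equiv> \<lambda>x. \<Sum>l<k. (ls_coef {..<n} (columns x) k (\<lambda>i. x (i, k)) l)\<^sup>2"
  assumes k: "k < n" and \<delta>: "\<delta> > 0"
  shows "measure G {x \<in> space G. 2 * \<delta> < \<bar>sq_resid n k x / (real n - real k) * ((real n + 1) / (real n + 1 - real k)) - (1 + T x)\<bar>}
    \<le> 4 * exp (- ((real n - real k) * Psi (\<delta> * ((real n - real k) / real n))))"
proof -
  interpret prob_space G unfolding G_def by (rule prob_space_std_gaussian)
  define p q N where "p = real n - real k" and "q = real n + 1 - real k" and "N = real n + 1"
  have p: "p > 0" "real (n - k) = p" using k by (auto simp: p_def of_nat_diff)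
  have q: "q > 0" "p \<le> q" and N: "N > 0" and Nq: "N = q + real k" using k by (auto simp: q_def p_def N_def)
  have n: "real n > 0" using k by simp
  \<comment> \<open>\<open>\<eta>\<close> solves \<open>\<eta> * (N / q) = \<delta>\<close>; the
    same relative deviation serves both errors because both are measured against the factor
    \<open>N / q\<close>. The \<open>t\<close> of the final bound is at most \<open>\<eta>\<close>:
    passing from \<open>p / n\<close> to \<open>q / N\<close> adds one to numerator and
    denominator.\<close>
  define \<eta> t where "\<eta> = \<delta> * q / N" and "t = \<delta> * (p / real n)"
  have \<eta>: "\<eta> > 0" using \<delta> q N by (simp add: \<eta>_def)
  have t: "0 \<le> t" using \<delta> p n by (simp add: t_def)
  have t\<eta>: "t \<le> \<eta>"
  proof -
    have "p * N \<le> q * real n" using k by (simp add: p_def q_def N_def algebra_simps)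
    then have "p / real n \<le> q / N" using n N by (simp add: field_simps)
    then have "\<delta> * (p / real n) \<le> \<delta> * (q / N)" using \<delta> by (intro mult_left_mono) auto
    then show ?thesis by (simp add: t_def \<eta>_def)
  qed
  define E where "E = exp (- (p * Psi t))"
  \<comment> \<open>A common rate for the four events: their degrees of freedom are \<open>p\<close>
    or \<open>q\<close>, both at least \<open>p\<close>, and their relative deviation
    \<open>\<eta>\<close> is at least \<open>t\<close>.\<close>
  have rate: "exp (- (r / 2 * z)) \<le> E" if "(t / (t + 1))\<^sup>2 / 4 \<le> z" "p \<le> r" for r z
  proof -
    have "p * Psi t = p / 2 * ((t / (t + 1))\<^sup>2 / 4)" by (simp add: Psi_def)
    also have "\<dots> \<le> r / 2 * z" using that p by (intro mult_mono) auto
    finally show ?thesis by (simp add: E_def)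
  qed
  let ?R = "sq_resid n k"
  define E1 where "E1 = {x \<in> space G. 0 \<le> \<eta> * (?R x - p * (1 + \<eta>))}"
  \<comment> \<open>A lower-tail event is taken empty when its threshold is not positive, since the
    variable is nonnegative; the two events about coefficients are also empty for
    \<open>k = 0\<close>, where \<open>T\<close> vanishes.\<close>
  define E2 where "E2 = (if \<eta> < 1 then {x \<in> space G. 0 \<le> - \<eta> * (?R x - p * (1 + - \<eta>))} else {})"
  define E3 where "E3 = (if 0 < k then {x \<in> space G. 0 \<le> \<eta> * (T x - (real k + N * \<eta>) / q)} else {})"
  define E4 where "E4 = (if 0 < k \<and> 0 < real k + N * (- \<eta>) then {x \<in> space G. 0 \<le> - \<eta> * (T x - (real k + N * (- \<eta>)) / q)} else {})"
  have "measure G E1 \<le> exp (- (p / 2 * (sqrt (1 + \<eta>) - 1)\<^sup>2))"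
    unfolding E1_def G_def using Chernoff_sq_resid[OF k, of \<eta>] \<eta> p by simp
  also have "\<dots> \<le> E" using \<eta> t t\<eta> by (intro rate sqrt_deviation) auto
  finally have 1: "measure G E1 \<le> E" .
  have 2: "measure G E2 \<le> E"
  proof (cases "\<eta> < 1")
    case True
    then have "measure G E2 \<le> exp (- (p / 2 * (sqrt (1 + - \<eta>) - 1)\<^sup>2))"
      unfolding E2_def G_def using Chernoff_sq_resid[OF k, of "- \<eta>"] p by simp
    also have "\<dots> \<le> E" using True \<eta> t t\<eta> by (intro rate sqrt_deviation) auto
    finally show ?thesis .
  qed (simp add: E2_def E_def)
  have 3: "measure G E3 \<le> E"
  proof (cases "0 < k")
    case True
    then have "measure G E3 \<le> exp (- (q / 2 * (1 - 1 / sqrt (1 + \<eta>))\<^sup>2))"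
      unfolding E3_def G_def T_def N_def q_def using Chernoff_ls_coef[of k n \<eta>] \<eta> k by (simp add: add_pos_pos)
    also have "\<dots> \<le> E" using \<eta> t t\<eta> q by (intro rate sqrt_deviation) auto
    finally show ?thesis .
  qed (simp add: E3_def E_def)
  have 4: "measure G E4 \<le> E"
  proof (cases "0 < k \<and> 0 < real k + N * (- \<eta>)")
    case True
    then have "measure G E4 \<le> exp (- (q / 2 * (1 - 1 / sqrt (1 + - \<eta>))\<^sup>2))"
      unfolding E4_def G_def T_def N_def q_def using Chernoff_ls_coef[of k n "- \<eta>"] k by simp
    also have "\<dots> \<le> E"
    proof -
      have "N * \<eta> < real k" "real k \<le> N * 1" using True Nq q by auto
      then have "N * \<eta> < N * 1" by linarith
      then have "\<eta> < 1" using N by (simp only: mult_less_cancel_left_pos)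
      then show ?thesis using \<eta> t t\<eta> q by (intro rate sqrt_deviation) auto
    qed
    finally show ?thesis .
  qed (auto simp add: E4_def E_def)
  have R[measurable]: "?R \<in> borel_measurable G"
    by (simp add: G_def measurable_cong_sets[OF sets_std_gaussian refl] borel_measurable_sq_resid)
  have T[measurable]: "T \<in> borel_measurable G"
    using borel_measurable_ls_coef_columns[of n k]
    by (simp add: G_def T_def[abs_def] measurable_cong_sets[OF sets_std_gaussian refl])
  have s: "E1 \<in> sets G" "E2 \<in> sets G" "E3 \<in> sets G" "E4 \<in> sets G"
  proof -
    have "{x \<in> space G. 0 \<le> a * (?R x - b)} \<in> sets G" "{x \<in> space G. 0 \<le> a * (T x - b)} \<in> sets G" for a b
      by measurable
    then show "E1 \<in> sets G" "E2 \<in> sets G" "E3 \<in> sets G" "E4 \<in> sets G"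
      unfolding E1_def E2_def E3_def E4_def by (auto simp del: mult_minus_left)
  qed
  have "{x \<in> space G. 2 * \<delta> < \<bar>?R x / p * (N / q) - (1 + T x)\<bar>} \<subseteq> E1 \<union> E2 \<union> E3 \<union> E4"
  proof (rule subsetI, rule ccontr)
    fix x assume x: "x \<in> {x \<in> space G. 2 * \<delta> < \<bar>?R x / p * (N / q) - (1 + T x)\<bar>}" "x \<notin> E1 \<union> E2 \<union> E3 \<union> E4"
    then have xs: "x \<in> space G" and dev: "2 * \<delta> < \<bar>?R x / p * (N / q) - (1 + T x)\<bar>" by auto
    have "?R x < p * (1 + \<eta>)"
      using x xs \<eta> by (simp add: E1_def not_le mult_less_0_iff)
    moreover have "p * (1 - \<eta>) \<le> ?R x"
    proof (cases "\<eta> < 1")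
      case True
      then show ?thesis using x xs \<eta> by (simp add: E2_def not_le zero_less_mult_iff mult_less_0_iff)
    next
      case False
      then have "p * (1 - \<eta>) \<le> 0" using p by (simp add: mult_nonneg_nonpos)
      then show ?thesis using sq_resid_nonneg[of n k x] by linarith
    qed
    ultimately have "\<bar>?R x - p\<bar> \<le> p * \<eta>" by (simp add: abs_le_iff algebra_simps)
    then have "\<bar>?R x / p - 1\<bar> \<le> \<eta>" using p by (simp add: abs_le_iff field_simps)
    then have "\<bar>?R x / p - 1\<bar> * (N / q) \<le> \<eta> * (N / q)" using N q by (intro mult_right_mono) auto
    moreover have "\<eta> * (N / q) = \<delta>" using N q by (simp add: \<eta>_def)
    moreover have "\<bar>?R x / p - 1\<bar> * (N / q) = \<bar>?R x / p * (N / q) - N / q\<bar>"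
    proof -
      have "\<bar>z\<bar> * (N / q) = \<bar>z * (N / q)\<bar>" for z using N q by (simp add: abs_mult)
      then show ?thesis by (simp only: left_diff_distrib mult_1)
    qed
    ultimately have dR: "\<bar>?R x / p * (N / q) - N / q\<bar> \<le> \<delta>" by simp
    have N\<eta>: "N * \<eta> / q = \<delta>" using N q by (simp add: \<eta>_def)
    have T0: "0 \<le> T x" by (simp add: T_def sum_nonneg)
    have "T x \<le> real k / q + \<delta>"
    proof (cases "0 < k")
      case True
      then have "T x < (real k + N * \<eta>) / q" using x xs \<eta> by (simp add: E3_def not_le mult_less_0_iff)
      then show ?thesis using N\<eta> by (simp add: add_divide_distrib)
    qed (use \<delta> in \<open>simp add: T_def\<close>)
    moreover have "real k / q - \<delta> \<le> T x"
    proof (cases "0 < k \<and> 0 < real k + N * (- \<eta>)")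
      case True
      then have "(real k + N * (- \<eta>)) / q < T x" using x xs \<eta> by (simp add: E4_def not_le zero_less_mult_iff mult_less_0_iff)
      then show ?thesis using N\<eta> by (simp add: diff_divide_distrib)
    next
      case False
      then have "real k + N * (- \<eta>) \<le> 0" using \<eta> N by auto
      then have "(real k + N * (- \<eta>)) / q \<le> 0" using q by (simp add: divide_nonpos_pos)
      then have "real k / q - \<delta> \<le> 0" using N\<eta> by (simp add: diff_divide_distrib)
      then show ?thesis using T0 by linarith
    qed
    moreover have "N / q = 1 + real k / q" using q by (simp add: Nq add_divide_distrib)
    ultimately show False using dR dev by linarith
  qed
  then have "measure G {x \<in> space G. 2 * \<delta> < \<bar>?R x / p * (N / q) - (1 + T x)\<bar>} \<le> measure G (E1 \<union> E2 \<union> E3 \<union> E4)"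
    using s by (intro finite_measure_mono) auto
  also have "\<dots> \<le> measure G E1 + measure G E2 + measure G E3 + measure G E4"
    using s measure_Un_le[of "E1 \<union> E2 \<union> E3" G E4] measure_Un_le[of "E1 \<union> E2" G E3] measure_Un_le[of E1 G E2] by force
  also have "\<dots> \<le> 4 * E" using 1 2 3 4 by linarith
  finally show ?thesis unfolding E_def p_def q_def N_def t_def .
qed

section \<open>Whitening a positive definite covariance matrix\<close>

lemma whitening_exists:
  fixes S :: "nat \<Rightarrow> nat \<Rightarrow> real"
  assumes sym: "\<And>i j. S i j = S j i"
    and pd: "\<And>c. \<exists>i<k. c i \<noteq> 0 \<Longrightarrow> (\<Sum>i<k. \<Sum>j<k. c i * S i j * c j) > 0"
  shows "\<exists>A B. (\<forall>i<k. \<forall>j<k. (\<Sum>a<k. \<Sum>b<k. A i a * S a b * A j b) = (if i = j then 1 else 0)) \<and>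
     (\<forall>X. \<forall>i<k. (\<Sum>l<k. B i l * (\<Sum>j<k. A l j * X j)) = X i) \<and>
     (\<forall>w. \<forall>l<k. (\<Sum>i<k. A l i * (\<Sum>j<k. B i j * w j)) = w l)"
  using pd
proof (induction k)
  case (Suc k)
  have pd: "(\<Sum>i<k. \<Sum>j<k. c i * S i j * c j) > 0" if "\<exists>i<k. c i \<noteq> 0" for c
  proof -
    have "(\<Sum>i<k. \<Sum>j<k. c i * S i j * c j) = (\<Sum>i<Suc k. \<Sum>j<Suc k. (c(k := 0)) i * S i j * (c(k := 0)) j)"
      by simp
    moreover have "\<exists>i<Suc k. (c(k := 0)) i \<noteq> 0"
      using that by (metis fun_upd_other less_SucI less_irrefl)
    ultimately show ?thesis using Suc.prems[of "c(k := 0)"] by simp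
  qed
  from Suc.IH[OF pd] obtain A B where
    "\<forall>i<k. \<forall>j<k. (\<Sum>a<k. \<Sum>b<k. A i a * S a b * A j b) = (if i = j then 1 else 0)"
    "\<forall>X. \<forall>i<k. (\<Sum>l<k. B i l * (\<Sum>j<k. A l j * X j)) = X i"
    "\<forall>w. \<forall>l<k. (\<Sum>i<k. A l i * (\<Sum>j<k. B i j * w j)) = w l"
    by blast
  then have on: "\<And>i j. i < k \<Longrightarrow> j < k \<Longrightarrow> (\<Sum>a<k. \<Sum>b<k. A i a * S a b * A j b) = (if i = j then 1 else 0)" and
    BA: "\<And>X i. i < k \<Longrightarrow> (\<Sum>l<k. B i l * (\<Sum>j<k. A l j * X j)) = X i" and
    AB: "\<And>w l. l < k \<Longrightarrow> (\<Sum>i<k. A l i * (\<Sum>j<k. B i j * w j)) = w l"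
    by simp_all
  \<comment> \<open>One Cholesky step, with \<open>S\<close> read as a covariance:
    \<open>g l\<close> is the covariance of the new variable with score \<open>l\<close>,
    \<open>h\<close> holds its regression coefficients on the old variables, \<open>c\<close> its
    residual and \<open>\<rho>\<close> the variance of that residual. Thus \<open>B'\<close> is the
    Cholesky factor of \<open>S\<close> and \<open>A'\<close> its inverse.\<close>
  define g where "g l = (\<Sum>j<k. A l j * S k j)" for l
  define h where "h j = (\<Sum>l<k. g l * A l j)" for j
  define c where "c = (\<lambda>j. if j = k then 1 else - h j)"
  define Q where "Q u v = (\<Sum>i<Suc k. \<Sum>j<Suc k. u i * S i j * v j)" for u v
  define \<rho> where "\<rho> = Q c c"
  have \<rho>: "\<rho> > 0" unfolding \<rho>_def Q_def by (rule Suc.prems) (auto simp: c_def)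
  define A' where "A' l j = (if l = k then c j / sqrt \<rho> else if j = k then 0 else A l j)" for l j
  define B' where "B' i l = (if i = k then if l = k then sqrt \<rho> else g l else if l = k then 0 else B i l)" for i l
  have W: "(\<Sum>j<Suc k. A' l j * X j) = (\<Sum>j<k. A l j * X j)" if "l < k" for l X
    using that by (simp add: A'_def)
  have Wk: "(\<Sum>j<Suc k. A' k j * X j) = (X k - (\<Sum>l<k. g l * (\<Sum>j<k. A l j * X j))) / sqrt \<rho>" for X
  proof -
    have "(\<Sum>j<k. h j * X j) = (\<Sum>l<k. g l * (\<Sum>j<k. A l j * X j))"
      unfolding h_def sum_distrib_left sum_distrib_right by (subst sum.swap) (simp add: mult.assoc)
    then show ?thesis
      by (simp add: A'_def c_def add_divide_distrib sum_divide_distrib[symmetric] sum_negf diff_divide_distrib)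
  qed
  have QW: "Q u v = (\<Sum>i<Suc k. u i * (\<Sum>j<Suc k. S i j * v j))" for u v
    unfolding Q_def by (simp add: sum_distrib_left mult.assoc del: sum.lessThan_Suc)
  have Qs: "Q u v = Q v u" for u v
    unfolding Q_def by (subst sum.swap) (simp add: sym mult.commute mult.left_commute)
  have QA: "Q (A' i) (A' j) = (if i = j then 1 else 0)" if "i < k" "j < k" for i j
    unfolding Q_def using that on[OF that] by (simp add: A'_def)
  have Qk: "Q (A' k) (A' l) = 0" if l: "l < k" for l
  proof -
    have e: "(\<Sum>j<Suc k. S i j * A' l j) = (\<Sum>j<k. S i j * A l j)" for i
      using l by (simp add: A'_def)
    have "Q (A' k) (A' l) = (g l - (\<Sum>l'<k. g l' * (\<Sum>i<k. A l' i * (\<Sum>j<k. S i j * A l j)))) / sqrt \<rho>"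
      unfolding QW Wk e by (simp add: g_def mult.commute)
    also have "(\<Sum>l'<k. g l' * (\<Sum>i<k. A l' i * (\<Sum>j<k. S i j * A l j))) = (\<Sum>l'<k. g l' * (if l' = l then 1 else 0))"
      using on[OF _ l] by (intro sum.cong refl) (simp add: sum_distrib_left mult.assoc)
    finally show ?thesis using l by (simp add: if_distrib cong: if_cong)
  qed
  have Qkk: "Q (A' k) (A' k) = 1"
  proof -
    have "Q (A' k) (A' k) = \<rho> / (sqrt \<rho> * sqrt \<rho>)"
      unfolding \<rho>_def Q_def sum_divide_distrib A'_def by (simp add: mult.commute mult.left_commute)
    then show ?thesis using \<rho> by simp
  qed
  have on': "Q (A' i) (A' j) = (if i = j then 1 else 0)" if "i < Suc k" "j < Suc k" for i j
    using that QA Qk Qkk Qs[of "A' i" "A' k"] by (auto simp: less_Suc_eq)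
  have BA': "(\<Sum>l<Suc k. B' i l * (\<Sum>j<Suc k. A' l j * X j)) = X i" if "i < Suc k" for i X
  proof (cases "i = k")
    case True
    have "(\<Sum>l<Suc k. B' i l * (\<Sum>j<Suc k. A' l j * X j)) =
        (\<Sum>l<k. g l * (\<Sum>j<k. A l j * X j)) + sqrt \<rho> * ((X k - (\<Sum>l<k. g l * (\<Sum>j<k. A l j * X j))) / sqrt \<rho>)"
      unfolding sum.lessThan_Suc[of _ k, where g="\<lambda>l. B' i l * _ l"] Wk using True
      by (simp add: B'_def W del: sum.lessThan_Suc)
    then show ?thesis using \<rho> True by simp
  next
    case False
    then have "(\<Sum>l<Suc k. B' i l * (\<Sum>j<Suc k. A' l j * X j)) = (\<Sum>l<k. B i l * (\<Sum>j<k. A l j * X j))"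
      unfolding sum.lessThan_Suc[of _ k, where g="\<lambda>l. B' i l * _ l"]
      by (simp add: B'_def W del: sum.lessThan_Suc)
    then show ?thesis using BA False that by simp
  qed
  have AB': "(\<Sum>i<Suc k. A' l i * (\<Sum>j<Suc k. B' i j * w j)) = w l" if "l < Suc k" for l w
  proof -
    have e: "(\<Sum>j<Suc k. B' i j * w j) = (\<Sum>j<k. B i j * w j)" if "i < k" for i
      using that by (simp add: B'_def)
    have ek: "(\<Sum>j<Suc k. B' k j * w j) = (\<Sum>j<k. g j * w j) + sqrt \<rho> * w k"
      by (simp add: B'_def)
    have in1: "(\<Sum>i<k. A l i * (\<Sum>j<Suc k. B' i j * w j)) = w l" if "l < k" for l
      using AB[OF that] by (simp add: e del: sum.lessThan_Suc)
    show ?thesis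
    proof (cases "l = k")
      case True
      have "(\<Sum>l<k. g l * (\<Sum>i<k. A l i * (\<Sum>j<Suc k. B' i j * w j))) = (\<Sum>l<k. g l * w l)"
        by (intro sum.cong refl) (simp only: in1 lessThan_iff)
      then show ?thesis
        unfolding True Wk ek using \<rho> by simp
    next
      case False
      then show ?thesis
        using that W[of l "\<lambda>i. \<Sum>j<Suc k. B' i j * w j"] in1[of l] by (simp del: sum.lessThan_Suc)
    qed
  qed
  show ?case
    by (intro exI[of _ A'] exI[of _ B'] conjI allI impI) (simp_all only: on'[unfolded Q_def] BA' AB')
qed simp

subsection \<open>Whitened coordinates and least squares\<close>

lemma gs_coef_cong:
  assumes "\<And>l p. l \<le> k \<Longrightarrow> p \<in> J \<Longrightarrow> W l p = W' l p"
  shows "gs_coef J W k i = gs_coef J W' k i"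
  using assms
proof (induction k rule: less_induct)
  case (less k)
  have "dot J (W k) (gram_schmidt J W j) = dot J (W' k) (gram_schmidt J W' j)"
    "dot J (gram_schmidt J W j) (gram_schmidt J W j) = dot J (gram_schmidt J W' j) (gram_schmidt J W' j)"
    if "j < k" for j
    using that less.prems by (auto intro!: dot_cong gram_schmidt_cong)
  moreover have "gs_coef J W j i = gs_coef J W' j i" if "j < k" for j
    using that less by auto
  ultimately have "(\<Sum>j<k. dot J (W k) (gram_schmidt J W j) / dot J (gram_schmidt J W j) (gram_schmidt J W j) * gs_coef J W j i)
    = (\<Sum>j<k. dot J (W' k) (gram_schmidt J W' j) / dot J (gram_schmidt J W' j) (gram_schmidt J W' j) * gs_coef J W' j i)"
    by (intro sum.cong) simp_all
  then show ?case by (simp only: gs_coef.simps[of J _ k])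
qed

lemma ls_coef_cong:
  assumes "\<And>l p. l < k \<Longrightarrow> p \<in> J \<Longrightarrow> W l p = W' l p" "\<And>p. p \<in> J \<Longrightarrow> v p = v' p"
  shows "ls_coef J W k v i = ls_coef J W' k v' i"
proof -
  have "dot J v (gram_schmidt J W j) = dot J v' (gram_schmidt J W' j)"
    "dot J (gram_schmidt J W j) (gram_schmidt J W j) = dot J (gram_schmidt J W' j) (gram_schmidt J W' j)"
    "gs_coef J W j i = gs_coef J W' j i"
    if "j < k" for j
    using that assms by (auto intro!: dot_cong gram_schmidt_cong gs_coef_cong)
  then show ?thesis unfolding ls_coef_def by simp
qed

lemma ls_coef_scale: "ls_coef J W k (\<lambda>p. s * v p) i = s * ls_coef J W k v i"
  by (simp add: ls_coef_def dot_scale_left sum_distrib_left mult.assoc)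

lemma residual_scale: "residual J W k (\<lambda>p. s * v p) p = s * residual J W k v p"
  by (simp add: residual_eq_ls_coef ls_coef_scale right_diff_distrib sum_distrib_left mult.assoc)

text \<open>The only place where the noise level enters the data. Scaling standard data up, instead
  of standardising observed data, keeps the case \<open>s = 0\<close> inside the same
  formulas.\<close>

definition scale_last :: "nat \<Rightarrow> nat \<Rightarrow> real \<Rightarrow> (nat \<times> nat \<Rightarrow> real) \<Rightarrow> nat \<times> nat \<Rightarrow> real" where
  "scale_last n k s x = (\<lambda>(i, l)\<in>{..<n} \<times> {..k}. if l = k then s * x (i, l) else x (i, l))"

lemma sq_resid_scale_last: "sq_resid n k (scale_last n k s x) = s\<^sup>2 * sq_resid n k x"
proof -
  have "gram_schmidt {..<n} (columns (scale_last n k s x)) k p = s * gram_schmidt {..<n} (columns x) k p" if "p \<in> {..<n}" for p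
    unfolding gram_schmidt_residual residual_scale[symmetric] using that
    by (intro residual_cong) (auto simp: scale_last_def)
  then have "sq_resid n k (scale_last n k s x) = dot {..<n} (\<lambda>p. s * gram_schmidt {..<n} (columns x) k p) (\<lambda>p. s * gram_schmidt {..<n} (columns x) k p)"
    unfolding sq_resid_def by (intro dot_cong)
  then show ?thesis
    by (simp add: dot_scale_left dot_scale_right sq_resid_def power2_eq_square)
qed

lemma ls_coef_scale_last:
  "ls_coef {..<n} (columns (scale_last n k s x)) k (\<lambda>i. scale_last n k s x (i, k)) l = s * ls_coef {..<n} (columns x) k (\<lambda>i. x (i, k)) l"
  unfolding ls_coef_scale[symmetric] by (intro ls_coef_cong) (auto simp: scale_last_def)

lemma full_rank_scale_last:
  "full_rank {..<n} (columns (scale_last n k s x)) k \<longleftrightarrow> full_rank {..<n} (columns x) k"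
  by (intro full_rank_cong) (auto simp: scale_last_def)

text \<open>The deterministic part: a change of basis among the selected regressors, with
  \<open>f\<close> enumerating their indices, and a shift \<open>\<gamma>\<close> of the
  coefficients. The probabilistic choice of \<open>A\<close>, \<open>B\<close> and
  \<open>\<gamma>\<close> comes with \<open>whitened_gaussian_model\<close>.\<close>

locale whitened_model =
  fixes m :: model and k :: nat and f :: "nat \<Rightarrow> nat" and A B :: "nat \<Rightarrow> nat \<Rightarrow> real" and \<gamma> :: "nat \<Rightarrow> real"
  assumes f: "bij_betw f {..<k} {j. m j}"
    and BA: "i < k \<Longrightarrow> (\<Sum>l<k. B i l * (\<Sum>j<k. A l j * X j)) = X i"
    and AB: "l < k \<Longrightarrow> (\<Sum>i<k. A l i * (\<Sum>j<k. B i j * w j)) = w l"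
begin

definition score :: "nat \<Rightarrow> observation \<Rightarrow> real" where
  "score l z = (\<Sum>j<k. A l j * snd z (f j))"

definition noise :: "observation \<Rightarrow> real" where
  "noise z = fst z - (\<Sum>l<k. \<gamma> l * score l z)"

text \<open>The noise takes the place of the response \<open>fst\<close>: subtracting a combination
  of the regressors leaves all residuals as they are and turns least-squares coefficients into
  estimation errors.\<close>

definition data :: "(nat \<Rightarrow> observation) \<Rightarrow> nat \<times> nat \<Rightarrow> real" where
  "data d = (\<lambda>(i, l). if l = k then noise (d i) else score l (d i))"

text \<open>The coefficients of a predictor in score coordinates, with \<open>\<gamma>\<close> as
  origin. For the least-squares estimator this is the error vector, the \<open>t\<close> of the
  overview times the noise level.\<close>

definition tau :: "(nat \<Rightarrow> real) \<Rightarrow> nat \<Rightarrow> real" where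
  "tau b l = (\<Sum>i<k. b (f i) * B i l) - \<gamma> l"

definition of_tau :: "(nat \<Rightarrow> real) \<Rightarrow> nat \<Rightarrow> real" where
  "of_tau t j = (if m j then \<Sum>l<k. (t l + \<gamma> l) * A l (the_inv_into {..<k} f j) else 0)"

lemma m_f: "i < k \<Longrightarrow> m (f i)"
  using f by (auto simp: bij_betw_def)

lemma of_tau_f: "i < k \<Longrightarrow> of_tau t (f i) = (\<Sum>l<k. (t l + \<gamma> l) * A l i)"
  using f by (simp add: of_tau_def m_f the_inv_into_f_f bij_betw_def)

lemma AB_delta:
  assumes "l < k" "j < k"
  shows "(\<Sum>i<k. A l i * B i j) = (if l = j then 1 else 0)"
  using AB[OF assms(1), of "\<lambda>i. if i = j then 1 else 0"] assms(2)
  by (simp add: if_distrib cong: if_cong)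

lemma BA_delta:
  assumes "i < k" "j < k"
  shows "(\<Sum>l<k. B i l * A l j) = (if i = j then 1 else 0)"
  using BA[OF assms(1), of "\<lambda>i. if i = j then 1 else 0"] assms(2)
  by (simp add: if_distrib cong: if_cong)

lemma tau_of_tau:
  assumes "l < k"
  shows "tau (of_tau t) l = t l"
proof -
  have "(\<Sum>i<k. of_tau t (f i) * B i l) = (\<Sum>i<k. \<Sum>l'<k. (t l' + \<gamma> l') * (A l' i * B i l))"
    by (intro sum.cong refl) (simp add: of_tau_f sum_distrib_right mult.assoc)
  also have "\<dots> = (\<Sum>l'<k. (t l' + \<gamma> l') * (\<Sum>i<k. A l' i * B i l))"
    by (subst sum.swap) (simp add: sum_distrib_left)
  also have "\<dots> = (\<Sum>l'<k. if l' = l then t l' + \<gamma> l' else 0)"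
    using assms by (intro sum.cong refl) (simp add: AB_delta)
  finally show ?thesis using assms by (simp add: tau_def)
qed

lemma of_tau_tau:
  assumes "\<forall>j. \<not> m j \<longrightarrow> b j = 0"
  shows "of_tau (tau b) = b"
proof
  fix j
  show "of_tau (tau b) j = b j"
  proof (cases "m j")
    case True
    then obtain i where i: "i < k" "j = f i" using f by (auto simp: bij_betw_def)
    have "of_tau (tau b) j = (\<Sum>l<k. \<Sum>i'<k. b (f i') * (B i' l * A l i))"
      unfolding i(2) of_tau_f[OF i(1)] tau_def by (simp add: sum_distrib_right mult.assoc)
    also have "\<dots> = (\<Sum>i'<k. b (f i') * (\<Sum>l<k. B i' l * A l i))"
      by (subst sum.swap) (simp add: sum_distrib_left)
    also have "\<dots> = (\<Sum>i'<k. if i' = i then b (f i') else 0)"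
      using i(1) by (intro sum.cong refl) (simp add: BA_delta)
    finally show ?thesis using i by simp
  qed (use assms in \<open>simp add: of_tau_def\<close>)
qed

lemma of_tau_cong: "(\<And>l. l < k \<Longrightarrow> t l = t' l) \<Longrightarrow> of_tau t = of_tau t'"
  by (simp add: of_tau_def fun_eq_iff)

lemma of_tau_support: "\<forall>j. \<not> m j \<longrightarrow> of_tau t j = 0"
  by (simp add: of_tau_def)

lemma prediction_error_eq: "prediction_error m z b = noise z - (\<Sum>l<k. tau b l * score l z)"
proof -
  have "(\<Sum>j | m j. snd z j * b j) = (\<Sum>i<k. b (f i) * snd z (f i))"
    using sum.reindex_bij_betw[OF f, of "\<lambda>j. snd z j * b j"] by (simp add: mult.commute)
  also have "\<dots> = (\<Sum>i<k. b (f i) * (\<Sum>l<k. B i l * score l z))"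
    by (intro sum.cong refl) (simp add: score_def BA)
  also have "\<dots> = (\<Sum>l<k. (\<Sum>i<k. b (f i) * B i l) * score l z)"
    unfolding sum_distrib_left sum_distrib_right by (subst sum.swap) (simp add: mult.assoc)
  also have "\<dots> = (\<Sum>l<k. tau b l * score l z) + (\<Sum>l<k. \<gamma> l * score l z)"
    by (simp add: tau_def left_diff_distrib sum_subtractf)
  finally show ?thesis unfolding prediction_error_def noise_def by simp
qed

lemma sum_sq_eq:
  "sum_sq n m d b = sq_resid n k (data d)
    + dot {..<n} (\<lambda>p. \<Sum>l<k. (ls_coef {..<n} (columns (data d)) k (\<lambda>i. data d (i, k)) l - tau b l) * data d (p, l))
                 (\<lambda>p. \<Sum>l<k. (ls_coef {..<n} (columns (data d)) k (\<lambda>i. data d (i, k)) l - tau b l) * data d (p, l))"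
proof -
  have "sum_sq n m d b = dot {..<n} (\<lambda>p. data d (p, k) - (\<Sum>l<k. tau b l * data d (p, l))) (\<lambda>p. data d (p, k) - (\<Sum>l<k. tau b l * data d (p, l)))"
    unfolding sum_sq_def prediction_error_eq dot_def by (simp add: data_def power2_eq_square)
  then show ?thesis
    by (simp only: dot_residual_decomposition[OF finite_lessThan] sq_resid_def gram_schmidt_residual)
qed

text \<open>The second summand of \<open>sum_sq_eq\<close> is nonnegative and vanishes at
  \<open>of_tau\<close> of the least-squares coefficients, so the minimisers are exactly the zeros
  of that summand. The equivalence covers rank-deficient designs, for which it will exhibit several
  minimisers.\<close>

lemma least_squares_iff:
  "least_squares n m d b \<longleftrightarrow> (\<forall>j. \<not> m j \<longrightarrow> b j = 0) \<and>
    (\<forall>p<n. (\<Sum>l<k. (ls_coef {..<n} (columns (data d)) k (\<lambda>i. data d (i, k)) l - tau b l) * data d (p, l)) = 0)"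
proof -
  define t where "t = ls_coef {..<n} (columns (data d)) k (\<lambda>i. data d (i, k))"
  define D where "D b = dot {..<n} (\<lambda>p. \<Sum>l<k. (t l - tau b l) * data d (p, l)) (\<lambda>p. \<Sum>l<k. (t l - tau b l) * data d (p, l))" for b
  have ss: "sum_sq n m d b = sq_resid n k (data d) + D b" for b
    unfolding D_def t_def by (rule sum_sq_eq)
  have D0: "D b = 0 \<longleftrightarrow> (\<forall>p<n. (\<Sum>l<k. (t l - tau b l) * data d (p, l)) = 0)" for b
    unfolding D_def by (subst dot_self_eq_0_iff) auto
  have "D (of_tau t) = 0" unfolding D0 by (simp add: tau_of_tau)
  moreover have "0 \<le> D b'" for b' by (simp add: D_def)
  ultimately have "(\<forall>b'. (\<forall>j. \<not> m j \<longrightarrow> b' j = 0) \<longrightarrow> sum_sq n m d b \<le> sum_sq n m d b') \<longleftrightarrow> D b = 0" for b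
    unfolding ss using of_tau_support[of t] by (metis add_le_cancel_left order_antisym)
  then show ?thesis unfolding least_squares_def D0 t_def by blast
qed

lemma beta_tilde_full_rank:
  assumes full: "full_rank {..<n} (columns (data d)) k"
  shows "beta_tilde n m d = of_tau (ls_coef {..<n} (columns (data d)) k (\<lambda>i. data d (i, k)))"
proof -
  define t where "t = ls_coef {..<n} (columns (data d)) k (\<lambda>i. data d (i, k))"
  have "least_squares n m d b \<longleftrightarrow> b = of_tau t" for b
  proof
    assume b: "least_squares n m d b"
    then have "\<forall>p<n. (\<Sum>l<k. (t l - tau b l) * data d (p, l)) = 0" unfolding least_squares_iff t_def by blast
    then have "\<forall>l<k. t l - tau b l = 0"
      using full_rank_iff_independent[OF finite_lessThan, THEN iffD1, OF full, THEN spec, of "\<lambda>l. t l - tau b l"] by simp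
    then have "of_tau (tau b) = of_tau t" by (intro of_tau_cong) simp
    moreover have "of_tau (tau b) = b" using b by (intro of_tau_tau) (simp add: least_squares_iff)
    ultimately show "b = of_tau t" by simp
  next
    assume "b = of_tau t"
    then show "least_squares n m d b"
      unfolding least_squares_iff t_def[symmetric] using of_tau_support[of t] by (simp add: tau_of_tau)
  qed
  then have "least_squares n m d = (\<lambda>b. b = of_tau t)" by (rule ext)
  then show ?thesis
    unfolding beta_tilde_def t_def[symmetric] by simp
qed

text \<open>A dependence among the columns moves one minimiser to a different one, so uniqueness
  fails and the default applies. Together with the full-rank formula this describes the estimator on
  the whole sample space, which is how its measurability is obtained.\<close>

lemma beta_tilde_rank_deficient:
  assumes "\<not> full_rank {..<n} (columns (data d)) k"
  shows "beta_tilde n m d = (\<lambda>_. 0)"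
proof -
  define t where "t = ls_coef {..<n} (columns (data d)) k (\<lambda>i. data d (i, k))"
  obtain c l where c: "\<forall>p\<in>{..<n}. (\<Sum>l<k. c l * data d (p, l)) = 0" and l: "l < k" "c l \<noteq> 0"
    using assms unfolding full_rank_iff_independent[OF finite_lessThan] by blast
  have "least_squares n m d (of_tau t)" "least_squares n m d (of_tau (\<lambda>l. t l - c l))"
    unfolding least_squares_iff t_def[symmetric] using of_tau_support c by (auto simp: tau_of_tau)
  moreover have "of_tau t \<noteq> of_tau (\<lambda>l. t l - c l)"
    using tau_of_tau[OF l(1), of t] tau_of_tau[OF l(1), of "\<lambda>l. t l - c l"] l(2) by auto
  ultimately have "\<not> (\<exists>!b. least_squares n m d b)" by blast
  then show ?thesis unfolding beta_tilde_def by simp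
qed

lemma RSS_full_rank:
  assumes full: "full_rank {..<n} (columns (data d)) k"
  shows "RSS n m d = sq_resid n k (data d)"
  unfolding RSS_def sum_sq_eq beta_tilde_full_rank[OF full] by (simp add: tau_of_tau dot_def)

lemma measurable_score [measurable]: "score l \<in> borel_measurable obs_space"
  unfolding score_def[abs_def] by measurable

lemma measurable_noise [measurable]: "noise \<in> borel_measurable obs_space"
  unfolding noise_def[abs_def] by measurable

lemma measurable_data:
  assumes "i < n"
  shows "(\<lambda>d. data d (i, l)) \<in> borel_measurable (sample_space n)"
proof -
  have i: "(\<lambda>d. d i) \<in> sample_space n \<rightarrow>\<^sub>M obs_space"
    using assms by (intro measurable_component_singleton) auto
  show ?thesis
    using measurable_compose[OF i measurable_noise] measurable_compose[OF i measurable_score[of l]]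
    by (cases "l = k") (simp_all add: data_def)
qed

lemma measurable_beta_tilde: "(\<lambda>d. beta_tilde n m d j) \<in> borel_measurable (sample_space n)"
proof -
  have "(\<lambda>d. of_tau (ls_coef {..<n} (columns (data d)) k (\<lambda>i. data d (i, k))) j) \<in> borel_measurable (sample_space n)"
    unfolding of_tau_def
    by (cases "m j") (auto intro!: borel_measurable_sum borel_measurable_times borel_measurable_add borel_measurable_ls_coef measurable_data)
  moreover have "Measurable.pred (sample_space n) (\<lambda>d. full_rank {..<n} (columns (data d)) k)"
    unfolding pred_def by (intro sets_Collect_full_rank measurable_data) auto
  ultimately have "(\<lambda>d. if full_rank {..<n} (columns (data d)) k
      then of_tau (ls_coef {..<n} (columns (data d)) k (\<lambda>i. data d (i, k))) j else 0) \<in> borel_measurable (sample_space n)"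
    by measurable
  moreover have "(\<lambda>d. if full_rank {..<n} (columns (data d)) k
      then of_tau (ls_coef {..<n} (columns (data d)) k (\<lambda>i. data d (i, k))) j else 0) = (\<lambda>d. beta_tilde n m d j)"
    by (simp add: fun_eq_iff beta_tilde_full_rank beta_tilde_rank_deficient)
  ultimately show ?thesis by simp
qed

end

subsection \<open>The Gaussian model in whitened coordinates\<close>

definition square_integrable :: "'a measure \<Rightarrow> ('a \<Rightarrow> real) \<Rightarrow> bool" where
  "square_integrable M f \<longleftrightarrow> f \<in> borel_measurable M \<and> integrable M (\<lambda>x. (f x)\<^sup>2)"

lemma square_integrable_mult:
  assumes "square_integrable M f" "square_integrable M g"
  shows "integrable M (\<lambda>x. f x * g x)"
proof (rule Bochner_Integration.integrable_bound)
  show "integrable M (\<lambda>x. (f x)\<^sup>2 + (g x)\<^sup>2)"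
    using assms by (simp add: square_integrable_def)
  show "(\<lambda>x. f x * g x) \<in> borel_measurable M"
    using assms by (auto simp: square_integrable_def)
  have "\<bar>a * b\<bar> \<le> a\<^sup>2 + b\<^sup>2" for a b :: real
  proof -
    have "2 * (\<bar>a\<bar> * \<bar>b\<bar>) \<le> a\<^sup>2 + b\<^sup>2" using sum_squares_bound[of "\<bar>a\<bar>" "\<bar>b\<bar>"] by simp
    moreover have "0 \<le> \<bar>a\<bar> * \<bar>b\<bar>" by simp
    ultimately show ?thesis unfolding abs_mult by linarith
  qed
  then show "AE x in M. norm (f x * g x) \<le> norm ((f x)\<^sup>2 + (g x)\<^sup>2)" by simp
qed

lemma square_integrable_add:
  assumes "square_integrable M f" "square_integrable M g"
  shows "square_integrable M (\<lambda>x. f x + g x)"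
proof -
  have "integrable M (\<lambda>x. (f x)\<^sup>2 + (g x)\<^sup>2 + 2 * (f x * g x))"
    using assms square_integrable_mult[OF assms]
    by (intro Bochner_Integration.integrable_add integrable_mult_right) (auto simp: square_integrable_def)
  then show ?thesis
    using assms by (auto simp: square_integrable_def power2_sum mult.assoc)
qed

lemma square_integrable_scale: "square_integrable M f \<Longrightarrow> square_integrable M (\<lambda>x. c * f x)"
  by (auto simp: square_integrable_def power_mult_distrib)

lemma square_integrable_sum:
  "(\<And>i. i \<in> I \<Longrightarrow> square_integrable M (f i)) \<Longrightarrow> square_integrable M (\<lambda>x. \<Sum>i\<in>I. f i x)"
proof (induction I rule: infinite_finite_induct)
  case (insert i I)
  then show ?case
    using square_integrable_add[of M "f i" "\<lambda>x. \<Sum>i\<in>I. f i x"] by simp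
qed (simp_all add: square_integrable_def)

lemma (in prob_space) square_integrable_integrable:
  assumes "square_integrable M f" shows "integrable M f"
  using square_integrable_mult[OF assms, of "\<lambda>_. 1"] by (simp add: square_integrable_def)

lemma (in prob_space) gaussian_rv_square_integrable:
  assumes "gaussian_rv M V"
  shows "square_integrable M V"
proof -
  have [measurable]: "V \<in> borel_measurable M" using assms by (simp add: gaussian_rv_def)
  consider \<mu> where "AE \<omega> in M. V \<omega> = \<mu>"
    | \<mu> s where "s > 0" "distributed M lborel V (\<lambda>t. ennreal (normal_density \<mu> s t))"
    using assms unfolding gaussian_rv_def by blast
  then have "integrable M (\<lambda>\<omega>. (V \<omega>)\<^sup>2)"
  proof cases
    case 1
    then have "AE \<omega> in M. (V \<omega>)\<^sup>2 = \<mu>\<^sup>2" by auto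
    then show ?thesis by (subst integrable_cong_AE[of _ _ "\<lambda>_. \<mu>\<^sup>2"]) auto
  next
    case 2
    \<comment> \<open>The square is expanded about the mean, so that every term is a central
      moment.\<close>
    have "integrable lborel (\<lambda>x. normal_density \<mu> s x * (x - \<mu>)^2 + 2 * \<mu> * (normal_density \<mu> s x * (x - \<mu>)^1) + \<mu>\<^sup>2 * (normal_density \<mu> s x * (x - \<mu>)^0))"
      by (intro Bochner_Integration.integrable_add integrable_mult_right integrable_normal_moment 2)
    also have "(\<lambda>x. normal_density \<mu> s x * (x - \<mu>)^2 + 2 * \<mu> * (normal_density \<mu> s x * (x - \<mu>)^1) + \<mu>\<^sup>2 * (normal_density \<mu> s x * (x - \<mu>)^0))
        = (\<lambda>x. normal_density \<mu> s x * x\<^sup>2)"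
      by (simp add: fun_eq_iff power2_eq_square algebra_simps)
    finally show ?thesis
      using distributed_integrable[OF 2(2), of "\<lambda>x. x\<^sup>2"] by simp
  qed
  then show ?thesis by (simp add: square_integrable_def)
qed

text \<open>Constants and variables with a density obey the same formula, so the laws derived from
  it include the case of vanishing noise.\<close>

lemma (in prob_space) char_gaussian_rv:
  assumes V: "gaussian_rv M V" and mean: "expectation V = 0"
  shows "(CLINT \<omega>|M. iexp (V \<omega>)) = of_real (exp (- expectation (\<lambda>\<omega>. (V \<omega>)\<^sup>2) / 2))"
proof -
  have [measurable]: "V \<in> borel_measurable M" using assms by (simp add: gaussian_rv_def)
  consider \<mu> where "AE \<omega> in M. V \<omega> = \<mu>"
    | \<mu> s where "s > 0" "distributed M lborel V (\<lambda>t. ennreal (normal_density \<mu> s t))"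
    using V unfolding gaussian_rv_def by blast
  then show ?thesis
  proof cases
    case 1
    have "expectation V = \<mu>"
      using 1 by (subst integral_cong_AE[of _ _ "\<lambda>_. \<mu>"]) (auto simp: prob_space)
    then have V0: "AE \<omega> in M. V \<omega> = 0" using 1 mean by simp
    then have "(CLINT \<omega>|M. iexp (V \<omega>)) = (CLINT \<omega>|M. 1)"
      by (intro integral_cong_AE) auto
    moreover have "expectation (\<lambda>\<omega>. (V \<omega>)\<^sup>2) = expectation (\<lambda>\<omega>. 0)"
      using V0 by (intro integral_cong_AE) auto
    ultimately show ?thesis by (simp add: prob_space)
  next
    case 2
    have \<mu>: "\<mu> = 0" using normal_distributed_expectation[OF 2] mean by simp
    have s2: "expectation (\<lambda>\<omega>. (V \<omega>)\<^sup>2) = s\<^sup>2" using normal_distributed_variance[OF 2] mean by simp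
    have "distributed M lborel (\<lambda>\<omega>. V \<omega> / s) std_normal_density"
      using normal_standard_normal_convert[OF 2(1), of V \<mu>] 2(2) \<mu> by simp
    then have d: "distr M borel (\<lambda>\<omega>. V \<omega> / s) = std_normal_distribution"
      by (simp add: distributed_def) (metis distr_cong sets_lborel)
    have "(CLINT \<omega>|M. iexp (V \<omega>)) = char (distr M borel (\<lambda>\<omega>. V \<omega> / s)) s"
      unfolding char_def using 2(1) by (subst integral_distr) auto
    then show ?thesis unfolding d char_std_normal_distribution s2 by simp
  qed
qed

context gaussian_linear_model
begin

abbreviation obs :: "'p \<Rightarrow> observation" where
  "obs \<omega> \<equiv> (y \<omega>, \<lambda>j. x j \<omega>)"

lemma gaussian_combination:
  assumes I: "finite I"
  shows "gaussian_rv P (\<lambda>\<omega>. c0 * y \<omega> + (\<Sum>i\<in>I. c i * x i \<omega>))"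
proof -
  let ?F = "insert y (x ` I)"
  \<comment> \<open>Joint normality speaks of finite sets of functions, in which repetitions are
    lost; \<open>y\<close>, for instance, may be the same function as some \<open>x i\<close>. Hence
    the coefficients of equal functions are added up.\<close>
  define d where "d V = (if V = y then c0 else 0) + (\<Sum>i\<in>{i\<in>I. x i = V}. c i)" for V
  have "(\<Sum>V\<in>?F. d V * V \<omega>) = c0 * y \<omega> + (\<Sum>i\<in>I. c i * x i \<omega>)" for \<omega>
  proof -
    have "(\<Sum>V\<in>?F. d V * V \<omega>) = (\<Sum>V\<in>?F. (if V = y then c0 * y \<omega> else 0)) + (\<Sum>V\<in>?F. \<Sum>i\<in>{i\<in>I. x i = V}. c i * x i \<omega>)"
      unfolding d_def distrib_right sum.distrib
      by (intro arg_cong2[where f="(+)"] sum.cong refl) (auto simp: sum_distrib_right intro!: sum.cong)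
    also have "(\<Sum>V\<in>?F. \<Sum>i\<in>{i\<in>I. x i = V}. c i * x i \<omega>) = (\<Sum>i\<in>I. c i * x i \<omega>)"
      using I by (intro sum.group) auto
    also have "(\<Sum>V\<in>?F. (if V = y then c0 * y \<omega> else 0)) = c0 * y \<omega>"
      using I by simp
    finally show ?thesis .
  qed
  moreover have "gaussian_rv P (\<lambda>\<omega>. \<Sum>V\<in>?F. d V * V \<omega>)"
    by (rule gaussian[unfolded jointly_gaussian_def, rule_format]) (use I in auto)
  ultimately show ?thesis by simp
qed

lemma square_integrable_y: "square_integrable P y"
  using gaussian_rv_square_integrable[OF gaussian_combination[of "{}" 1]] by simp

lemma square_integrable_x: "square_integrable P (x i)"
  using gaussian_rv_square_integrable[OF gaussian_combination[of "{i}" 0 "\<lambda>_. 1"]] by simp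

lemma square_integrable_u: "square_integrable P u"
proof -
  have "gaussian_rv P (\<lambda>\<omega>. \<Sum>V\<in>{u}. 1 * V \<omega>)"
    by (rule gaussian[unfolded jointly_gaussian_def, rule_format]) auto
  then show ?thesis using gaussian_rv_square_integrable by simp
qed

lemma measurable_obs [measurable]: "obs \<in> P \<rightarrow>\<^sub>M obs_space"
  using square_integrable_y square_integrable_x
  by (intro measurable_Pair measurable_PiM_single') (auto simp: square_integrable_def)

text \<open>The model does not prescribe the mean of \<open>y\<close>; it comes from the series. All
  remainders \<open>Y N\<close> have the mean of \<open>y\<close>, its square is at most their
  second moment, and the latter tends to 0.\<close>

lemma mean_y: "expectation y = 0"
proof -
  define Y where "Y N \<omega> = y \<omega> - u \<omega> - (\<Sum>j<N. x j \<omega> * \<beta> j)" for N \<omega>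
  have iY: "square_integrable P (Y N)" for N
  proof -
    have "square_integrable P (\<lambda>\<omega>. y \<omega> + (-1) * u \<omega> + (\<Sum>j<N. (- \<beta> j) * x j \<omega>))"
      by (intro square_integrable_add square_integrable_sum square_integrable_scale
          square_integrable_y square_integrable_u square_integrable_x)
    then show ?thesis unfolding Y_def[abs_def] by (simp add: sum_negf mult.commute)
  qed
  have ints: "integrable P y" "integrable P u" "integrable P (x j)" for j
    using square_integrable_y square_integrable_u square_integrable_x by (auto intro: square_integrable_integrable)
  have EY: "expectation (Y N) = expectation y" for N
    unfolding Y_def[abs_def] using ints by (simp add: mean_u mean_x)
  have "(expectation y)\<^sup>2 \<le> expectation (\<lambda>\<omega>. (Y N \<omega>)\<^sup>2)" for N
  proof -
    have "variance (Y N) = expectation (\<lambda>\<omega>. (Y N \<omega>)\<^sup>2) - (expectation (Y N))\<^sup>2"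
      using iY[of N] by (intro variance_eq) (auto simp: square_integrable_def intro: square_integrable_integrable)
    then show ?thesis
      using variance_positive[of "Y N"] unfolding EY by linarith
  qed
  moreover have "(\<lambda>N. expectation (\<lambda>\<omega>. (Y N \<omega>)\<^sup>2)) \<longlonglongrightarrow> 0"
    unfolding Y_def by (rule linear_model)
  ultimately have "(expectation y)\<^sup>2 \<le> 0"
    by (intro LIMSEQ_le_const) auto
  then show ?thesis by simp
qed

end

text \<open>The scores are orthonormal in mean square and \<open>\<gamma> l\<close> is the
  covariance of \<open>y\<close> with score \<open>l\<close>. This makes \<open>noise\<close> the
  residual of the projection of \<open>y\<close> onto the span of the selected regressors.\<close>

locale whitened_gaussian_model = gaussian_linear_model P y u x \<beta> \<sigma> \<Sigma> + whitened_model m k f A B \<gamma>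
  for P :: "'p measure" and y u :: "'p \<Rightarrow> real" and x :: "nat \<Rightarrow> 'p \<Rightarrow> real"
    and \<beta> :: "nat \<Rightarrow> real" and \<sigma> :: real and \<Sigma> :: "nat \<Rightarrow> nat \<Rightarrow> real"
    and m k f A B \<gamma> +
  assumes cov_A: "i < k \<Longrightarrow> j < k \<Longrightarrow> (\<Sum>a<k. \<Sum>b<k. A i a * \<Sigma> (f a) (f b) * A j b) = (if i = j then 1 else 0)"
    and \<gamma>_eq: "\<gamma> l = (\<Sum>j<k. A l j * expectation (\<lambda>\<omega>. y \<omega> * x (f j) \<omega>))"
begin

lemma square_integrable_score: "square_integrable P (\<lambda>\<omega>. score l (obs \<omega>))"
  unfolding score_def snd_conv
  by (intro square_integrable_sum square_integrable_scale square_integrable_x)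

lemma square_integrable_noise: "square_integrable P (\<lambda>\<omega>. noise (obs \<omega>))"
proof -
  have "square_integrable P (\<lambda>\<omega>. y \<omega> + (-1) * (\<Sum>l<k. \<gamma> l * score l (obs \<omega>)))"
    by (intro square_integrable_add square_integrable_sum square_integrable_scale
          square_integrable_y square_integrable_score)
  then show ?thesis by (simp add: noise_def)
qed

lemma expectation_score_score:
  assumes "i < k" "j < k"
  shows "expectation (\<lambda>\<omega>. score i (obs \<omega>) * score j (obs \<omega>)) = (if i = j then 1 else 0)"
proof -
  have "expectation (\<lambda>\<omega>. score i (obs \<omega>) * score j (obs \<omega>)) = expectation (\<lambda>\<omega>. \<Sum>a<k. \<Sum>b<k. (A i a * A j b) * (x (f a) \<omega> * x (f b) \<omega>))"
    by (simp add: score_def sum_product mult_ac)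
  also have "\<dots> = (\<Sum>a<k. \<Sum>b<k. (A i a * A j b) * \<Sigma> (f a) (f b))"
    using square_integrable_mult[OF square_integrable_x square_integrable_x]
    by (simp add: Bochner_Integration.integral_sum cov_x)
  also have "\<dots> = (if i = j then 1 else 0)"
    unfolding cov_A[OF assms, symmetric] by (simp add: mult_ac)
  finally show ?thesis .
qed

lemma expectation_y_score: "expectation (\<lambda>\<omega>. y \<omega> * score l (obs \<omega>)) = \<gamma> l"
proof -
  have "expectation (\<lambda>\<omega>. y \<omega> * score l (obs \<omega>)) = expectation (\<lambda>\<omega>. \<Sum>j<k. A l j * (y \<omega> * x (f j) \<omega>))"
    by (simp add: score_def sum_distrib_left mult_ac)
  also have "\<dots> = \<gamma> l"
    unfolding \<gamma>_eq using square_integrable_mult[OF square_integrable_y square_integrable_x]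
    by (simp add: Bochner_Integration.integral_sum)
  finally show ?thesis .
qed

lemma expectation_noise_score:
  assumes "j < k"
  shows "expectation (\<lambda>\<omega>. noise (obs \<omega>) * score j (obs \<omega>)) = 0"
proof -
  have "expectation (\<lambda>\<omega>. noise (obs \<omega>) * score j (obs \<omega>)) =
      expectation (\<lambda>\<omega>. y \<omega> * score j (obs \<omega>) - (\<Sum>l<k. \<gamma> l * (score l (obs \<omega>) * score j (obs \<omega>))))"
    by (simp add: noise_def left_diff_distrib sum_distrib_right mult.assoc)
  also have "\<dots> = \<gamma> j - (\<Sum>l<k. \<gamma> l * expectation (\<lambda>\<omega>. score l (obs \<omega>) * score j (obs \<omega>)))"
    using square_integrable_mult[OF square_integrable_y square_integrable_score]
      square_integrable_mult[OF square_integrable_score square_integrable_score]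
    by (simp add: expectation_y_score)
  also have "(\<Sum>l<k. \<gamma> l * expectation (\<lambda>\<omega>. score l (obs \<omega>) * score j (obs \<omega>))) = (\<Sum>l<k. if l = j then \<gamma> l else 0)"
    using assms by (intro sum.cong refl) (simp add: expectation_score_score)
  finally show ?thesis using assms by simp
qed

text \<open>A working name for the conditional variance that is open to moment computations;
  \<open>sigma2_eq\<close> identifies the two.\<close>

definition resid_var :: real where
  "resid_var = expectation (\<lambda>\<omega>. (noise (obs \<omega>))\<^sup>2)"

lemma resid_var_nonneg: "0 \<le> resid_var"
  by (simp add: resid_var_def)

lemma second_moment_combination:
  "expectation (\<lambda>\<omega>. (c0 * noise (obs \<omega>) + (\<Sum>l<k. c l * score l (obs \<omega>)))\<^sup>2) = c0\<^sup>2 * resid_var + (\<Sum>l<k. (c l)\<^sup>2)"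
proof -
  note [simp] = square_integrable_mult[OF square_integrable_noise square_integrable_score]
    square_integrable_mult[OF square_integrable_score square_integrable_score]
    square_integrable_noise[unfolded square_integrable_def, THEN conjunct2]
  have "expectation (\<lambda>\<omega>. (c0 * noise (obs \<omega>) + (\<Sum>l<k. c l * score l (obs \<omega>)))\<^sup>2) =
    expectation (\<lambda>\<omega>. c0\<^sup>2 * (noise (obs \<omega>))\<^sup>2 + (\<Sum>l<k. (2 * c0 * c l) * (noise (obs \<omega>) * score l (obs \<omega>)))
       + (\<Sum>l<k. \<Sum>l'<k. (c l * c l') * (score l (obs \<omega>) * score l' (obs \<omega>))))"
    by (intro Bochner_Integration.integral_cong refl)
       (simp add: power2_sum power_mult_distrib sum_distrib_left power2_eq_square[of "sum _ _"] sum_product mult_ac)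
  also have "\<dots> = c0\<^sup>2 * resid_var + (\<Sum>l<k. (2 * c0 * c l) * expectation (\<lambda>\<omega>. noise (obs \<omega>) * score l (obs \<omega>)))
      + (\<Sum>l<k. \<Sum>l'<k. (c l * c l') * expectation (\<lambda>\<omega>. score l (obs \<omega>) * score l' (obs \<omega>)))"
    by (simp add: Bochner_Integration.integral_sum resid_var_def)
  also have "(\<Sum>l<k. \<Sum>l'<k. (c l * c l') * expectation (\<lambda>\<omega>. score l (obs \<omega>) * score l' (obs \<omega>))) = (\<Sum>l<k. (c l)\<^sup>2)"
  proof (intro sum.cong refl)
    fix l assume l: "l \<in> {..<k}"
    have "(\<Sum>l'<k. (c l * c l') * expectation (\<lambda>\<omega>. score l (obs \<omega>) * score l' (obs \<omega>))) = (\<Sum>l'<k. if l' = l then c l * c l else 0)"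
      using l by (intro sum.cong refl) (auto simp: expectation_score_score)
    then show "(\<Sum>l'<k. (c l * c l') * expectation (\<lambda>\<omega>. score l (obs \<omega>) * score l' (obs \<omega>))) = (c l)\<^sup>2"
      using l by (simp add: power2_eq_square)
  qed
  also have "(\<Sum>l<k. (2 * c0 * c l) * expectation (\<lambda>\<omega>. noise (obs \<omega>) * score l (obs \<omega>))) = 0"
    by (simp add: expectation_noise_score)
  finally show ?thesis by simp
qed

text \<open>A combination of noise and scores is a combination of \<open>y\<close> and finitely many
  \<open>x j\<close>, hence centred Gaussian and determined by its second moment. The law of one
  observation, its sign symmetry and the law of the sample are all read off from this
  formula.\<close>

lemma char_combination:
  "(CLINT \<omega>|P. iexp (c0 * noise (obs \<omega>) + (\<Sum>l<k. c l * score l (obs \<omega>)))) = of_real (exp (- (c0\<^sup>2 * resid_var + (\<Sum>l<k. (c l)\<^sup>2)) / 2))"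
proof -
  define d where "d j = (\<Sum>l<k. (c l - c0 * \<gamma> l) * A l (the_inv_into {..<k} f j))" for j
  have inv: "the_inv_into {..<k} f (f i) = i" if "i < k" for i
    using f that by (simp add: the_inv_into_f_f bij_betw_def)
  have eq: "c0 * noise (obs \<omega>) + (\<Sum>l<k. c l * score l (obs \<omega>)) = c0 * y \<omega> + (\<Sum>j\<in>f ` {..<k}. d j * x j \<omega>)" for \<omega>
  proof -
    have "(\<Sum>j\<in>f ` {..<k}. d j * x j \<omega>) = (\<Sum>i<k. d (f i) * x (f i) \<omega>)"
      using f by (subst sum.reindex) (auto simp: bij_betw_def)
    also have "\<dots> = (\<Sum>i<k. \<Sum>l<k. (c l - c0 * \<gamma> l) * (A l i * x (f i) \<omega>))"
      by (intro sum.cong refl) (simp add: d_def inv sum_distrib_right mult.assoc)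
    also have "\<dots> = (\<Sum>l<k. (c l - c0 * \<gamma> l) * score l (obs \<omega>))"
      by (subst sum.swap) (simp add: score_def sum_distrib_left)
    finally show ?thesis
      by (simp add: noise_def right_diff_distrib left_diff_distrib sum_distrib_left sum_subtractf mult.assoc)
  qed
  let ?L = "\<lambda>\<omega>. c0 * noise (obs \<omega>) + (\<Sum>l<k. c l * score l (obs \<omega>))"
  have g: "gaussian_rv P ?L"
    unfolding eq by (rule gaussian_combination) simp
  have "expectation ?L = 0"
    unfolding eq using square_integrable_y square_integrable_x
    by (simp add: square_integrable_integrable mean_y mean_x)
  from char_gaussian_rv[OF g this] show ?thesis
    unfolding second_moment_combination .
qed

lemma expectation_prediction_error:
  "expectation (\<lambda>\<omega>. (prediction_error m (obs \<omega>) b)\<^sup>2) = resid_var + (\<Sum>l<k. (tau b l)\<^sup>2)"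
  using second_moment_combination[of 1 "\<lambda>l. - tau b l"]
  by (simp add: prediction_error_eq sum_negf)

lemma integrable_prediction_error: "integrable P (\<lambda>\<omega>. (prediction_error m (obs \<omega>) b)\<^sup>2)"
proof -
  have "square_integrable P (\<lambda>\<omega>. noise (obs \<omega>) + (\<Sum>l<k. (- tau b l) * score l (obs \<omega>)))"
    by (intro square_integrable_add square_integrable_sum square_integrable_scale
          square_integrable_noise square_integrable_score)
  then show ?thesis by (simp add: prediction_error_eq sum_negf square_integrable_def)
qed

end

section \<open>Conditional mean and variance given the selected regressors\<close>

lemma nn_integral_square_std_normal: "(\<integral>\<^sup>+ z. ennreal (z\<^sup>2) \<partial>std_normal_distribution) = 1"
proof -
  have "(\<integral>\<^sup>+ z. ennreal (z\<^sup>2) \<partial>std_normal_distribution) = ennreal (LINT z|std_normal_distribution. z\<^sup>2)"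
    using integrable_std_normal_distribution_moment[of 2] by (intro nn_integral_eq_integral) auto
  also have "(LINT z|std_normal_distribution. z\<^sup>2) = 1"
    using std_normal_distribution_even_moments(1)[of 1] by simp
  finally show ?thesis by simp
qed

context whitened_gaussian_model
begin

definition coord :: "observation \<Rightarrow> nat \<Rightarrow> real" where
  "coord z = (\<lambda>l\<in>{..k}. if l = k then noise z else score l z)"

lemma measurable_coord: "coord \<in> obs_space \<rightarrow>\<^sub>M PiM {..k} (\<lambda>_. borel)"
  unfolding coord_def[abs_def] by (intro measurable_restrict) simp

lemma distr_coord:
  "distr P (PiM {..k} (\<lambda>_. borel)) (\<lambda>\<omega>. coord (obs \<omega>)) =
   distr (std_gaussian {..k}) (PiM {..k} (\<lambda>_. borel)) (\<lambda>z. \<lambda>l\<in>{..k}. if l = k then sqrt resid_var * z l else z l)"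
proof (rule distr_eqI_linear_forms)
  show "(\<lambda>\<omega>. coord (obs \<omega>)) \<in> P \<rightarrow>\<^sub>M PiM {..k} (\<lambda>_. borel)"
    by (rule measurable_compose[OF measurable_obs measurable_coord])
  have "(\<lambda>z. \<lambda>l\<in>{..k}. if l = k then sqrt resid_var * z l else z l) \<in> PiM {..k} (\<lambda>_. borel) \<rightarrow>\<^sub>M PiM {..k} (\<lambda>_. borel)"
  proof (intro measurable_restrict)
    fix l assume "l \<in> {..k}"
    then have "(\<lambda>z. z l) \<in> borel_measurable (PiM {..k} (\<lambda>_. borel :: real measure))"
      by (rule measurable_component_singleton)
    then show "(\<lambda>z. if l = k then sqrt resid_var * z l else z l) \<in> borel_measurable (PiM {..k} (\<lambda>_. borel))"
      by simp
  qed
  then show "(\<lambda>z. \<lambda>l\<in>{..k}. if l = k then sqrt resid_var * z l else z l) \<in> std_gaussian {..k} \<rightarrow>\<^sub>M PiM {..k} (\<lambda>_. borel)"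
    by (simp add: measurable_cong_sets[OF sets_std_gaussian refl])
  fix t :: "nat \<Rightarrow> real"
  have "(\<Sum>l\<le>k. t l * coord z l) = t k * noise z + (\<Sum>l<k. t l * score l z)" for z
    by (simp add: lessThan_Suc_atMost[symmetric] coord_def)
  then have 1: "(CLINT \<omega>|P. iexp (\<Sum>l\<le>k. t l * coord (obs \<omega>) l)) = of_real (exp (- ((t k)\<^sup>2 * resid_var + (\<Sum>l<k. (t l)\<^sup>2)) / 2))"
    by (simp only: char_combination)
  let ?c = "\<lambda>l. if l = k then t l * sqrt resid_var else t l"
  have "(\<Sum>l\<le>k. t l * (\<lambda>l\<in>{..k}. if l = k then sqrt resid_var * z l else z l) l) = (\<Sum>l\<le>k. ?c l * z l)" for z
    by (intro sum.cong) auto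
  then have "(CLINT z|std_gaussian {..k}. iexp (\<Sum>l\<le>k. t l * (\<lambda>l\<in>{..k}. if l = k then sqrt resid_var * z l else z l) l)) = of_real (exp (- (\<Sum>l\<le>k. (?c l)\<^sup>2) / 2))"
    by (simp only: char_std_gaussian finite_atMost)
  also have "(\<Sum>l\<le>k. (?c l)\<^sup>2) = (t k)\<^sup>2 * resid_var + (\<Sum>l<k. (t l)\<^sup>2)"
    by (simp add: lessThan_Suc_atMost[symmetric] power_mult_distrib resid_var_nonneg)
  finally show "(CLINT \<omega>|P. iexp (\<Sum>l\<le>k. t l * coord (obs \<omega>) l)) =
      (CLINT z|std_gaussian {..k}. iexp (\<Sum>l\<le>k. t l * (\<lambda>l\<in>{..k}. if l = k then sqrt resid_var * z l else z l) l))"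
    unfolding 1 ..
qed (auto intro: prob_space_axioms prob_space_std_gaussian)

text \<open>The characteristic function involves the coefficient of the noise only through its
  square. By this symmetry every integrable function odd in the noise has mean zero, which yields
  the conditional mean of \<open>y\<close>.\<close>

lemma distr_coord_flip:
  "distr P (PiM {..k} (\<lambda>_. borel)) (\<lambda>\<omega>. coord (obs \<omega>)) =
   distr P (PiM {..k} (\<lambda>_. borel)) (\<lambda>\<omega>. \<lambda>l\<in>{..k}. if l = k then - noise (obs \<omega>) else score l (obs \<omega>))"
proof (rule distr_eqI_linear_forms)
  show "(\<lambda>\<omega>. coord (obs \<omega>)) \<in> P \<rightarrow>\<^sub>M PiM {..k} (\<lambda>_. borel)"
    by (rule measurable_compose[OF measurable_obs measurable_coord])
  show "(\<lambda>\<omega>. \<lambda>l\<in>{..k}. if l = k then - noise (obs \<omega>) else score l (obs \<omega>)) \<in> P \<rightarrow>\<^sub>M PiM {..k} (\<lambda>_. borel)"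
    by (intro measurable_restrict) measurable
  fix t :: "nat \<Rightarrow> real"
  have 1: "(\<Sum>l\<le>k. t l * coord z l) = t k * noise z + (\<Sum>l<k. t l * score l z)" for z
    by (simp add: lessThan_Suc_atMost[symmetric] coord_def)
  have 2: "(\<Sum>l\<le>k. t l * (\<lambda>l\<in>{..k}. if l = k then - noise z else score l z) l) = (- t k) * noise z + (\<Sum>l<k. t l * score l z)" for z
    by (simp add: lessThan_Suc_atMost[symmetric])
  show "(CLINT \<omega>|P. iexp (\<Sum>l\<le>k. t l * coord (obs \<omega>) l)) =
      (CLINT \<omega>|P. iexp (\<Sum>l\<le>k. t l * (\<lambda>l\<in>{..k}. if l = k then - noise (obs \<omega>) else score l (obs \<omega>)) l))"
    unfolding 1 2 char_combination by simp
qed (auto intro: prob_space_axioms)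

text \<open>Recovers the selected regressors from their scores, so that events generated by the
  former become events in coordinates independent of the noise.\<close>

definition regressors :: "(nat \<Rightarrow> real) \<Rightarrow> nat \<Rightarrow> real" where
  "regressors z = (\<lambda>j\<in>{j. m j}. \<Sum>l<k. B (the_inv_into {..<k} f j) l * z l)"

lemma regressors_coord: "regressors (coord (obs \<omega>)) = (\<lambda>j\<in>{j. m j}. x j \<omega>)"
proof (rule ext)
  fix j
  show "regressors (coord (obs \<omega>)) j = (\<lambda>j\<in>{j. m j}. x j \<omega>) j"
  proof (cases "m j")
    case True
    then obtain i where i: "i < k" "j = f i" using f by (auto simp: bij_betw_def)
    then have "the_inv_into {..<k} f j = i"
      using f by (simp add: the_inv_into_f_f bij_betw_def)
    then have "regressors (coord (obs \<omega>)) j = (\<Sum>l<k. B i l * score l (obs \<omega>))"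
      using True by (simp add: regressors_def coord_def)
    also have "\<dots> = x j \<omega>"
      using BA[OF i(1), of "\<lambda>i. x (f i) \<omega>"] by (simp add: score_def i(2))
    finally show ?thesis using True by simp
  qed (simp add: regressors_def)
qed

lemma regressors_cong: "(\<And>l. l < k \<Longrightarrow> z l = z' l) \<Longrightarrow> regressors z = regressors z'"
  by (simp add: regressors_def fun_eq_iff)

lemma measurable_regressors: "{..<k} \<subseteq> I \<Longrightarrow> regressors \<in> PiM I (\<lambda>_. borel) \<rightarrow>\<^sub>M PiM {j. m j} (\<lambda>_. borel)"
  unfolding regressors_def[abs_def]
  by (intro measurable_restrict borel_measurable_sum borel_measurable_times borel_measurable_const measurable_component_singleton) auto

lemma expectation_noise_indicator:
  assumes S: "S \<in> sets (PiM {j. m j} (\<lambda>_. borel))"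
  shows "expectation (\<lambda>\<omega>. noise (obs \<omega>) * indicator S (\<lambda>j\<in>{j. m j}. x j \<omega>)) = 0"
proof -
  let ?M = "PiM {..k} (\<lambda>_. borel :: real measure)"
  let ?F = "\<lambda>\<omega>. \<lambda>l\<in>{..k}. if l = k then - noise (obs \<omega>) else score l (obs \<omega>)"
  define \<phi> where "\<phi> z = z k * indicator S (regressors z)" for z
  have \<phi>: "\<phi> \<in> borel_measurable ?M"
    unfolding \<phi>_def[abs_def] using S
    by (intro borel_measurable_times measurable_component_singleton
        measurable_compose[OF measurable_regressors borel_measurable_indicator]) auto
  have c: "(\<lambda>\<omega>. coord (obs \<omega>)) \<in> P \<rightarrow>\<^sub>M ?M"
    by (rule measurable_compose[OF measurable_obs measurable_coord])
  have F: "?F \<in> P \<rightarrow>\<^sub>M ?M"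
    by (intro measurable_restrict) measurable
  have "regressors (?F \<omega>) = regressors (coord (obs \<omega>))" for \<omega>
    by (intro regressors_cong) (simp add: coord_def)
  then have neg: "\<phi> (?F \<omega>) = - \<phi> (coord (obs \<omega>))" for \<omega>
    by (simp add: \<phi>_def coord_def)
  have "expectation (\<lambda>\<omega>. \<phi> (coord (obs \<omega>))) = (LINT z|distr P ?M (\<lambda>\<omega>. coord (obs \<omega>)). \<phi> z)"
    by (rule integral_distr[OF c \<phi>, symmetric])
  also have "\<dots> = expectation (\<lambda>\<omega>. \<phi> (?F \<omega>))"
    unfolding distr_coord_flip by (rule integral_distr[OF F \<phi>])
  finally have "expectation (\<lambda>\<omega>. \<phi> (coord (obs \<omega>))) = 0"
    unfolding neg by simp
  then show ?thesis
    unfolding \<phi>_def regressors_coord by (simp add: coord_def)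
qed

lemma expectation_noise_square_indicator:
  assumes S: "S \<in> sets (PiM {j. m j} (\<lambda>_. borel))"
  shows "expectation (\<lambda>\<omega>. (noise (obs \<omega>))\<^sup>2 * indicator S (\<lambda>j\<in>{j. m j}. x j \<omega>))
    = resid_var * expectation (\<lambda>\<omega>. indicator S (\<lambda>j\<in>{j. m j}. x j \<omega>))"
proof -
  let ?M = "PiM {..k} (\<lambda>_. borel :: real measure)"
  let ?s = "\<lambda>z. \<lambda>l\<in>{..k}. if l = k then sqrt resid_var * z l else z l :: real"
  have k: "{..k} = insert k {..<k}" by auto
  have c: "(\<lambda>\<omega>. coord (obs \<omega>)) \<in> P \<rightarrow>\<^sub>M ?M"
    by (rule measurable_compose[OF measurable_obs measurable_coord])
  have s: "?s \<in> std_gaussian {..k} \<rightarrow>\<^sub>M ?M"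
  proof -
    have "(\<lambda>z. z l) \<in> borel_measurable (std_gaussian {..k})" if "l \<in> {..k}" for l
      using that by (simp add: measurable_cong_sets[OF sets_std_gaussian refl])
    then show ?thesis
      by (intro measurable_restrict) auto
  qed
  have ind: "(\<lambda>z. indicator S (regressors z) :: ennreal) \<in> borel_measurable (PiM I (\<lambda>_. borel))" if "{..<k} \<subseteq> I" for I
    using S by (intro measurable_compose[OF measurable_regressors[OF that] borel_measurable_indicator])
  have sub: "{..<k} \<subseteq> {..k}" by auto
  \<comment> \<open>Independence of noise and regressors in usable form: a function of the noise
    factors out of a regressor event. It is applied to the constant 1 and to the square, and
    nonnegative integrals keep integrability out of the way.\<close>
  have transfer: "(\<integral>\<^sup>+\<omega>. ennreal (g (coord (obs \<omega>) k)) * indicator S (\<lambda>j\<in>{j. m j}. x j \<omega>) \<partial>P)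
      = (\<integral>\<^sup>+z. ennreal (g (sqrt resid_var * z)) \<partial>std_normal_distribution) * (\<integral>\<^sup>+z. indicator S (regressors z) \<partial>std_gaussian {..<k})"
    if g[measurable]: "g \<in> borel_measurable borel" for g :: "real \<Rightarrow> real"
  proof -
    let ?\<phi> = "\<lambda>z. ennreal (g (z k)) * indicator S (regressors z)"
    have zk: "(\<lambda>z. z k) \<in> borel_measurable ?M" by (rule measurable_component_singleton) simp
    have \<phi>: "?\<phi> \<in> borel_measurable ?M"
      using ind[OF sub] measurable_compose[OF zk g] by (intro borel_measurable_times_ennreal) auto
    have "(\<integral>\<^sup>+\<omega>. ennreal (g (coord (obs \<omega>) k)) * indicator S (\<lambda>j\<in>{j. m j}. x j \<omega>) \<partial>P) = (\<integral>\<^sup>+z. ?\<phi> z \<partial>distr P ?M (\<lambda>\<omega>. coord (obs \<omega>)))"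
      using c \<phi> by (simp add: nn_integral_distr regressors_coord)
    also have "\<dots> = (\<integral>\<^sup>+z. ?\<phi> (?s z) \<partial>std_gaussian {..k})"
      unfolding distr_coord using s \<phi> by (subst nn_integral_distr) auto
    also have "\<dots> = (\<integral>\<^sup>+z. ennreal (g (sqrt resid_var * z k)) * indicator S (regressors z) \<partial>std_gaussian {..k})"
    proof (intro nn_integral_cong arg_cong2[where f="(*)"])
      fix z
      show "indicator S (regressors (?s z)) = (indicator S (regressors z) :: ennreal)"
        by (intro arg_cong[where f="indicator S"] regressors_cong) simp
    qed simp
    also have "\<dots> = (\<integral>\<^sup>+z. \<integral>\<^sup>+w. ennreal (g (sqrt resid_var * (z(k := w)) k)) * indicator S (regressors (z(k := w))) \<partial>std_normal_distribution \<partial>std_gaussian {..<k})"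
      unfolding k std_gaussian_def
    proof (rule std_gaussian.product_nn_integral_insert)
      have "(\<lambda>z. ennreal (g (sqrt resid_var * z k)) * indicator S (regressors z)) \<in> borel_measurable ?M"
        using ind[OF sub] measurable_compose[OF zk, of "\<lambda>w. g (sqrt resid_var * w)"] by (intro borel_measurable_times_ennreal) auto
      then have "(\<lambda>z. ennreal (g (sqrt resid_var * z k)) * indicator S (regressors z)) \<in> borel_measurable (std_gaussian {..k})"
        by (simp add: measurable_cong_sets[OF sets_std_gaussian refl])
      then show "(\<lambda>z. ennreal (g (sqrt resid_var * z k)) * indicator S (regressors z)) \<in> borel_measurable (PiM (insert k {..<k}) (\<lambda>_. std_normal_distribution))"
        unfolding k std_gaussian_def .
    qed simp_all
    also have "\<dots> = (\<integral>\<^sup>+z. \<integral>\<^sup>+w. ennreal (g (sqrt resid_var * w)) * indicator S (regressors z) \<partial>std_normal_distribution \<partial>std_gaussian {..<k})"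
    proof (intro nn_integral_cong arg_cong2[where f="(*)"])
      fix z and w :: real
      show "indicator S (regressors (z(k := w))) = (indicator S (regressors z) :: ennreal)"
        by (intro arg_cong[where f="indicator S"] regressors_cong) simp
    qed simp
    also have "\<dots> = (\<integral>\<^sup>+z. ennreal (g (sqrt resid_var * z)) \<partial>std_normal_distribution) * (\<integral>\<^sup>+z. indicator S (regressors z) \<partial>std_gaussian {..<k})"
      using ind[of "{..<k}"] by (simp add: nn_integral_multc nn_integral_cmult measurable_cong_sets[OF sets_std_gaussian refl])
    finally show ?thesis .
  qed
  let ?p = "\<integral>\<^sup>+z. indicator S (regressors z) \<partial>std_gaussian {..<k}"
  have "(\<integral>\<^sup>+\<omega>. indicator S (\<lambda>j\<in>{j. m j}. x j \<omega>) \<partial>P) = ?p"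
    using transfer[of "\<lambda>_. 1"] std_gaussian.M.emeasure_space_1 by simp
  moreover have "(\<integral>\<^sup>+\<omega>. ennreal ((noise (obs \<omega>))\<^sup>2) * indicator S (\<lambda>j\<in>{j. m j}. x j \<omega>) \<partial>P) = ennreal resid_var * ?p"
  proof -
    have "(\<integral>\<^sup>+z. ennreal ((sqrt resid_var * z)\<^sup>2) \<partial>std_normal_distribution) = ennreal resid_var * (\<integral>\<^sup>+z. ennreal (z\<^sup>2) \<partial>std_normal_distribution)"
      by (subst nn_integral_cmult[symmetric]) (simp_all add: power_mult_distrib resid_var_nonneg ennreal_mult)
    then show ?thesis
      using transfer[of "\<lambda>z. z\<^sup>2"] by (simp add: coord_def nn_integral_square_std_normal)
  qed
  ultimately have nn: "(\<integral>\<^sup>+\<omega>. ennreal ((noise (obs \<omega>))\<^sup>2) * indicator S (\<lambda>j\<in>{j. m j}. x j \<omega>) \<partial>P)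
      = ennreal resid_var * (\<integral>\<^sup>+\<omega>. indicator S (\<lambda>j\<in>{j. m j}. x j \<omega>) \<partial>P)"
    by simp
  have xJ: "(\<lambda>\<omega>. \<lambda>j\<in>{j. m j}. x j \<omega>) \<in> P \<rightarrow>\<^sub>M PiM {j. m j} (\<lambda>_. borel)"
    using square_integrable_x by (intro measurable_restrict) (simp add: square_integrable_def)
  have indm: "(\<lambda>\<omega>. indicator S (\<lambda>j\<in>{j. m j}. x j \<omega>) :: real) \<in> borel_measurable P"
    using S by (intro measurable_compose[OF xJ borel_measurable_indicator])
  have nm: "(\<lambda>\<omega>. noise (obs \<omega>)) \<in> borel_measurable P"
    using square_integrable_noise by (simp add: square_integrable_def)
  have "expectation (\<lambda>\<omega>. (noise (obs \<omega>))\<^sup>2 * indicator S (\<lambda>j\<in>{j. m j}. x j \<omega>))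
      = enn2real (\<integral>\<^sup>+\<omega>. ennreal ((noise (obs \<omega>))\<^sup>2 * indicator S (\<lambda>j\<in>{j. m j}. x j \<omega>)) \<partial>P)"
    using indm nm by (intro integral_eq_nn_integral) auto
  also have "\<dots> = enn2real (\<integral>\<^sup>+\<omega>. ennreal ((noise (obs \<omega>))\<^sup>2) * indicator S (\<lambda>j\<in>{j. m j}. x j \<omega>) \<partial>P)"
    by (simp add: ennreal_mult ennreal_indicator)
  also have "\<dots> = resid_var * enn2real (\<integral>\<^sup>+\<omega>. ennreal (indicator S (\<lambda>j\<in>{j. m j}. x j \<omega>)) \<partial>P)"
    unfolding nn by (simp add: enn2real_mult resid_var_nonneg ennreal_indicator)
  also have "enn2real (\<integral>\<^sup>+\<omega>. ennreal (indicator S (\<lambda>j\<in>{j. m j}. x j \<omega>)) \<partial>P) = expectation (\<lambda>\<omega>. indicator S (\<lambda>j\<in>{j. m j}. x j \<omega>))"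
    using indm by (intro integral_eq_nn_integral[symmetric]) auto
  finally show ?thesis .
qed

text \<open>The score part of \<open>y\<close> is its conditional expectation, and what remains is
  independent of the regressors, so the conditional variance is constant. The description by
  \<open>THE\<close> is legitimate because two constants that agree almost surely are equal on a
  probability space.\<close>

lemma sigma2_eq: "sigma2 P y x m = resid_var"
proof -
  let ?g = "\<lambda>\<omega>. \<lambda>j\<in>{j. m j}. x j \<omega>"
  let ?J = "PiM {j. m j} (\<lambda>_. borel :: real measure)"
  define F where "F = vimage_algebra (space P) ?g ?J"
  have g: "?g \<in> P \<rightarrow>\<^sub>M ?J"
    using square_integrable_x by (intro measurable_restrict) (simp add: square_integrable_def)
  have gs: "?g \<in> space P \<rightarrow> space ?J"
    using g by (auto simp: measurable_def)
  have sub: "subalgebra P F"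
    unfolding subalgebra_def F_def using g by (auto simp: sets_vimage_algebra2[OF gs] measurable_sets)
  interpret finite_measure_subalgebra P F
    using sub by unfold_locales
  have gF: "?g \<in> F \<rightarrow>\<^sub>M ?J"
    unfolding F_def by (rule measurable_vimage_algebra1[OF gs])
  have sF: "(\<lambda>\<omega>. score l (obs \<omega>)) \<in> borel_measurable F" for l
  proof -
    have "(\<lambda>\<omega>. x (f j) \<omega>) \<in> borel_measurable F" if "j < k" for j
      using measurable_compose[OF gF measurable_component_singleton[of "f j"]] m_f[OF that] by simp
    then show ?thesis
      unfolding score_def snd_conv by (intro borel_measurable_sum borel_measurable_times) auto
  qed
  have iy: "integrable P y" and iS: "integrable P (\<lambda>\<omega>. score l (obs \<omega>))" and iN: "integrable P (\<lambda>\<omega>. noise (obs \<omega>))" for l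
    using square_integrable_y square_integrable_score square_integrable_noise by (auto intro: square_integrable_integrable)
  have in2: "integrable P (\<lambda>\<omega>. (noise (obs \<omega>))\<^sup>2)"
    using square_integrable_noise by (simp add: square_integrable_def)
  let ?h = "\<lambda>\<omega>. \<Sum>l<k. \<gamma> l * score l (obs \<omega>)"
  have h: "integrable P ?h" using iS by auto
  \<comment> \<open>Events of the generated sigma-algebra are rewritten as the regressors falling
    into a set \<open>S\<close>, the form in which the two noise identities are stated.\<close>
  have A: "\<exists>S\<in>sets ?J. \<forall>\<omega>\<in>space P. \<omega> \<in> A \<longleftrightarrow> ?g \<omega> \<in> S" if "A \<in> sets F" for A
    using that unfolding F_def sets_vimage_algebra2[OF gs] by auto
  have "AE \<omega> in P. real_cond_exp P F y \<omega> = ?h \<omega>"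
  proof (rule real_cond_exp_charact)
    fix A assume "A \<in> sets F"
    with A obtain S where S: "S \<in> sets ?J" "\<forall>\<omega>\<in>space P. \<omega> \<in> A \<longleftrightarrow> ?g \<omega> \<in> S" by blast
    have Am: "A \<in> sets P" using \<open>A \<in> sets F\<close> sub by (auto simp: subalgebra_def)
    have ind: "indicator A \<omega> = (indicator S (?g \<omega>) :: real)" if "\<omega> \<in> space P" for \<omega>
      using S(2) that by (simp add: indicator_def)
    have "(\<integral>\<omega>\<in>A. y \<omega> \<partial>P) - (\<integral>\<omega>\<in>A. ?h \<omega> \<partial>P) = (\<integral>\<omega>\<in>A. noise (obs \<omega>) \<partial>P)"
      unfolding set_lebesgue_integral_def
      using integrable_mult_indicator[OF Am iy] integrable_mult_indicator[OF Am h]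
      by (subst Bochner_Integration.integral_diff[symmetric]) (auto simp: noise_def right_diff_distrib)
    also have "\<dots> = expectation (\<lambda>\<omega>. noise (obs \<omega>) * indicator S (?g \<omega>))"
      unfolding set_lebesgue_integral_def by (intro Bochner_Integration.integral_cong refl) (simp add: ind)
    also have "\<dots> = 0" by (rule expectation_noise_indicator[OF S(1)])
    finally show "(\<integral>\<omega>\<in>A. y \<omega> \<partial>P) = (\<integral>\<omega>\<in>A. ?h \<omega> \<partial>P)" by simp
  qed (use iy h sF in auto)
  then have "AE \<omega> in P. (y \<omega> - real_cond_exp P F y \<omega>)\<^sup>2 = (noise (obs \<omega>))\<^sup>2"
    by eventually_elim (simp add: noise_def)
  then have "AE \<omega> in P. cond_var P F y \<omega> = real_cond_exp P F (\<lambda>\<omega>. (noise (obs \<omega>))\<^sup>2) \<omega>"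
    unfolding cond_var_def using iy in2 by (intro real_cond_exp_cong) auto
  moreover have "AE \<omega> in P. real_cond_exp P F (\<lambda>\<omega>. (noise (obs \<omega>))\<^sup>2) \<omega> = resid_var"
  proof (rule real_cond_exp_charact)
    fix A assume "A \<in> sets F"
    with A obtain S where S: "S \<in> sets ?J" "\<forall>\<omega>\<in>space P. \<omega> \<in> A \<longleftrightarrow> ?g \<omega> \<in> S" by blast
    have ind: "indicator A \<omega> = (indicator S (?g \<omega>) :: real)" if "\<omega> \<in> space P" for \<omega>
      using S(2) that by (simp add: indicator_def)
    have "(\<integral>\<omega>\<in>A. (noise (obs \<omega>))\<^sup>2 \<partial>P) = expectation (\<lambda>\<omega>. (noise (obs \<omega>))\<^sup>2 * indicator S (?g \<omega>))"
      unfolding set_lebesgue_integral_def by (intro Bochner_Integration.integral_cong refl) (simp add: ind)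
    also have "\<dots> = resid_var * expectation (\<lambda>\<omega>. indicator S (?g \<omega>))"
      by (rule expectation_noise_square_indicator[OF S(1)])
    also have "\<dots> = (\<integral>\<omega>\<in>A. resid_var \<partial>P)"
      unfolding set_lebesgue_integral_def
      by (subst integral_mult_right_zero[symmetric], intro Bochner_Integration.integral_cong refl) (simp add: ind)
    finally show "(\<integral>\<omega>\<in>A. (noise (obs \<omega>))\<^sup>2 \<partial>P) = (\<integral>\<omega>\<in>A. resid_var \<partial>P)" .
  qed (use in2 in auto)
  ultimately have ae: "AE \<omega> in P. cond_var P F y \<omega> = resid_var" by eventually_elim simp
  have "v = resid_var" if "AE \<omega> in P. cond_var P F y \<omega> = v" for v
  proof -
    have "AE \<omega> in P. v = resid_var" using ae that by eventually_elim simp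
    then show ?thesis by simp
  qed
  with ae show ?thesis
    unfolding sigma2_def F_def[symmetric] by (rule the_equality)
qed

end

subsection \<open>Samples\<close>

context iid_sample_and_future
begin

lemma measurable_Z: "i < n \<Longrightarrow> Z i \<in> M \<rightarrow>\<^sub>M obs_space"
  using sample_indep by (simp add: indep_vars_def)

lemma measurable_sample: "sample n Z \<in> M \<rightarrow>\<^sub>M sample_space n"
  unfolding sample_def[abs_def] by (intro measurable_restrict measurable_Z) simp

text \<open>Independence is given for generated sigma-algebras. As a product law it permits
  integrating over the future observation with the sample frozen.\<close>

lemma distr_sample_future:
  "distr M (sample_space n \<Otimes>\<^sub>M obs_space) (\<lambda>\<omega>. (sample n Z \<omega>, Zf \<omega>)) = distr M (sample_space n) (sample n Z) \<Otimes>\<^sub>M D"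
proof -
  have sz: "(\<lambda>\<omega>. (sample n Z \<omega>, Zf \<omega>)) \<in> M \<rightarrow>\<^sub>M sample_space n \<Otimes>\<^sub>M obs_space"
    using measurable_sample future_rv by (rule measurable_Pair)
  have "distr M (sample_space n) (sample n Z) \<Otimes>\<^sub>M distr M obs_space Zf
    = distr M (sample_space n \<Otimes>\<^sub>M obs_space) (\<lambda>\<omega>. (sample n Z \<omega>, Zf \<omega>))"
  proof (rule pair_measure_eqI)
    show "sigma_finite_measure (distr M (sample_space n) (sample n Z))"
      by (intro prob_space_imp_sigma_finite prob_space_distr measurable_sample)
    show "sigma_finite_measure (distr M obs_space Zf)"
      by (intro prob_space_imp_sigma_finite prob_space_distr future_rv)
    show "sets (distr M (sample_space n) (sample n Z) \<Otimes>\<^sub>M distr M obs_space Zf) =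
        sets (distr M (sample_space n \<Otimes>\<^sub>M obs_space) (\<lambda>\<omega>. (sample n Z \<omega>, Zf \<omega>)))"
      unfolding sets_distr by (intro sets_pair_measure_cong) simp_all
    fix A B assume "A \<in> sets (distr M (sample_space n) (sample n Z))" "B \<in> sets (distr M obs_space Zf)"
    then have AB: "A \<in> sets (sample_space n)" "B \<in> sets obs_space" by simp_all
    have "prob ((sample n Z -` A \<inter> space M) \<inter> (Zf -` B \<inter> space M)) = prob (sample n Z -` A \<inter> space M) * prob (Zf -` B \<inter> space M)"
      by (rule indep_setD[OF future_indep]) (rule in_vimage_algebra, rule AB)+
    moreover have "(sample n Z -` A \<inter> space M) \<inter> (Zf -` B \<inter> space M) = (\<lambda>\<omega>. (sample n Z \<omega>, Zf \<omega>)) -` (A \<times> B) \<inter> space M"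
      by auto
    ultimately show "emeasure (distr M (sample_space n) (sample n Z)) A * emeasure (distr M obs_space Zf) B
        = emeasure (distr M (sample_space n \<Otimes>\<^sub>M obs_space) (\<lambda>\<omega>. (sample n Z \<omega>, Zf \<omega>))) (A \<times> B)"
      using AB measurable_sample future_rv sz
      by (simp add: emeasure_distr emeasure_eq_measure ennreal_mult[symmetric])
  qed
  then show ?thesis by (simp add: future_law)
qed

end

section \<open>Conditional prediction error and the law of the whitened sample\<close>

lemma scale_last_eq: "scale_last n k s = (\<lambda>x. \<lambda>q\<in>{..<n} \<times> {..k}. if snd q = k then s * x q else x q)"
  by (auto simp: scale_last_def fun_eq_iff)

lemma measurable_scale_last:
  "scale_last n k s \<in> std_gaussian ({..<n} \<times> {..k}) \<rightarrow>\<^sub>M PiM ({..<n} \<times> {..k}) (\<lambda>_. borel)"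
proof -
  have "(\<lambda>x. x q) \<in> borel_measurable (std_gaussian ({..<n} \<times> {..k}))" if "q \<in> {..<n} \<times> {..k}" for q
    using measurable_component_singleton[OF that, of "\<lambda>_. borel :: real measure"]
    by (simp add: measurable_cong_sets[OF sets_std_gaussian refl])
  then show ?thesis
    unfolding scale_last_eq by (intro measurable_restrict) auto
qed

context whitened_gaussian_model
begin

text \<open>With the sample frozen, the estimator is a fixed coefficient vector and the integral
  over the future pair is \<open>expectation_prediction_error\<close>; the product law turns this
  into a statement about the conditional expectation.\<close>

lemma rho2_eq:
  assumes iid: "iid_sample_and_future M (distr P obs_space obs) n Z Zf"
  shows "AE \<omega> in M. rho2 M n Z Zf m \<omega> = resid_var + (\<Sum>l<k. (tau (beta_tilde n m (sample n Z \<omega>)) l)\<^sup>2)"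
proof -
  interpret S: iid_sample_and_future M "distr P obs_space obs" n Z Zf by (rule iid)
  let ?D = "distr P obs_space obs"
  interpret D: prob_space ?D by (rule prob_space_distr[OF measurable_obs])
  define F where "F = vimage_algebra (space M) (sample n Z) (sample_space n)"
  have gs: "sample n Z \<in> space M \<rightarrow> space (sample_space n)"
    using S.measurable_sample by (auto simp: measurable_def)
  have sub: "subalgebra M F"
    unfolding subalgebra_def F_def using S.measurable_sample by (auto simp: sets_vimage_algebra2[OF gs] measurable_sets)
  interpret F: finite_measure_subalgebra M F
    using sub by unfold_locales
  have sF: "sample n Z \<in> F \<rightarrow>\<^sub>M sample_space n"
    unfolding F_def by (rule measurable_vimage_algebra1[OF gs])
  define h where "h p = ennreal ((prediction_error m (snd p) (beta_tilde n m (fst p)))\<^sup>2)" for p :: "(nat \<Rightarrow> observation) \<times> observation"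
  have h: "h \<in> borel_measurable (sample_space n \<Otimes>\<^sub>M obs_space)"
  proof -
    have "(\<lambda>p. beta_tilde n m (fst p) j) \<in> borel_measurable (sample_space n \<Otimes>\<^sub>M obs_space)" for j
      by (rule measurable_compose[OF measurable_fst measurable_beta_tilde])
    then have "(\<lambda>p. prediction_error m (snd p) (beta_tilde n m (fst p))) \<in> borel_measurable (sample_space n \<Otimes>\<^sub>M obs_space)"
      unfolding prediction_error_eq tau_def
      by (intro borel_measurable_diff borel_measurable_sum borel_measurable_times borel_measurable_const
          measurable_compose[OF measurable_snd measurable_noise] measurable_compose[OF measurable_snd measurable_score]) auto
    then show ?thesis unfolding h_def[abs_def] by measurable
  qed
  define r where "r d = resid_var + (\<Sum>l<k. (tau (beta_tilde n m d) l)\<^sup>2)" for d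
  have r0: "0 \<le> r d" for d by (simp add: r_def resid_var_nonneg sum_nonneg)
  have hr: "(\<integral>\<^sup>+z. h (d, z) \<partial>?D) = ennreal (r d)" for d
  proof -
    have "(\<lambda>z. prediction_error m z (beta_tilde n m d)) \<in> borel_measurable obs_space"
      unfolding prediction_error_eq by measurable
    then have "(\<integral>\<^sup>+z. h (d, z) \<partial>?D) = (\<integral>\<^sup>+\<omega>. ennreal ((prediction_error m (obs \<omega>) (beta_tilde n m d))\<^sup>2) \<partial>P)"
      unfolding h_def by (subst nn_integral_distr[OF measurable_obs]) auto
    also have "\<dots> = ennreal (expectation (\<lambda>\<omega>. (prediction_error m (obs \<omega>) (beta_tilde n m d))\<^sup>2))"
      by (intro nn_integral_eq_integral integrable_prediction_error) simp
    finally show ?thesis unfolding expectation_prediction_error r_def .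
  qed
  have rm: "(\<lambda>d. ennreal (r d)) \<in> borel_measurable (sample_space n)"
    unfolding r_def tau_def using measurable_beta_tilde by (intro measurable_compose[OF _ measurable_ennreal] borel_measurable_add
      borel_measurable_sum borel_measurable_power borel_measurable_diff borel_measurable_times borel_measurable_const) auto
  let ?pe = "\<lambda>\<omega>. (prediction_error m (Zf \<omega>) (beta_tilde n m (sample n Z \<omega>)))\<^sup>2"
  have sz: "(\<lambda>\<omega>. (sample n Z \<omega>, Zf \<omega>)) \<in> M \<rightarrow>\<^sub>M sample_space n \<Otimes>\<^sub>M obs_space"
    using S.measurable_sample S.future_rv by (rule measurable_Pair)
  \<comment> \<open>By definition \<open>real_cond_exp\<close> is a difference of conditional
    expectations of the positive and the negative part. Both are identified with nonnegative
    integrals, so the squared error is never integrated as a real function; the negative part is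
    zero.\<close>
  have "AE \<omega> in M. ennreal (r (sample n Z \<omega>)) = nn_cond_exp M F (\<lambda>\<omega>. ennreal (?pe \<omega>)) \<omega>"
  proof (rule F.nn_cond_exp_charact)
    fix A assume "A \<in> sets F"
    then obtain T where T: "T \<in> sets (sample_space n)" "A = sample n Z -` T \<inter> space M"
      unfolding F_def sets_vimage_algebra2[OF gs] by auto
    have ind: "indicator A \<omega> = (indicator T (sample n Z \<omega>) :: ennreal)" if "\<omega> \<in> space M" for \<omega>
      using that by (simp add: T(2) indicator_def)
    have hT: "(\<lambda>p. h p * indicator T (fst p)) \<in> borel_measurable (sample_space n \<Otimes>\<^sub>M obs_space)"
      using h T(1) by (intro borel_measurable_times_ennreal measurable_compose[OF measurable_fst borel_measurable_indicator]) auto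
    have "(\<integral>\<^sup>+\<omega>\<in>A. ennreal (?pe \<omega>) \<partial>M) = (\<integral>\<^sup>+\<omega>. h (sample n Z \<omega>, Zf \<omega>) * indicator T (fst (sample n Z \<omega>, Zf \<omega>)) \<partial>M)"
      by (intro nn_integral_cong) (simp add: h_def ind)
    also have "\<dots> = (\<integral>\<^sup>+p. h p * indicator T (fst p) \<partial>(distr M (sample_space n) (sample n Z) \<Otimes>\<^sub>M ?D))"
      unfolding S.distr_sample_future[symmetric] using hT sz by (subst nn_integral_distr) auto
    also have "\<dots> = (\<integral>\<^sup>+d. \<integral>\<^sup>+z. h (d, z) * indicator T (fst (d, z)) \<partial>?D \<partial>distr M (sample_space n) (sample n Z))"
    proof (rule D.nn_integral_fst[symmetric])
      have eq: "sets (distr M (sample_space n) (sample n Z) \<Otimes>\<^sub>M ?D) = sets (sample_space n \<Otimes>\<^sub>M obs_space)"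
        by (intro sets_pair_measure_cong) simp_all
      show "(\<lambda>p. h p * indicator T (fst p)) \<in> borel_measurable (distr M (sample_space n) (sample n Z) \<Otimes>\<^sub>M ?D)"
        unfolding measurable_cong_sets[OF eq refl] by (rule hT)
    qed
    also have "\<dots> = (\<integral>\<^sup>+d. ennreal (r d) * indicator T d \<partial>distr M (sample_space n) (sample n Z))"
    proof (rule nn_integral_cong)
      fix d assume "d \<in> space (distr M (sample_space n) (sample n Z))"
      then have "d \<in> space (sample_space n)" by simp
      then have "(\<lambda>z. h (d, z)) \<in> borel_measurable obs_space"
        using h by (rule measurable_Pair2[rotated])
      then show "(\<integral>\<^sup>+z. h (d, z) * indicator T (fst (d, z)) \<partial>?D) = ennreal (r d) * indicator T d"
        by (simp add: nn_integral_multc hr)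
    qed
    also have "\<dots> = (\<integral>\<^sup>+\<omega>. ennreal (r (sample n Z \<omega>)) * indicator T (sample n Z \<omega>) \<partial>M)"
      using rm T(1) S.measurable_sample by (subst nn_integral_distr) (auto intro!: borel_measurable_times_ennreal)
    also have "\<dots> = (\<integral>\<^sup>+\<omega>\<in>A. ennreal (r (sample n Z \<omega>)) \<partial>M)"
      by (intro nn_integral_cong) (simp add: ind)
    finally show "(\<integral>\<^sup>+\<omega>\<in>A. ennreal (?pe \<omega>) \<partial>M) = (\<integral>\<^sup>+\<omega>\<in>A. ennreal (r (sample n Z \<omega>)) \<partial>M)" .
  next
    show "(\<lambda>\<omega>. ennreal (?pe \<omega>)) \<in> borel_measurable M"
      using measurable_compose[OF sz h] by (simp add: h_def)
    show "(\<lambda>\<omega>. ennreal (r (sample n Z \<omega>))) \<in> borel_measurable F"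
      by (rule measurable_compose[OF sF rm])
  qed
  moreover have "AE \<omega> in M. (0::ennreal) = nn_cond_exp M F (\<lambda>\<omega>. ennreal (- ?pe \<omega>)) \<omega>"
    by (rule F.nn_cond_exp_charact) (simp_all add: ennreal_neg)
  ultimately show ?thesis
    unfolding rho2_def real_cond_exp_def F_def[symmetric]
  proof eventually_elim
    case (elim \<omega>)
    show ?case
      unfolding elim(1)[symmetric] elim(2)[symmetric] r_def[symmetric] by (simp add: r0)
  qed
qed

lemma char_distr_Z:
  assumes iid: "iid_sample_and_future M (distr P obs_space obs) n Z Zf" and i: "i < n"
  shows "(CLINT \<omega>|M. iexp (c0 * noise (Z i \<omega>) + (\<Sum>l<k. c l * score l (Z i \<omega>))))
    = of_real (exp (- (c0\<^sup>2 * resid_var + (\<Sum>l<k. (c l)\<^sup>2)) / 2))"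
proof -
  interpret S: iid_sample_and_future M "distr P obs_space obs" n Z Zf by (rule iid)
  let ?h = "\<lambda>z. iexp (c0 * noise z + (\<Sum>l<k. c l * score l z))"
  have h: "?h \<in> borel_measurable obs_space" by measurable
  have "(CLINT \<omega>|M. ?h (Z i \<omega>)) = (CLINT z|distr M obs_space (Z i). ?h z)"
    by (rule integral_distr[OF S.measurable_Z[OF i] h, symmetric])
  also have "\<dots> = (CLINT \<omega>|P. ?h (obs \<omega>))"
    unfolding S.sample_law[OF i] by (rule integral_distr[OF measurable_obs h])
  finally show ?thesis unfolding char_combination .
qed

text \<open>Since the rows are independent, the transform of a linear form in all entries is a
  product over the observations, and each factor is given by \<open>char_distr_Z\<close> with the
  coefficients of its own row.\<close>

lemma distr_data:
  assumes iid: "iid_sample_and_future M (distr P obs_space obs) n Z Zf"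
  shows "distr M (PiM ({..<n} \<times> {..k}) (\<lambda>_. borel)) (\<lambda>\<omega>. restrict (data (sample n Z \<omega>)) ({..<n} \<times> {..k}))
    = distr (std_gaussian ({..<n} \<times> {..k})) (PiM ({..<n} \<times> {..k}) (\<lambda>_. borel)) (scale_last n k (sqrt resid_var))"
proof -
  interpret S: iid_sample_and_future M "distr P obs_space obs" n Z Zf by (rule iid)
  let ?K = "{..<n} \<times> {..k}"
  show ?thesis
  proof (rule distr_eqI_linear_forms)
    show "(\<lambda>\<omega>. restrict (data (sample n Z \<omega>)) ?K) \<in> M \<rightarrow>\<^sub>M PiM ?K (\<lambda>_. borel)"
      using measurable_compose[OF S.measurable_sample measurable_data]
      by (intro measurable_restrict) auto
    show "scale_last n k (sqrt resid_var) \<in> std_gaussian ?K \<rightarrow>\<^sub>M PiM ?K (\<lambda>_. borel)"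
      by (rule measurable_scale_last)
    fix t :: "nat \<times> nat \<Rightarrow> real"
    let ?h = "\<lambda>i z. t (i, k) * noise z + (\<Sum>l<k. t (i, l) * score l z)"
    let ?v = "\<lambda>i. (t (i, k))\<^sup>2 * resid_var + (\<Sum>l<k. (t (i, l))\<^sup>2)"
    have "(\<Sum>q\<in>?K. t q * restrict (data (sample n Z \<omega>)) ?K q) = (\<Sum>i<n. ?h i (Z i \<omega>))" for \<omega>
    proof -
      have "(\<Sum>q\<in>?K. t q * restrict (data (sample n Z \<omega>)) ?K q) = (\<Sum>i<n. \<Sum>l\<le>k. t (i, l) * data (sample n Z \<omega>) (i, l))"
        by (simp add: sum.cartesian_product)
      also have "\<dots> = (\<Sum>i<n. ?h i (Z i \<omega>))"
        by (intro sum.cong refl) (simp add: lessThan_Suc_atMost[symmetric] data_def sample_def)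
      finally show ?thesis .
    qed
    then have "(CLINT \<omega>|M. iexp (\<Sum>q\<in>?K. t q * restrict (data (sample n Z \<omega>)) ?K q)) = (CLINT \<omega>|M. iexp (\<Sum>i<n. ?h i (Z i \<omega>)))"
      by (simp only:)
    also have "\<dots> = (\<Prod>i<n. CLINT \<omega>|M. iexp (?h i (Z i \<omega>)))"
    proof -
      have ind: "S.indep_vars (\<lambda>_. borel) (\<lambda>i \<omega>. ?h i (Z i \<omega>)) {..<n}"
        by (rule S.indep_vars_compose2[OF S.sample_indep]) measurable
      then have m: "(\<lambda>\<omega>. ?h i (Z i \<omega>)) \<in> borel_measurable M" if "i < n" for i
        using that by (auto simp: S.indep_vars_def)
      have c: "char (distr M borel g) 1 = (CLINT \<omega>|M. iexp (g \<omega>))" if "g \<in> borel_measurable M" for g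
        unfolding char_def using that by (subst integral_distr) auto
      have "(CLINT \<omega>|M. iexp (\<Sum>i<n. ?h i (Z i \<omega>))) = char (distr M borel (\<lambda>\<omega>. \<Sum>i<n. ?h i (Z i \<omega>))) 1"
        using m by (intro c[symmetric] borel_measurable_sum) auto
      also have "\<dots> = (\<Prod>i<n. char (distr M borel (\<lambda>\<omega>. ?h i (Z i \<omega>))) 1)"
        by (rule S.char_distr_sum[OF ind])
      also have "\<dots> = (\<Prod>i<n. CLINT \<omega>|M. iexp (?h i (Z i \<omega>)))"
        using m by (intro prod.cong refl c) auto
      finally show ?thesis .
    qed
    also have "\<dots> = (\<Prod>i<n. of_real (exp (- ?v i / 2)))"
      by (intro prod.cong refl char_distr_Z[OF iid]) simp
    also have "\<dots> = of_real (exp (- (\<Sum>i<n. ?v i) / 2))"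
      by (simp only: of_real_prod[symmetric] exp_sum[symmetric] finite_lessThan sum_negf[symmetric] sum_divide_distrib)
    also have "(\<Sum>i<n. ?v i) = (\<Sum>q\<in>?K. (if snd q = k then t q * sqrt resid_var else t q)\<^sup>2)"
    proof -
      have "(\<Sum>q\<in>?K. (if snd q = k then t q * sqrt resid_var else t q)\<^sup>2) = (\<Sum>i<n. \<Sum>l\<le>k. (if l = k then t (i, l) * sqrt resid_var else t (i, l))\<^sup>2)"
        by (simp only: sum.cartesian_product split_def prod.collapse)
      also have "\<dots> = (\<Sum>i<n. ?v i)"
        by (intro sum.cong refl) (simp add: lessThan_Suc_atMost[symmetric] power_mult_distrib resid_var_nonneg)
      finally show ?thesis ..
    qed
    also have "of_real (exp (- (\<Sum>q\<in>?K. (if snd q = k then t q * sqrt resid_var else t q)\<^sup>2) / 2))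
      = (CLINT x|std_gaussian ?K. iexp (\<Sum>q\<in>?K. (if snd q = k then t q * sqrt resid_var else t q) * x q))"
      by (rule char_std_gaussian[symmetric]) simp
    also have "\<dots> = (CLINT x|std_gaussian ?K. iexp (\<Sum>q\<in>?K. t q * scale_last n k (sqrt resid_var) x q))"
    proof -
      have "(\<Sum>q\<in>?K. (if snd q = k then t q * sqrt resid_var else t q) * x q) = (\<Sum>q\<in>?K. t q * scale_last n k (sqrt resid_var) x q)" for x
        unfolding scale_last_eq by (intro sum.cong) auto
      then show ?thesis by (simp only:)
    qed
    finally show "(CLINT \<omega>|M. iexp (\<Sum>q\<in>?K. t q * restrict (data (sample n Z \<omega>)) ?K q))
      = (CLINT x|std_gaussian ?K. iexp (\<Sum>q\<in>?K. t q * scale_last n k (sqrt resid_var) x q))" .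
  qed (auto intro: S.prob_space_axioms prob_space_std_gaussian)
qed

text \<open>Almost surely the deviation is a measurable function \<open>\<Phi>\<close> of the
  whitened data matrix. Only the law of that matrix matters then, and the event can be moved to a
  scaled standard Gaussian matrix.\<close>

lemma deviation_bound:
  assumes iid: "iid_sample_and_future M (distr P obs_space obs) n Z Zf"
    and k: "k < n" and \<epsilon>: "\<epsilon> > 0"
  shows "measure M {\<omega> \<in> space M. \<bar>rho2_hat n m (sample n Z \<omega>) - rho2 M n Z Zf m \<omega>\<bar> > \<epsilon>}
    \<le> (if resid_var = 0 then 0
       else 4 * exp (- (real n * (1 - real k / real n) *
              Psi (\<epsilon> / (2 * resid_var) * (1 - real k / real n)))))" (is "measure M ?E \<le> ?b")
proof -
  interpret S: iid_sample_and_future M "distr P obs_space obs" n Z Zf by (rule iid)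
  let ?K = "{..<n} \<times> {..k}"
  let ?P = "PiM ?K (\<lambda>_. borel :: real measure)"
  interpret G: prob_space "std_gaussian ?K" by (rule prob_space_std_gaussian)
  have mk: "msize m = k"
    using bij_betw_same_card[OF f] by (simp add: msize_def)
  define s where "s = sqrt resid_var"
  have s2: "s\<^sup>2 = resid_var" by (simp add: s_def resid_var_nonneg)
  define T where "T z = (\<Sum>l<k. (ls_coef {..<n} (columns z) k (\<lambda>i. z (i, k)) l)\<^sup>2)" for z
  define \<Phi> where "\<Phi> z = \<bar>sq_resid n k z / (real n - real k) * ((real n + 1) / (real n + 1 - real k)) - (resid_var + T z)\<bar>" for z
  define X where "X \<omega> = restrict (data (sample n Z \<omega>)) ?K" for \<omega>
  have X: "X \<in> M \<rightarrow>\<^sub>M ?P"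
    unfolding X_def[abs_def] using measurable_compose[OF S.measurable_sample measurable_data]
    by (intro measurable_restrict) auto
  have sl: "scale_last n k s \<in> std_gaussian ?K \<rightarrow>\<^sub>M ?P"
    unfolding s_def by (rule measurable_scale_last)
  have law: "distr M ?P X = distr (std_gaussian ?K) ?P (scale_last n k s)"
    unfolding X_def[abs_def] s_def by (rule distr_data[OF iid])
  have \<Phi>: "\<Phi> \<in> borel_measurable ?P"
  proof -
    have "T \<in> borel_measurable ?P"
      unfolding T_def[abs_def] by (intro borel_measurable_sum borel_measurable_power borel_measurable_ls_coef_columns)
    moreover have "sq_resid n k \<in> borel_measurable ?P" by (rule borel_measurable_sq_resid) simp
    ultimately show ?thesis
      unfolding \<Phi>_def[abs_def] by measurable
  qed
  have fr: "{z \<in> space ?P. full_rank {..<n} (columns z) k} \<in> sets ?P"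
    by (intro sets_Collect_full_rank measurable_component_singleton) auto
  have "AE z in std_gaussian ?K. full_rank {..<n} (columns (scale_last n k s z)) k"
    unfolding full_rank_scale_last using k by (intro AE_full_rank') auto
  then have "AE z in distr M ?P X. full_rank {..<n} (columns z) k"
    unfolding law by (subst AE_distr_iff[OF sl fr])
  then have "AE \<omega> in M. full_rank {..<n} (columns (X \<omega>)) k"
    by (rule AE_distrD[OF X])
  \<comment> \<open>The identity is tied to designs of full rank: elsewhere the estimator takes its
    default value.\<close>
  then have "AE \<omega> in M. \<bar>rho2_hat n m (sample n Z \<omega>) - rho2 M n Z Zf m \<omega>\<bar> = \<Phi> (X \<omega>)"
    using rho2_eq[OF iid]
  proof eventually_elim
    case (elim \<omega>)
    let ?d = "data (sample n Z \<omega>)"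
    have full: "full_rank {..<n} (columns ?d) k"
      using elim(1) by (subst full_rank_cong[of k "{..<n}" _ "columns (X \<omega>)"]) (auto simp: X_def)
    have "sq_resid n k ?d = sq_resid n k (X \<omega>)"
      by (intro sq_resid_cong) (auto simp: X_def)
    moreover have "T ?d = T (X \<omega>)"
      unfolding T_def by (intro sum.cong refl arg_cong[where f="\<lambda>x. x\<^sup>2"] ls_coef_cong) (auto simp: X_def)
    moreover have "(\<Sum>l<k. (tau (beta_tilde n m (sample n Z \<omega>)) l)\<^sup>2) = T ?d"
      unfolding T_def beta_tilde_full_rank[OF full] by (intro sum.cong refl) (simp add: tau_of_tau)
    ultimately show ?case
      unfolding elim(2) rho2_hat_def RSS_full_rank[OF full] mk \<Phi>_def by simp
  qed
  then have "AE \<omega> in M. \<omega> \<in> ?E \<longrightarrow> \<omega> \<in> {\<omega> \<in> space M. \<epsilon> < \<Phi> (X \<omega>)}"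
    by eventually_elim simp
  moreover have "{\<omega> \<in> space M. \<epsilon> < \<Phi> (X \<omega>)} \<in> sets M"
    using measurable_compose[OF X \<Phi>] by measurable
  ultimately have "measure M ?E \<le> measure M {\<omega> \<in> space M. \<epsilon> < \<Phi> (X \<omega>)}"
    by (rule S.finite_measure_mono_AE)
  also have "\<dots> = measure (distr M ?P X) {z \<in> space ?P. \<epsilon> < \<Phi> z}"
  proof -
    have "{z \<in> space ?P. \<epsilon> < \<Phi> z} \<in> sets ?P" using \<Phi> by measurable
    moreover have "X -` {z \<in> space ?P. \<epsilon> < \<Phi> z} \<inter> space M = {\<omega> \<in> space M. \<epsilon> < \<Phi> (X \<omega>)}"
      using measurable_space[OF X] by auto
    ultimately show ?thesis using X by (simp add: measure_distr)
  qed
  also have "\<dots> = measure (std_gaussian ?K) {z \<in> space (std_gaussian ?K). \<epsilon> < \<Phi> (scale_last n k s z)}"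
  proof -
    have "{z \<in> space ?P. \<epsilon> < \<Phi> z} \<in> sets ?P" using \<Phi> by measurable
    moreover have "scale_last n k s -` {z \<in> space ?P. \<epsilon> < \<Phi> z} \<inter> space (std_gaussian ?K) = {z \<in> space (std_gaussian ?K). \<epsilon> < \<Phi> (scale_last n k s z)}"
      using measurable_space[OF sl] by auto
    ultimately show ?thesis unfolding law using sl by (simp add: measure_distr)
  qed
  also have "\<dots> \<le> ?b"
  proof -
    \<comment> \<open>Both quantities are proportional to the noise variance, so the deviation is
      \<open>resid_var\<close> times the standard one. If \<open>resid_var\<close> is 0 it vanishes
      identically and the event is empty.\<close>
    have \<Phi>s: "\<Phi> (scale_last n k s z) = resid_var * \<bar>sq_resid n k z / (real n - real k) * ((real n + 1) / (real n + 1 - real k)) - (1 + T z)\<bar>" for z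
    proof -
      have "T (scale_last n k s z) = resid_var * T z"
        unfolding T_def ls_coef_scale_last by (simp add: power_mult_distrib s2 sum_distrib_left)
      then have "\<Phi> (scale_last n k s z) = \<bar>resid_var * (sq_resid n k z / (real n - real k) * ((real n + 1) / (real n + 1 - real k)) - (1 + T z))\<bar>"
        unfolding \<Phi>_def sq_resid_scale_last s2 by (simp add: algebra_simps)
      then show ?thesis using resid_var_nonneg by (simp only: abs_mult abs_of_nonneg)
    qed
    show ?thesis
    proof (cases "resid_var = 0")
      case True
      then show ?thesis using \<epsilon> by (simp add: \<Phi>s)
    next
      case False
      then have rv: "resid_var > 0" using resid_var_nonneg by linarith
      \<comment> \<open>Half of \<open>\<epsilon>\<close>, in units of the variance, for each of the
        two errors.\<close>
      define \<delta> where "\<delta> = \<epsilon> / (2 * resid_var)"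
      have \<delta>: "\<delta> > 0" using \<epsilon> rv by (simp add: \<delta>_def)
      have "\<epsilon> < resid_var * a \<longleftrightarrow> 2 * \<delta> < a" for a
        using rv by (simp add: \<delta>_def field_simps)
      then have "measure (std_gaussian ?K) {z \<in> space (std_gaussian ?K). \<epsilon> < \<Phi> (scale_last n k s z)}
        \<le> 4 * exp (- ((real n - real k) * Psi (\<delta> * ((real n - real k) / real n))))"
        using deviation_bound_std_gaussian[OF k \<delta>] unfolding \<Phi>s T_def by simp
      moreover have "real n * (1 - real k / real n) = real n - real k" "1 - real k / real n = (real n - real k) / real n"
        using k by (simp_all add: field_simps)
      ultimately show ?thesis using False by (simp add: \<delta>_def)
    qed
  qed
  finally show ?thesis .
qed

end

theorem theorem3p2:
  fixes P :: "'p measure" and M :: "'a measure"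
    and y u :: "'p \<Rightarrow> real" and x :: "nat \<Rightarrow> 'p \<Rightarrow> real"
    and \<beta> :: "nat \<Rightarrow> real" and \<sigma> :: real and \<Sigma> :: "nat \<Rightarrow> nat \<Rightarrow> real"
    and n :: nat and Z :: "nat \<Rightarrow> 'a \<Rightarrow> observation" and Zf :: "'a \<Rightarrow> observation"
    and m :: model and \<epsilon> :: real
  assumes "gaussian_linear_model P y u x \<beta> \<sigma> \<Sigma>"
    and "iid_sample_and_future M (distr P obs_space (\<lambda>\<omega>. (y \<omega>, \<lambda>j. x j \<omega>))) n Z Zf"
    and "finite {j. m j}"
    and "msize m < n - 1"
    and "\<epsilon> > 0"
  shows "measure M {\<omega> \<in> space M. \<bar>rho2_hat n m (sample n Z \<omega>) - rho2 M n Z Zf m \<omega>\<bar> > \<epsilon>}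
    \<le> (if sigma2 P y x m = 0 then 0
       else 4 * exp (- (real n * (1 - real (msize m) / real n) *
              Psi (\<epsilon> / (2 * sigma2 P y x m) * (1 - real (msize m) / real n)))))"
proof -
  interpret glm: gaussian_linear_model P y u x \<beta> \<sigma> \<Sigma> by fact
  define k where "k = msize m"
  obtain f where f: "bij_betw f {..<k} {j. m j}"
    using ex_bij_betw_nat_finite[OF assms(3)] by (auto simp: k_def msize_def atLeast0LessThan)
  have sym: "\<Sigma> i j = \<Sigma> j i" for i j
    unfolding glm.cov_x[symmetric] by (simp add: mult.commute)
  have pd: "(\<Sum>i<k. \<Sum>j<k. c i * \<Sigma> (f i) (f j) * c j) > 0" if nz: "\<exists>i<k. c i \<noteq> 0" for c
  proof -
    \<comment> \<open>Positive definiteness is formulated over sets of regressor indices;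
      \<open>c'\<close> carries the coefficients from positions below \<open>k\<close> to these
      indices.\<close>
    define c' where "c' j = c (the_inv_into {..<k} f j)" for j
    have c': "c' (f i) = c i" if "i < k" for i
      using f that by (simp add: c'_def the_inv_into_f_f bij_betw_def)
    have "(\<Sum>i\<in>{j. m j}. \<Sum>j\<in>{j. m j}. c' i * \<Sigma> i j * c' j) > 0"
    proof (rule glm.pos_def[OF assms(3)])
      obtain i where "i < k" "c i \<noteq> 0" using nz by blast
      then show "\<exists>j\<in>{j. m j}. c' j \<noteq> 0"
        using f c' by (intro bexI[of _ "f i"]) (auto simp: bij_betw_def)
    qed
    also have "(\<Sum>i\<in>{j. m j}. \<Sum>j\<in>{j. m j}. c' i * \<Sigma> i j * c' j) = (\<Sum>i<k. \<Sum>j<k. c' (f i) * \<Sigma> (f i) (f j) * c' (f j))"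
      by (simp only: sum.reindex_bij_betw[OF f, symmetric])
    also have "\<dots> = (\<Sum>i<k. \<Sum>j<k. c i * \<Sigma> (f i) (f j) * c j)"
      by (intro sum.cong refl) (simp add: c')
    finally show ?thesis .
  qed
  obtain A B where AB:
    "\<forall>i<k. \<forall>j<k. (\<Sum>a<k. \<Sum>b<k. A i a * \<Sigma> (f a) (f b) * A j b) = (if i = j then 1 else 0)"
    "\<forall>X. \<forall>i<k. (\<Sum>l<k. B i l * (\<Sum>j<k. A l j * X j)) = X i"
    "\<forall>w. \<forall>l<k. (\<Sum>i<k. A l i * (\<Sum>j<k. B i j * w j)) = w l"
    using whitening_exists[of "\<lambda>i j. \<Sigma> (f i) (f j)" k, OF sym pd] by blast
  interpret w: whitened_gaussian_model P y u x \<beta> \<sigma> \<Sigma> m k f A B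
      "\<lambda>l. \<Sum>j<k. A l j * glm.expectation (\<lambda>\<omega>. y \<omega> * x (f j) \<omega>)"
    using f AB by unfold_locales auto
  show ?thesis
    unfolding w.sigma2_eq k_def[symmetric]
    using assms(4) by (intro w.deviation_bound[OF assms(2)] assms(5)) (simp add: k_def)
qed

end
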